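(* Consider the dynamical model of the context, with $\eta\in(0,1)$ and the prior $\pi_1$ uniform on $\mathcal Q=\{0,1\}^d$. (Upper bound) If $r$ is $M$-Lipschitz in its first argument, then $R_T=\mathcal O\big(Md\ln(2/\eta)\,\eta T\big)$. (Lower bound) Moreover, if $\eta T=\Omega(1)$, there is some $M$-Lipschitz reward function $r$ and some transition matrix $P$ with $P(q,q)\ge 1-\eta$ for all $q\in\mathcal Q$ such that $R_T=\Omega\big(Md\ln(2/\eta)\,\eta T\big)$. The hidden constants in $\mathcal O(\cdot)$ and $\Omega(\cdot)$ depend only on the values of $\delta$ and $\gamma$ defined in the context. Here $g(T,\eta)=\mathcal O(f(T,\eta))$ means that there is a constant $c>0$ such that $g(T,\eta)\le c f(T,\eta)$ for all integers $T\ge1$ and all $\eta\in(0,1)$, and $g=\Omega(f)$ means $f=\mathcal O(g)$.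
   Context: Model. Let $d\ge1$, $\mathcal Q=\{0,1\}^d$, $[d]=\{1,\dots,d\}$; $x^{(i)}$ is the $i$-th component of a vector $x$; $\mathcal P(\mathcal Q)$ is the set of probability distributions on $\mathcal Q$. The quality process $(Q_t)_{t\ge1}$ is a Markov chain on $\mathcal Q$ with $Q_1\sim\pi_1$ and $\mathbb P(Q_{t+1}=q'\mid Q_t=q)=P(q,q')$, where $P(q,q)\ge 1-\eta$ for all $q$. Consumers $t=1,2,\dots$ have private i.i.d. preferences $\theta_t\in\Theta$ with known distribution, and i.i.d. noises $\varepsilon_t$; the sequences $(\theta_t)$, $(\varepsilon_t)$, $(Q_t)$ are mutually independent. There are a reward function $r:\mathcal Q\times\Theta\to\mathbb R$ and a feedback function $f(q,\theta,\varepsilon)=(f^{(i)}(q^{(i)},\varepsilon,\theta))_{i\in[d]}$ with values in a finite set $\mathcal Z\subset\mathbb R^d$; $\mathcal Z^{(i)}=\{z^{(i)}:z\in\mathcal Z\}$. Let $\mathcal H_t=(Z_1,\dots,Z_{t-1})$ be the history and $\pi_t$ the conditional distribution of $Q_t$ given $\mathcal H_t$ (consumers know the model, including $P$). Consumer $t$ buys iff $\mathbb E[r(Q_t,\theta_t)\mid\mathcal H_t,\theta_t]=\sum_{q}\pi_t(q)r(q,\theta_t)>0$. If she buys, she gets utility $u_t=r(Q_t,\theta_t)$ and posts the review $Z_t=f(Q_t,\theta_t,\varepsilon_t)$; otherwise $u_t=0$ and $Z_t=\ast$. Regret: $R_T=\sum_{t=1}^T\mathbb E[r(Q_t,\theta_t)_+-u_t]$,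 where $x_+=\max(x,0)$. $r$ is $M$-Lipschitz if $|r(q,\theta)-r(q',\theta)|\le M\|q-q'\|_1$ for all $q,q'\in\mathcal Q$, $\theta\in\Theta$. For $z\in\mathcal Z$, $\pi\in\mathcal P(\mathcal Q)$: $G^{(i)}(z^{(i)},\pi,q^{(i)})=\mathbb P[Z_t^{(i)}=z^{(i)}\mid\pi_t=\pi,Q_t^{(i)}=q^{(i)}]=\mathbb P\big(\sum_{q'}\pi(q')r(q',\theta)>0,\ f^{(i)}(q^{(i)},\varepsilon,\theta)=z^{(i)}\big)$, where $\theta,\varepsilon$ are distributed as $\theta_t,\varepsilon_t$. $$\delta=\min_{i,\,\pi\in\mathcal P(\mathcal Q)}\sum_{z^{(i)}\in\mathcal Z^{(i)}}|G^{(i)}(z^{(i)},\pi,1)-G^{(i)}(z^{(i)},\pi,0)|,\qquad \gamma=2\max_{i,\,\pi\in\mathcal P(\mathcal Q),\,z\in\mathcal Z}\left|\ln\frac{G^{(i)}(z^{(i)},\pi,1)}{G^{(i)}(z^{(i)},\pi,0)}\right|.$$ Assumptions in force. Purchase guarantee: $r$ is weakly increasing in each $q^{(i)}$, and $\mathbb P(r(q,\theta_t)>0)>0$ for every $q\in\mathcal Q$. Identifiability: for all $i$, $\pi\in\mathcal P(\mathcal Q)$, $q^{(i)}$, $G^{(i)}(\cdot,\pi,q^{(i)})>0$; and for $q^{(i)}\ne q'^{(i)}$ there is $z\in\mathcal Z$ with $G^{(i)}(z^{(i)},\pi,q^{(i)})\ne G^{(i)}(z^{(i)},\pi,q'^{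(i)})$.
   Formalization: Upper bound proved with max(1, ln(2/η)ηT), since R_1 need not vanish as η→0; lower bound for T≥2 (at T=1 regret is O(M√d)) and for 0<δ<2tanh(γ/4) (otherwise no market or zero regret), with Θ, the laws and f chosen along with r. *)

theory Defs
  imports "HOL-Probability.Probability"
begin

text \<open>
  Vectors indexed by \<open>{1..d}\<close> are extensional functions on \<open>{1..d}\<close>, because \<open>d\<close> is quantified
  inside the theorem.
\<close>

type_synonym vec = "nat \<Rightarrow> real"

definition qualities :: "nat \<Rightarrow> vec set" where
  "qualities d = {1..d} \<rightarrow>\<^sub>E {0, 1}"

definition beliefs :: "nat \<Rightarrow> vec pmf set" where
  "beliefs d = {\<pi>. set_pmf \<pi> \<subseteq> qualities d}"

text \<open>
  The data of the model other than the transition matrix.  The preference space is the space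
  of \<open>pref_law\<close>; \<open>feedback m i x e th\<close> is the \<open>i\<close>-th component of the feedback function at a quality
  whose \<open>i\<close>-th component is \<open>x\<close>.
\<close>

record ('th, 'e) market =
  dim :: nat
  pref_law :: "'th measure"
  noise_law :: "'e measure"
  reward :: "vec \<Rightarrow> 'th \<Rightarrow> real"
  feedback :: "nat \<Rightarrow> real \<Rightarrow> 'e \<Rightarrow> 'th \<Rightarrow> real"
  outcomes :: "vec set"

definition review_of :: "('th, 'e) market \<Rightarrow> vec \<Rightarrow> 'th \<Rightarrow> 'e \<Rightarrow> vec" where
  "review_of m q th e = (\<lambda>i\<in>{1..dim m}. feedback m i (q i) e th)"

definition well_formed :: "('th, 'e) market \<Rightarrow> bool" where
  "well_formed m \<longleftrightarrow>
     1 \<le> dim m \<and> prob_space (pref_law m) \<and> prob_space (noise_law m) \<and>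
     (\<forall>q\<in>qualities (dim m). reward m q \<in> borel_measurable (pref_law m)) \<and>
     (\<forall>i\<in>{1..dim m}. \<forall>x\<in>{0, 1}.
        (\<lambda>(th, e). feedback m i x e th) \<in> borel_measurable (pref_law m \<Otimes>\<^sub>M noise_law m)) \<and>
     finite (outcomes m) \<and> outcomes m \<subseteq> extensional {1..dim m} \<and>
     (\<forall>q\<in>qualities (dim m). \<forall>th\<in>space (pref_law m). \<forall>e\<in>space (noise_law m).
        review_of m q th e \<in> outcomes m)"

text \<open>
  The purchase rule for a belief given by its point masses.  Since \<open>\<theta>\<^sub>t\<close> is independent of
  \<open>(Q\<^sub>t, H\<^sub>t)\<close>, the sum is the conditional expectation of the reward given \<open>(H\<^sub>t, \<theta>\<^sub>t)\<close>.
\<close>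

definition buys :: "('th, 'e) market \<Rightarrow> (vec \<Rightarrow> real) \<Rightarrow> 'th \<Rightarrow> bool" where
  "buys m b th \<longleftrightarrow> (\<Sum>q\<in>qualities (dim m). b q * reward m q th) > 0"

definition G :: "('th, 'e) market \<Rightarrow> nat \<Rightarrow> real \<Rightarrow> vec pmf \<Rightarrow> real \<Rightarrow> real" where
  "G m i z \<pi> x =
     measure (pref_law m \<Otimes>\<^sub>M noise_law m)
       {(th, e) \<in> space (pref_law m \<Otimes>\<^sub>M noise_law m). buys m (pmf \<pi>) th \<and> feedback m i x e th = z}"

definition component_outcomes :: "('th, 'e) market \<Rightarrow> nat \<Rightarrow> real set" where
  "component_outcomes m i = (\<lambda>z. z i) ` outcomes m"

definition delta :: "('th, 'e) market \<Rightarrow> real" where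
  "delta m =
     (INF (i, \<pi>) \<in> {1..dim m} \<times> beliefs (dim m).
        \<Sum>z\<in>component_outcomes m i. \<bar>G m i z \<pi> 1 - G m i z \<pi> 0\<bar>)"

definition gamma :: "('th, 'e) market \<Rightarrow> real" where
  "gamma m =
     2 * (SUP (i, \<pi>, z) \<in> {1..dim m} \<times> beliefs (dim m) \<times> outcomes m.
            \<bar>ln (G m i (z i) \<pi> 1 / G m i (z i) \<pi> 0)\<bar>)"

text \<open>
  If the infimum \<open>delta\<close> is attained, as the notation \<open>min\<close> presupposes, then \<open>identifiable\<close> makes it
  positive.  The supremum \<open>gamma\<close> is always over a bounded set: by monotonicity of the reward, a
  consumer who buys at the belief concentrated at the zero vector buys at every belief, so
  \<open>G m i z \<pi> x\<close> is at least its (positive) value at that belief.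
\<close>

definition purchase_guarantee :: "('th, 'e) market \<Rightarrow> bool" where
  "purchase_guarantee m \<longleftrightarrow>
     (\<forall>q\<in>qualities (dim m). \<forall>i\<in>{1..dim m}. \<forall>th\<in>space (pref_law m).
        reward m (q(i := 0)) th \<le> reward m (q(i := 1)) th) \<and>
     (\<forall>q\<in>qualities (dim m). \<P>(th in pref_law m. reward m q th > 0) > 0)"

definition identifiable :: "('th, 'e) market \<Rightarrow> bool" where
  "identifiable m \<longleftrightarrow>
     (\<forall>i\<in>{1..dim m}. \<forall>\<pi>\<in>beliefs (dim m).
        (\<forall>x\<in>{0, 1}. \<forall>z\<in>component_outcomes m i. G m i z \<pi> x > 0) \<and>
        (\<forall>x\<in>{0, 1}. \<forall>x'\<in>{0, 1}. x \<noteq> x' \<longrightarrow> (\<exists>z\<in>outcomes m. G m i (z i) \<pi> x \<noteq> G m i (z i) \<pi> x')))"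

definition admissible :: "('th, 'e) market \<Rightarrow> bool" where
  "admissible m \<longleftrightarrow> well_formed m \<and> purchase_guarantee m \<and> identifiable m"

definition lipschitz_reward :: "('th, 'e) market \<Rightarrow> real \<Rightarrow> bool" where
  "lipschitz_reward m M \<longleftrightarrow>
     (\<forall>q\<in>qualities (dim m). \<forall>q'\<in>qualities (dim m). \<forall>th\<in>space (pref_law m).
        \<bar>reward m q th - reward m q' th\<bar> \<le> M * (\<Sum>i=1..dim m. \<bar>q i - q' i\<bar>))"

definition lazy_transition :: "nat \<Rightarrow> real \<Rightarrow> (vec \<Rightarrow> vec pmf) \<Rightarrow> bool" where
  "lazy_transition d \<eta> P \<longleftrightarrow>
     (\<forall>q\<in>qualities d. set_pmf (P q) \<subseteq> qualities d \<and> pmf (P q) q \<ge> 1 - \<eta>)"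

text \<open>Time starts at 1; the random variables with index 0 are never used.\<close>

record ('w, 'th, 'e) process =
  sample :: "'w measure"
  quality :: "nat \<Rightarrow> 'w \<Rightarrow> vec"
  preference :: "nat \<Rightarrow> 'w \<Rightarrow> 'th"
  noise :: "nat \<Rightarrow> 'w \<Rightarrow> 'e"

definition markov_chain ::
  "'w measure \<Rightarrow> vec set \<Rightarrow> vec pmf \<Rightarrow> (vec \<Rightarrow> vec pmf) \<Rightarrow> (nat \<Rightarrow> 'w \<Rightarrow> vec) \<Rightarrow> bool" where
  "markov_chain W S \<pi>\<^sub>1 P Q \<longleftrightarrow>
     (\<forall>t\<ge>1. Q t \<in> measurable W (count_space S)) \<and>
     (\<forall>q\<in>S. \<P>(w in W. Q 1 w = q) = pmf \<pi>\<^sub>1 q) \<and>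
     (\<forall>t\<ge>1. \<forall>x. (\<forall>s. x s \<in> S) \<longrightarrow> \<P>(w in W. \<forall>s\<in>{1..t}. Q s w = x s) > 0 \<longrightarrow>
        (\<forall>q\<in>S. \<P>(w in W. Q (Suc t) w = q \<bar> \<forall>s\<in>{1..t}. Q s w = x s) = pmf (P (x t)) q))"

definition iid :: "'w measure \<Rightarrow> 'b measure \<Rightarrow> (nat \<Rightarrow> 'w \<Rightarrow> 'b) \<Rightarrow> bool" where
  "iid W N X \<longleftrightarrow>
     prob_space.indep_vars W (\<lambda>_. N) X {1..} \<and> (\<forall>t\<ge>1. distr W N (X t) = N)"

definition path_events :: "'w measure \<Rightarrow> 'b measure \<Rightarrow> (nat \<Rightarrow> 'w \<Rightarrow> 'b) \<Rightarrow> 'w set set" where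
  "path_events W N X =
     sets (vimage_algebra (space W) (\<lambda>w. \<lambda>t\<in>{1..}. X t w) (Pi\<^sub>M {1..} (\<lambda>_. N)))"

definition dynamics ::
  "('th, 'e) market \<Rightarrow> vec pmf \<Rightarrow> (vec \<Rightarrow> vec pmf) \<Rightarrow> ('w, 'th, 'e) process \<Rightarrow> bool" where
  "dynamics m \<pi>\<^sub>1 P X \<longleftrightarrow>
     prob_space (sample X) \<and>
     markov_chain (sample X) (qualities (dim m)) \<pi>\<^sub>1 P (quality X) \<and>
     iid (sample X) (pref_law m) (preference X) \<and>
     iid (sample X) (noise_law m) (noise X) \<and>
     prob_space.indep_sets (sample X)
       (\<lambda>k. if k = 0 then path_events (sample X) (count_space (qualities (dim m))) (quality X)
            else if k = 1 then path_events (sample X) (pref_law m) (preference X)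
            else path_events (sample X) (noise_law m) (noise X))
       {0, 1, 2 :: nat}"

text \<open>
  \<open>reviews m X n w\<close> is the list \<open>[Z\<^sub>1, ..., Z\<^sub>n]\<close>, i.e. the history \<open>H\<close> at time \<open>n + 1\<close>; \<open>None\<close> stands for the
  absence of a purchase.  The belief used at time \<open>n + 1\<close> is the conditional law of the quality given this
  history, an elementary conditional probability because the history has finitely many values.
\<close>

definition posterior ::
  "'w measure \<Rightarrow> ('w \<Rightarrow> vec) \<Rightarrow> ('w \<Rightarrow> 'h) \<Rightarrow> 'w \<Rightarrow> vec \<Rightarrow> real" where
  "posterior W Qt H w q = \<P>(w' in W. Qt w' = q \<bar> H w' = H w)"

primrec reviews :: "('th, 'e) market \<Rightarrow> ('w, 'th, 'e) process \<Rightarrow> nat \<Rightarrow> 'w \<Rightarrow> vec option list" where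
  "reviews m X 0 = (\<lambda>w. [])"
| "reviews m X (Suc n) = (\<lambda>w. reviews m X n w @
     [if buys m (posterior (sample X) (quality X (Suc n)) (reviews m X n) w) (preference X (Suc n) w)
      then Some (review_of m (quality X (Suc n) w) (preference X (Suc n) w) (noise X (Suc n) w))
      else None])"

definition belief :: "('th, 'e) market \<Rightarrow> ('w, 'th, 'e) process \<Rightarrow> nat \<Rightarrow> 'w \<Rightarrow> vec \<Rightarrow> real" where
  "belief m X t = posterior (sample X) (quality X t) (reviews m X (t - 1))"

definition utility :: "('th, 'e) market \<Rightarrow> ('w, 'th, 'e) process \<Rightarrow> nat \<Rightarrow> 'w \<Rightarrow> real" where
  "utility m X t w =
     (if buys m (belief m X t w) (preference X t w)
      then reward m (quality X t w) (preference X t w) else 0)"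

definition regret :: "('th, 'e) market \<Rightarrow> ('w, 'th, 'e) process \<Rightarrow> nat \<Rightarrow> real" where
  "regret m X T =
     (\<Sum>t=1..T. \<integral>w. max (reward m (quality X t w) (preference X t w)) 0 - utility m X t w \<partial>sample X)"

definition uniform_prior :: "nat \<Rightarrow> vec pmf" where
  "uniform_prior d = pmf_of_set (qualities d)"

text \<open>
  Three boundary effects shape the regret bounds proved about this model.

  \<^item> The regret of the first consumer does not depend on \<open>\<eta>\<close>, hence is not of order
    \<open>M d ln(2/\<eta>) \<eta>\<close> as \<open>\<eta>\<close> tends to 0.  The upper bound therefore has \<open>max 1 (ln(2/\<eta>) \<eta> T)\<close>, which is
    at most a constant times \<open>ln(2/\<eta>) \<eta> T\<close> as soon as \<open>\<eta> T\<close> is bounded below.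
  \<^item> Under the uniform prior the reward at time 1 is within \<open>O(M sqrt d)\<close> of its mean on average, so for \<open>T = 1\<close>
    the regret is not of order \<open>M d\<close> uniformly in \<open>d\<close>.  The lower bound is for \<open>T \<ge> 2\<close>.
  \<^item> Every admissible market satisfies \<open>delta \<le> 2 tanh(gamma/4)\<close>, with equality only if all consumers
    always buy, in which case the regret is 0.  The lower bound is for every \<open>(\<delta>, \<gamma>)\<close> with
    \<open>0 < \<delta> < 2 tanh(\<gamma>/4)\<close>.
\<close>

end

theory Submission
  imports Defs
begin

text \<open>
  Upper bound: the regret of a consumer is at most \<open>2 M\<close> times the sum over the components \<open>i\<close> of the mean of
  \<open>min\<close> of the two posterior probabilities of the component.  This mean is the error of an optimal test
  of the component from the history, so it is at most the probability \<open>n \<eta>\<close> of a change within the last \<open>n\<close>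
  periods plus the Hellinger affinity of the histories under a constant component 0 and 1.  By
  identifiability every period multiplies the affinity by at most \<open>1 - \<delta>\<^sup>2 / 8\<close>; take \<open>n\<close> of order \<open>ln (2 / \<eta>)\<close>.

  Lower bound: with a noise that is common to all components, consumers see the whole quality vector or its
  complement.  The quality is reset to all ones or all zeros with probability \<open>\<eta>\<close>.  A switch from ones to zeros
  within the last \<open>n\<close> periods has prior odds of order \<open>\<eta>\<close> per period, and the reviews since then change
  the odds by a factor of at most \<open>exp (\<gamma> n / 2)\<close> either way.  So for \<open>n\<close> of order \<open>ln (1 / \<eta>)\<close> such a switch is
  undetected, which costs \<open>M d / 2\<close> with probability of order \<open>n \<eta>\<close>.
\<close>

section \<open>The market process\<close>

text \<open>Reviews are generated adaptively, which is the obstacle in both bounds. Once a history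
  \<open>h\<close> is fixed, however, the belief \<open>bel n h\<close> is a constant, and the next
  review is a function of the current quality and of a fresh pair of preference and noise,
  independent of the whole quality path and of all earlier reviews. Probabilities of histories thus
  multiply period by period along a quality path, and what remains is a bound per period that is
  uniform over beliefs, as \<open>delta\<close> and \<open>gamma\<close> provide. The Hellinger
  affinity is used because it contracts by a factor in each period of such an experiment. Only
  component \<open>i\<close> is held constant there; the other components move freely, so reviews
  with the same \<open>i\<close>-th entry are merged before \<open>delta\<close> is applied. In the
  lower bound, \<open>gamma\<close> being defined componentwise, independent noises would allow a
  likelihood ratio of \<open>exp (\<gamma> d / 2)\<close> per review; the common noise reduces a
  review of an extreme quality to one bit. The noise level is fixed by \<open>gamma\<close>, the
  share of consumers who always buy then adjusts \<open>delta\<close>, and only the transition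
  matrix depends on \<eta>.\<close>

lemma path_events_vimage:
  assumes X: "\<And>t. t \<ge> 1 \<Longrightarrow> X t \<in> measurable W N" and t: "t \<ge> 1" and A: "A \<in> sets N"
  shows "X t -` A \<inter> space W \<in> path_events W N X"
proof -
  let ?f = "\<lambda>w. \<lambda>t\<in>{1..}. X t w"
  have f: "?f \<in> space W \<rightarrow> space (Pi\<^sub>M {1..} (\<lambda>_. N))"
    by (intro measurable_space[of _ W, THEN funcsetI] measurable_restrict X) auto
  have "(\<lambda>x. x t) -` A \<inter> space (Pi\<^sub>M {1..} (\<lambda>_. N)) \<in> sets (Pi\<^sub>M {1..} (\<lambda>_. N))"
    using t A by (intro measurable_sets[of _ _ N]) auto
  moreover have "X t -` A \<inter> space W = ?f -` ((\<lambda>x. x t) -` A \<inter> space (Pi\<^sub>M {1..} (\<lambda>_. N))) \<inter> space W"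
  proof (intro equalityI subsetI)
    fix w assume "w \<in> X t -` A \<inter> space W"
    then show "w \<in> ?f -` ((\<lambda>x. x t) -` A \<inter> space (Pi\<^sub>M {1..} (\<lambda>_. N))) \<inter> space W"
      using funcset_mem[OF f, of w] t by simp
  qed (use t in simp)
  ultimately show ?thesis
    unfolding path_events_def sets_vimage_algebra2[OF f] by blast
qed

lemma sigma_algebra_path_events: "sigma_algebra (space W) (path_events W N X)"
  unfolding path_events_def by (metis sets.sigma_algebra_axioms space_vimage_algebra)

lemma Int_stable_vimages: "Int_stable {f -` A \<inter> \<Omega> | A. A \<in> sets N}"
  unfolding Int_stable_def
  by (auto, rule_tac x = "A \<inter> Aa" in exI, auto)

section \<open>Independence of the current consumer from the past\<close>

locale market_process = prob_space "sample X"
  for X :: "('w, 'th, 'e) process" +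
  fixes m :: "('th, 'e) market" and \<pi>\<^sub>1 :: "vec pmf" and P :: "vec \<Rightarrow> vec pmf"
  assumes dyn: "dynamics m \<pi>\<^sub>1 P X" and wf: "well_formed m"
begin

abbreviation W where "W \<equiv> sample X"
abbreviation S where "S \<equiv> qualities (dim m)"
abbreviation \<nu> where "\<nu> \<equiv> pref_law m \<Otimes>\<^sub>M noise_law m"

lemma measurable_quality [measurable]: "t \<ge> 1 \<Longrightarrow> quality X t \<in> measurable W (count_space S)"
  using dyn by (auto simp: dynamics_def markov_chain_def)

lemma measurable_preference [measurable]: "t \<ge> 1 \<Longrightarrow> preference X t \<in> measurable W (pref_law m)"
  using dyn by (auto simp: dynamics_def iid_def indep_vars_def)

lemma measurable_noise [measurable]: "t \<ge> 1 \<Longrightarrow> noise X t \<in> measurable W (noise_law m)"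
  using dyn by (auto simp: dynamics_def iid_def indep_vars_def)

lemma quality_in: "t \<ge> 1 \<Longrightarrow> w \<in> space W \<Longrightarrow> quality X t w \<in> S"
  using measurable_space[OF measurable_quality] by simp

abbreviation quality_events where
  "quality_events \<equiv> path_events W (count_space S) (quality X)"

text \<open>The quality path is kept as a single block \<open>(0, 0)\<close> because its values at
  different times are dependent; preferences \<open>(1, t)\<close> and noises \<open>(2, t)\<close>
  are split by time.\<close>

definition atoms :: "nat \<times> nat \<Rightarrow> 'w set set" where
  "atoms j =
     (if fst j = 0 then quality_events
      else if fst j = 1 then {preference X (snd j) -` A \<inter> space W | A. A \<in> sets (pref_law m)}
      else {noise X (snd j) -` A \<inter> space W | A. A \<in> sets (noise_law m)})"

text \<open>The whole quality path is included, its future too. Events that prescribe qualities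
  after period \<open>n\<close> thus belong to \<open>past n\<close> and are still independent of
  the preference and noise of consumer \<open>n + 1\<close>.\<close>

definition past_index :: "nat \<Rightarrow> (nat \<times> nat) set" where
  "past_index n = {(0, 0)} \<union> {1, 2} \<times> {1..n}"

definition past :: "nat \<Rightarrow> 'w set set" where
  "past n = sigma_sets (space W) (\<Union>j\<in>past_index n. atoms j)"

lemma prob_INT_iid:
  assumes "iid W N Y" "U \<subseteq> {1..}" "finite U" "U \<noteq> {}"
    and "\<forall>u\<in>U. A u \<in> {Y u -` A \<inter> space W | A. A \<in> sets N}"
  shows "prob (\<Inter>u\<in>U. A u) = (\<Prod>u\<in>U. prob (A u))"
proof -
  have "indep_sets (\<lambda>u. {Y u -` A \<inter> space W | A. A \<in> sets N}) {1..}"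
    using assms(1) unfolding iid_def indep_vars_def2 by blast
  then show ?thesis using assms by (intro indep_setsD[of _ "{1..}"]) auto
qed

text \<open>Independence of the three sequences splits an intersection into a quality, a preference
  and a noise part; within the last two parts the i.i.d. assumption splits it further by
  time.\<close>

lemma indep_atoms: "indep_sets atoms ({(0, 0)} \<union> {1, 2} \<times> {1..})"
proof (rule indep_setsI)
  define pe where "pe = (\<lambda>k::nat. if k = 0 then quality_events
       else if k = 1 then path_events W (pref_law m) (preference X)
       else path_events W (noise_law m) (noise X))"
  have ind: "indep_sets pe {0, 1, 2 :: nat}"
    using dyn unfolding dynamics_def pe_def by blast
  have sub: "atoms j \<subseteq> pe (fst j)" if "j \<in> {(0, 0)} \<union> {1, 2} \<times> {1..}" for j
    using that unfolding atoms_def pe_def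
    by (auto intro!: path_events_vimage measurable_preference measurable_noise)
  have alg: "sigma_algebra (space W) (pe k)" for k
    unfolding pe_def by (auto intro: sigma_algebra_path_events)
  show "atoms j \<subseteq> events" if j: "j \<in> {(0, 0)} \<union> {1, 2} \<times> {1..}" for j
  proof -
    have "fst j \<in> {0, 1, 2}" using j by auto
    then have "pe (fst j) \<subseteq> events" using ind unfolding indep_sets_def by blast
    then show ?thesis using sub[OF j] by blast
  qed
  fix A J assume J: "J \<noteq> {}" "J \<subseteq> {(0, 0)} \<union> {1, 2} \<times> {1..}" "finite J" and A: "\<forall>j\<in>J. A j \<in> atoms j"
  \<comment> \<open>The intersection over an empty block is \<open>UNIV\<close>; cutting down to
    \<open>space W\<close> turns it into the sure event.\<close>
  define B where "B k = (\<Inter>j\<in>{j\<in>J. fst j = k}. A j) \<inter> space W" for k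
  have B: "B k \<in> pe k" if "k \<in> {0,1,2}" for k
  proof -
    interpret p: sigma_algebra "space W" "pe k" by (rule alg)
    have A': "A j \<in> pe k" if "j \<in> J" "fst j = k" for j
    proof -
      have "j \<in> {(0, 0)} \<union> {1, 2} \<times> {1..}" using J(2) that(1) by (rule subsetD)
      from sub[OF this] show ?thesis using A that by auto
    qed
    show ?thesis
    proof (cases "{j\<in>J. fst j = k} = {}")
      case True
      then have "B k = space W" unfolding B_def by (simp only: INF_empty) simp
      then show ?thesis using p.top by simp
    next
      case False
      have "(\<Inter>j\<in>{j\<in>J. fst j = k}. A j) \<in> pe k"
        using False J A' by (intro p.finite_INT) auto
      then show ?thesis unfolding B_def by auto
    qed
  qed
  have space: "A j \<subseteq> space W" if "j \<in> J" for j
  proof -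
    have "j \<in> {(0, 0)} \<union> {1, 2} \<times> {1..}" using J(2) that(1) by (rule subsetD)
    from sub[OF this] have "A j \<in> pe (fst j)" using A that by auto
    then show ?thesis using alg[of "fst j"] unfolding sigma_algebra_iff2 by blast
  qed
  have "(\<Inter>j\<in>J. A j) = (\<Inter>k\<in>{0,1,2}. B k)"
  proof (intro equalityI subsetI)
    fix w assume w: "w \<in> (\<Inter>j\<in>J. A j)"
    obtain j where "j \<in> J" using J by auto
    then have "w \<in> space W" using w space by blast
    then show "w \<in> (\<Inter>k\<in>{0,1,2}. B k)" using w unfolding B_def by auto
  next
    fix w assume w: "w \<in> (\<Inter>k\<in>{0,1,2}. B k)"
    show "w \<in> (\<Inter>j\<in>J. A j)"
    proof
      fix j assume j: "j \<in> J"
      then have "fst j \<in> {0, 1, 2}" using J(2) by auto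
      then have "w \<in> B (fst j)" using w by (rule INT_D[rotated])
      then show "w \<in> A j" using j unfolding B_def by (cases j) auto
    qed
  qed
  then have "prob (\<Inter>j\<in>J. A j) = prob (\<Inter>k\<in>{0,1,2::nat}. B k)" by simp
  also have "\<dots> = (\<Prod>k\<in>{0,1,2}. prob (B k))"
    using B by (intro indep_setsD[OF ind]) auto
  also have "\<dots> = (\<Prod>k\<in>{0,1,2}. \<Prod>j\<in>{j\<in>J. fst j = k}. prob (A j))"
  proof (rule prod.cong[OF refl])
    have two: "prob ((\<Inter>j\<in>{j\<in>J. fst j = k}. A j) \<inter> space W) = (\<Prod>j\<in>{j\<in>J. fst j = k}. prob (A j))"
      if k: "k = 1 \<or> k = (2::nat)"
        and iid: "\<And>U. U \<subseteq> {1..} \<Longrightarrow> finite U \<Longrightarrow> U \<noteq> {} \<Longrightarrow> \<forall>u\<in>U. A (k, u) \<in> atoms (k, u) \<Longrightarrow>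
          prob (\<Inter>u\<in>U. A (k, u)) = (\<Prod>u\<in>U. prob (A (k, u)))" for k
    proof (cases "{j\<in>J. fst j = k} = {}")
      case True
      then show ?thesis by (simp only: INF_empty prod.empty) (simp add: prob_space)
    next
      case False
      define U where "U = snd ` {j\<in>J. fst j = k}"
      have JU: "{j\<in>J. fst j = k} = Pair k ` U" unfolding U_def by force
      have "U \<subseteq> {1..}" unfolding U_def using subsetD[OF J(2)] k by fastforce
      moreover have "finite U" "U \<noteq> {}" using J(3) False unfolding U_def by simp_all
      ultimately have U: "U \<subseteq> {1..}" "finite U" "U \<noteq> {}" by blast+
      have "\<forall>u\<in>U. A (k, u) \<in> atoms (k, u)" using A unfolding U_def by force
      then have "prob (\<Inter>u\<in>U. A (k, u)) = (\<Prod>u\<in>U. prob (A (k, u)))" using U by (intro iid)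
      moreover have "(\<Inter>j\<in>{j\<in>J. fst j = k}. A j) \<inter> space W = (\<Inter>u\<in>U. A (k, u))"
      proof -
        obtain u where u: "u \<in> U" using U by auto
        then have "(k, u) \<in> J" using JU by blast
        then show ?thesis using space[of "(k, u)"] u unfolding JU by auto
      qed
      ultimately show ?thesis unfolding JU by (simp add: prod.reindex inj_on_def)
    qed
    fix k :: nat assume "k \<in> {0, 1, 2}"
    then consider "k = 0" | "k = 1" | "k = 2" by auto
    then show "prob (B k) = (\<Prod>j\<in>{j\<in>J. fst j = k}. prob (A j))"
    proof cases
      case 1
      have "{j\<in>J. fst j = 0} \<subseteq> {(0,0)}" using J(2) by (auto dest!: subsetD)
      then consider "{j\<in>J. fst j = 0} = {}" | "{j\<in>J. fst j = 0} = {(0,0)}"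
        by (meson subset_singletonD)
      then show ?thesis
      proof cases
        case 2
        then have "(0, 0) \<in> J" by (metis (mono_tags, lifting) mem_Collect_eq singletonI)
        then have "A (0,0) \<subseteq> space W" by (rule space)
        then show ?thesis unfolding B_def 1 2 by (simp add: Int_absorb2)
      next
        case 1
        show ?thesis unfolding B_def \<open>k = 0\<close> 1 by (simp add: prob_space)
      qed
    next
      case 2
      have "iid W (pref_law m) (preference X)" using dyn by (simp add: dynamics_def)
      note iid = prob_INT_iid[OF this]
      show ?thesis unfolding B_def 2
        by (rule two, simp, rule iid) (simp_all add: atoms_def)
    next
      case 3
      have "iid W (noise_law m) (noise X)" using dyn by (simp add: dynamics_def)
      note iid = prob_INT_iid[OF this]
      show ?thesis unfolding B_def 3
        by (rule two, simp, rule iid) (simp_all add: atoms_def)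
    qed
  qed
  also have "\<dots> = (\<Prod>j\<in>J. prob (A j))"
    using J by (intro prod.group) auto
  finally show "prob (\<Inter>j\<in>J. A j) = (\<Prod>j\<in>J. prob (A j))" .
qed

lemma Int_stable_atoms: "Int_stable (atoms j)"
proof -
  have "Int_stable quality_events"
    using sigma_algebra_path_events[of W "count_space S" "quality X"]
    by (meson Int_stable_def sigma_algebra.axioms(1) algebra.axioms(1) ring_of_sets.axioms(1) semiring_of_sets.Int)
  then show ?thesis unfolding atoms_def by (simp add: Int_stable_vimages)
qed

text \<open>Disjoint groups of independent generators, each generator closed under intersection,
  generate independent sigma-algebras.\<close>

lemma indep_past:
  "indep_set (past n) (sigma_sets (space W) (\<Union>j\<in>{1, 2} \<times> {Suc n}. atoms j))"
proof -
  define I where "I = (\<lambda>b. if b then past_index n else {1, 2} \<times> {Suc n})"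
  have "(\<Union>j\<in>UNIV. I j) \<subseteq> {(0, 0)} \<union> {1, 2} \<times> {1..}"
    unfolding I_def past_index_def by (auto split: if_splits)
  then have "indep_sets atoms (\<Union>j\<in>UNIV. I j)"
    by (rule indep_sets_mono_index[OF _ indep_atoms])
  then have "indep_sets (\<lambda>j. sigma_sets (space W) (\<Union>i\<in>I j. atoms i)) UNIV"
    by (rule indep_sets_collect_sigma)
      (auto simp: Int_stable_atoms disjoint_family_on_def I_def past_index_def split: if_splits)
  moreover have "(\<lambda>j. sigma_sets (space W) (\<Union>i\<in>I j. atoms i)) =
      case_bool (past n) (sigma_sets (space W) (\<Union>j\<in>{1, 2} \<times> {Suc n}. atoms j))"
    by (rule ext) (simp add: I_def past_def split: bool.split)
  ultimately show ?thesis unfolding indep_set_def by simp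
qed

lemma sigma_algebra_past: "sigma_algebra (space W) (past n)"
  unfolding past_def
proof (rule sigma_algebra_sigma_sets)
  have "past_index n \<subseteq> {(0, 0)} \<union> {1, 2} \<times> {1..}" unfolding past_index_def by auto
  then have "\<forall>j\<in>past_index n. atoms j \<subseteq> events"
    using indep_atoms unfolding indep_sets_def by blast
  then show "(\<Union>j\<in>past_index n. atoms j) \<subseteq> Pow (space W)"
    using sets.sets_into_space by blast
qed

lemma past_events: "past n \<subseteq> events"
  using indep_past by (rule indep_setD_ev1)

lemma past_mono: "n \<le> k \<Longrightarrow> past n \<subseteq> past k"
  unfolding past_def past_index_def by (intro sigma_sets_mono') fastforce

lemma quality_in_past: "t \<ge> 1 \<Longrightarrow> {w\<in>space W. quality X t w \<in> A} \<in> past n"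
proof -
  assume t: "t \<ge> 1"
  have "quality X t -` (A \<inter> S) \<inter> space W \<in> quality_events"
    using t by (intro path_events_vimage measurable_quality) auto
  also have "quality X t -` (A \<inter> S) \<inter> space W = {w\<in>space W. quality X t w \<in> A}"
    using quality_in[OF t] by auto
  finally have "{w\<in>space W. quality X t w \<in> A} \<in> atoms (0,0)" by (simp add: atoms_def)
  then show ?thesis unfolding past_def past_index_def by (intro sigma_sets.Basic) auto
qed

lemma pair_vimage:
  assumes B: "B \<in> sets \<nu>" and u: "u \<ge> 1"
  shows "{w\<in>space W. (preference X u w, noise X u w) \<in> B} \<in> sigma_sets (space W) (\<Union>j\<in>{1, 2} \<times> {u}. atoms j)"
proof -
  let ?M = "sigma (space W) (\<Union>j\<in>{1, 2} \<times> {u}. atoms j)"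
  have sub: "(\<Union>j\<in>{1, 2} \<times> {u}. atoms j) \<subseteq> Pow (space W)"
    by (auto simp: atoms_def)
  have "preference X u \<in> measurable ?M (pref_law m)"
  proof (rule measurableI)
    fix A assume "A \<in> sets (pref_law m)"
    then have "preference X u -` A \<inter> space W \<in> (\<Union>j\<in>{1, 2} \<times> {u}. atoms j)"
      by (auto simp: atoms_def intro!: bexI[of _ "1::nat"])
    then show "preference X u -` A \<inter> space ?M \<in> sets ?M"
      using sub by (simp add: space_measure_of)
  qed (use u measurable_space[OF measurable_preference] sub in \<open>auto simp: space_measure_of\<close>)
  moreover have "noise X u \<in> measurable ?M (noise_law m)"
  proof (rule measurableI)
    fix A assume "A \<in> sets (noise_law m)"
    then have "noise X u -` A \<inter> space W \<in> (\<Union>j\<in>{1, 2} \<times> {u}. atoms j)"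
      by (auto simp: atoms_def intro!: bexI[of _ "2::nat"])
    then show "noise X u -` A \<inter> space ?M \<in> sets ?M"
      using sub by (simp add: space_measure_of)
  qed (use u measurable_space[OF measurable_noise] sub in \<open>auto simp: space_measure_of\<close>)
  ultimately have "(\<lambda>w. (preference X u w, noise X u w)) \<in> measurable ?M \<nu>" by measurable
  from measurable_sets[OF this B] show ?thesis
    using sub by (simp add: space_measure_of vimage_def Int_def conj_commute)
qed

lemma pair_in_past:
  assumes "B \<in> sets \<nu>" "u \<in> {1..n}"
  shows "{w\<in>space W. (preference X u w, noise X u w) \<in> B} \<in> past n"
proof -
  have "sigma_sets (space W) (\<Union>j\<in>{1, 2} \<times> {u}. atoms j) \<subseteq> past n"
    unfolding past_def past_index_def using assms by (intro sigma_sets_mono') fastforce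
  then show ?thesis using pair_vimage[of B u] assms by auto
qed

text \<open>Preference and noise of one period are independent, so the law of the pair agrees with
  the product measure on rectangles and hence everywhere.\<close>

lemma prob_pair:
  assumes B: "B \<in> sets \<nu>" and u: "u \<ge> 1"
  shows "prob {w\<in>space W. (preference X u w, noise X u w) \<in> B} = measure \<nu> B"
proof -
  interpret p: prob_space "pref_law m" using wf by (simp add: well_formed_def)
  interpret n: prob_space "noise_law m" using wf by (simp add: well_formed_def)
  let ?f = "\<lambda>w. (preference X u w, noise X u w)"
  have f: "?f \<in> measurable W \<nu>" using u by measurable
  have dist: "distr W (pref_law m) (preference X u) = pref_law m" "distr W (noise_law m) (noise X u) = noise_law m"
    using dyn u by (auto simp: dynamics_def iid_def)
  have "\<nu> = distr W \<nu> ?f"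
  proof (rule pair_measure_eqI)
    fix A C assume A: "A \<in> sets (pref_law m)" and C: "C \<in> sets (noise_law m)"
    let ?a = "preference X u -` A \<inter> space W" and ?c = "noise X u -` C \<inter> space W"
    have "\<forall>j\<in>{(1::nat,u),(2,u)}. (if fst j = 1 then ?a else ?c) \<in> atoms j"
      using A C by (auto simp: atoms_def)
    then have "prob (\<Inter>j\<in>{(1::nat,u),(2,u)}. (if fst j = 1 then ?a else ?c))
        = (\<Prod>j\<in>{(1::nat,u),(2,u)}. prob (if fst j = 1 then ?a else ?c))"
      using u by (intro indep_setsD[OF indep_atoms]) auto
    then have eq: "prob (?a \<inter> ?c) = prob ?a * prob ?c" by (simp add: Int_commute mult.commute)
    have "emeasure (distr W \<nu> ?f) (A \<times> C) = emeasure W (?f -` (A \<times> C) \<inter> space W)"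
      using f A C by (intro emeasure_distr) auto
    also have "?f -` (A \<times> C) \<inter> space W = ?a \<inter> ?c" by auto
    also have "emeasure W \<dots> = emeasure W ?a * emeasure W ?c"
      using eq by (simp add: emeasure_eq_measure ennreal_mult)
    also have "emeasure W ?a = emeasure (distr W (pref_law m) (preference X u)) A"
      using u A by (intro emeasure_distr[symmetric]) auto
    also have "emeasure W ?c = emeasure (distr W (noise_law m) (noise X u)) C"
      using u C by (intro emeasure_distr[symmetric]) auto
    finally show "emeasure (pref_law m) A * emeasure (noise_law m) C = emeasure (distr W \<nu> ?f) (A \<times> C)"
      by (simp add: dist)
  qed (auto intro: p.sigma_finite_measure_axioms n.sigma_finite_measure_axioms)
  then have "measure \<nu> B = measure (distr W \<nu> (\<lambda>w. (preference X u w, noise X u w))) B" by simp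
  also have "\<dots> = prob ((\<lambda>w. (preference X u w, noise X u w)) -` B \<inter> space W)"
    using u B by (intro measure_distr) auto
  finally show ?thesis by (simp add: vimage_def Int_def conj_commute)
qed

text \<open>Later computations with the randomness of consumer \<open>n + 1\<close> all go back to
  this product formula.\<close>

theorem prob_past_pair:
  assumes E: "E \<in> past n" and B: "B \<in> sets \<nu>"
  shows "prob (E \<inter> {w\<in>space W. (preference X (Suc n) w, noise X (Suc n) w) \<in> B}) = prob E * measure \<nu> B"
  using indep_setD[OF indep_past E pair_vimage[OF B]] prob_pair[OF B, of "Suc n"] by simp

end

section \<open>Finite histories and their likelihoods\<close>

lemma finite_qualities: "finite (qualities d)"
  unfolding qualities_def by (intro finite_PiE) auto

lemma qualities_component: "q \<in> qualities d \<Longrightarrow> i \<in> {1..d} \<Longrightarrow> q i \<in> {0, 1}"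
  unfolding qualities_def by (rule PiE_mem)

lemma qualities_nonempty: "qualities d \<noteq> {}"
  unfolding qualities_def by (subst PiE_eq_empty_iff) auto

lemma (in finite_measure) measure_partition:
  assumes A: "finite A" and E: "E \<in> sets M" and f: "\<And>x. x \<in> A \<Longrightarrow> {w\<in>space M. f w = x} \<in> sets M"
    and sub: "\<And>w. w \<in> E \<Longrightarrow> f w \<in> A"
  shows "measure M E = (\<Sum>x\<in>A. measure M (E \<inter> {w\<in>space M. f w = x}))"
proof -
  have "E = (\<Union>x\<in>A. E \<inter> {w\<in>space M. f w = x})"
    using sub sets.sets_into_space[OF E] by auto
  then have "measure M E = measure M (\<Union>x\<in>A. E \<inter> {w\<in>space M. f w = x})" by simp
  also have "\<dots> = (\<Sum>x\<in>A. measure M (E \<inter> {w\<in>space M. f w = x}))"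
    using A E f by (intro finite_measure_finite_Union) (auto simp: disjoint_family_on_def)
  finally show ?thesis .
qed

context market_process
begin

definition histories :: "nat \<Rightarrow> vec option list set" where
  "histories n = {h. set h \<subseteq> insert None (Some ` outcomes m) \<and> length h = n}"

text \<open>The posterior as a function of the history instead of the sample point: for a fixed
  history the purchase rule becomes a deterministic set of preferences.\<close>

definition bel :: "nat \<Rightarrow> vec option list \<Rightarrow> vec \<Rightarrow> real" where
  "bel n h q = \<P>(w in W. quality X (Suc n) w = q \<bar> reviews m X n w = h)"

definition review_event :: "nat \<Rightarrow> vec option list \<Rightarrow> vec \<Rightarrow> vec option \<Rightarrow> ('th \<times> 'e) set" where
  "review_event n h q z = {(th, e) \<in> space \<nu>.
     (if buys m (bel n h) th then Some (review_of m q th e) else None) = z}"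

abbreviation hist :: "nat \<Rightarrow> vec option list \<Rightarrow> 'w set" where
  "hist n h \<equiv> {w\<in>space W. reviews m X n w = h}"

lemma finite_histories: "finite (histories n)"
  using wf unfolding histories_def well_formed_def by (intro finite_lists_length_eq) auto

lemma length_reviews: "length (reviews m X n w) = n"
  by (induction n) auto

lemma reviews_Suc_eq:
  assumes "reviews m X n w = h"
  shows "reviews m X (Suc n) w = h @
    [if buys m (bel n h) (preference X (Suc n) w)
     then Some (review_of m (quality X (Suc n) w) (preference X (Suc n) w) (noise X (Suc n) w)) else None]"
proof -
  have "posterior W (quality X (Suc n)) (reviews m X n) w = bel n h"
    using assms by (auto simp: posterior_def bel_def)
  then show ?thesis using assms by simp
qed

lemma belief_eq: "belief m X (Suc n) w = bel n (reviews m X n w)"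
  by (auto simp: belief_def posterior_def bel_def)

lemma reviews_in_histories: "w \<in> space W \<Longrightarrow> reviews m X n w \<in> histories n"
proof (induction n)
  case (Suc n)
  have "review_of m (quality X (Suc n) w) (preference X (Suc n) w) (noise X (Suc n) w) \<in> outcomes m"
    using wf quality_in[of "Suc n" w] measurable_space[OF measurable_preference, of "Suc n" w]
      measurable_space[OF measurable_noise, of "Suc n" w] Suc(2)
    unfolding well_formed_def by simp
  then show ?case using Suc unfolding reviews_Suc_eq[OF refl] histories_def by auto
qed (auto simp: histories_def)

lemma measurable_reward [measurable]: "q \<in> S \<Longrightarrow> reward m q \<in> borel_measurable (pref_law m)"
  using wf by (simp add: well_formed_def)

lemma measurable_feedback:
  "i \<in> {1..dim m} \<Longrightarrow> x \<in> {0, 1} \<Longrightarrow> (\<lambda>(th, e). feedback m i x e th) \<in> borel_measurable \<nu>"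
  using wf unfolding well_formed_def by blast

lemma buys_sets: "{th\<in>space (pref_law m). buys m b th} \<in> sets (pref_law m)"
  unfolding buys_def by measurable

lemma buys_sets2: "{x\<in>space \<nu>. buys m b (fst x)} \<in> sets \<nu>"
proof -
  have "{x\<in>space \<nu>. buys m b (fst x)} = {th\<in>space (pref_law m). buys m b th} \<times> space (noise_law m)"
    by (auto simp: space_pair_measure)
  then show ?thesis using buys_sets by auto
qed

lemma feedback_sets:
  assumes "i \<in> {1..dim m}" "x \<in> {0, 1}"
  shows "{y\<in>space \<nu>. feedback m i x (snd y) (fst y) = c} \<in> sets \<nu>"
  using measurable_sets[OF measurable_feedback[OF assms], of "{c}"]
  by (simp add: vimage_def Int_def case_prod_beta conj_commute)

lemma review_sets:
  assumes q: "q \<in> S"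
  shows "{y\<in>space \<nu>. review_of m q (fst y) (snd y) = z} \<in> sets \<nu>"
proof (cases "z \<in> extensional {1..dim m}")
  case True
  have "{y\<in>space \<nu>. review_of m q (fst y) (snd y) = z} =
      {y\<in>space \<nu>. \<forall>i\<in>{1..dim m}. feedback m i (q i) (snd y) (fst y) = z i}"
    using True by (auto simp: review_of_def extensional_def fun_eq_iff restrict_def)
  also have "\<dots> \<in> sets \<nu>"
    using feedback_sets qualities_component[OF q] wf
    by (intro sets.sets_Collect_finite_All') (auto simp: well_formed_def)
  finally show ?thesis .
next
  case False
  then have "{y\<in>space \<nu>. review_of m q (fst y) (snd y) = z} = {}"
    by (auto simp: review_of_def)
  then show ?thesis by (metis sets.empty_sets)
qed

lemma review_event_sets: "q \<in> S \<Longrightarrow> review_event n h q z \<in> sets \<nu>"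
proof (cases z)
  case None
  have "review_event n h q z = space \<nu> - {x\<in>space \<nu>. buys m (bel n h) (fst x)}"
    by (auto simp: review_event_def None)
  then show ?thesis using buys_sets2 by auto
next
  case (Some v)
  assume q: "q \<in> S"
  have "review_event n h q z = {x\<in>space \<nu>. buys m (bel n h) (fst x)} \<inter> {y\<in>space \<nu>. review_of m q (fst y) (snd y) = v}"
    by (auto simp: review_event_def Some split: if_splits)
  then show ?thesis using buys_sets2 review_sets[OF q] by auto
qed

lemma pair_space: "n \<ge> 1 \<Longrightarrow> w \<in> space W \<Longrightarrow> (preference X n w, noise X n w) \<in> space \<nu>"
  using measurable_space[OF measurable_preference] measurable_space[OF measurable_noise]
  by (simp add: space_pair_measure)

lemma hist_Suc:
  assumes w: "w \<in> space W" "quality X (Suc n) w = q"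
  shows "reviews m X (Suc n) w = h @ [z] \<longleftrightarrow>
    reviews m X n w = h \<and> (preference X (Suc n) w, noise X (Suc n) w) \<in> review_event n h q z"
proof (cases "reviews m X n w = h")
  case True
  then show ?thesis unfolding reviews_Suc_eq[OF True] review_event_def
    using w pair_space[of "Suc n" w] by auto
qed auto

text \<open>Beliefs are probabilities of histories, which in turn depend on beliefs. The circularity
  is only apparent: for a fixed prefix \<open>h'\<close> the belief is a constant, and splitting by
  the current quality leaves a finite union of product events.\<close>

lemma hist_in_past: "hist n h \<in> past n"
proof (induction n arbitrary: h)
  case 0
  interpret p: sigma_algebra "space W" "past 0" by (rule sigma_algebra_past)
  show ?case by (cases "h = []") auto
next
  case (Suc n)
  interpret p: sigma_algebra "space W" "past (Suc n)" by (rule sigma_algebra_past)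
  show ?case
  proof (cases "h = []")
    case True
    then have "hist (Suc n) h = {}" using length_reviews[of "Suc n"] by (metis (mono_tags, lifting) Collect_empty_eq length_0_conv nat.simps(3))
    then show ?thesis using p.empty_sets by metis
  next
    case False
    then obtain h' z where h: "h = h' @ [z]" by (metis rev_exhaust)
    have "hist (Suc n) h = (\<Union>q\<in>S. hist n h' \<inter> {w\<in>space W. quality X (Suc n) w \<in> {q}} \<inter>
        {w\<in>space W. (preference X (Suc n) w, noise X (Suc n) w) \<in> review_event n h' q z})"
    proof (intro equalityI subsetI)
      fix w assume w: "w \<in> hist (Suc n) h"
      then show "w \<in> (\<Union>q\<in>S. hist n h' \<inter> {w\<in>space W. quality X (Suc n) w \<in> {q}} \<inter>
        {w\<in>space W. (preference X (Suc n) w, noise X (Suc n) w) \<in> review_event n h' q z})"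
        using quality_in[of "Suc n" w] hist_Suc[of w n _ h' z] unfolding h by auto
    next
      fix w assume "w \<in> (\<Union>q\<in>S. hist n h' \<inter> {w\<in>space W. quality X (Suc n) w \<in> {q}} \<inter>
        {w\<in>space W. (preference X (Suc n) w, noise X (Suc n) w) \<in> review_event n h' q z})"
      then show "w \<in> hist (Suc n) h"
        using hist_Suc[of w n _ h' z] unfolding h by (auto simp del: reviews.simps)
    qed
    also have "\<dots> \<in> past (Suc n)"
    proof (intro p.finite_UN p.Int)
      show "hist n h' \<in> past (Suc n)" using Suc past_mono[of n "Suc n"] by auto
      show "{w\<in>space W. quality X (Suc n) w \<in> {q}} \<in> past (Suc n)" for q
        by (rule quality_in_past) simp
      show "{w\<in>space W. (preference X (Suc n) w, noise X (Suc n) w) \<in> review_event n h' q z} \<in> past (Suc n)"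
        if "q \<in> S" for q
        using that by (intro pair_in_past review_event_sets) auto
    qed (rule finite_qualities)
    finally show ?thesis .
  qed
qed

lemma hist_events [measurable]: "hist n h \<in> events"
  using hist_in_past past_events by blast

lemma quality_events [measurable]: "t \<ge> 1 \<Longrightarrow> {w\<in>space W. quality X t w \<in> A} \<in> events"
  using quality_in_past[of t A 0] past_events by blast

lemma prob_hist_pair:
  assumes E: "E \<in> past n" and B: "B \<in> sets \<nu>"
  shows "prob (E \<inter> hist n h \<inter> {w\<in>space W. (preference X (Suc n) w, noise X (Suc n) w) \<in> B})
    = prob (E \<inter> hist n h) * measure \<nu> B"
proof -
  interpret p: sigma_algebra "space W" "past n" by (rule sigma_algebra_past)
  show ?thesis using E hist_in_past by (intro prob_past_pair B p.Int)
qed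

lemma prob_hist_Suc:
  assumes E: "E \<in> past n" and q: "q \<in> S" "\<And>w. w \<in> E \<Longrightarrow> quality X (Suc n) w = q"
  shows "prob (E \<inter> hist (Suc n) (h @ [z])) = prob (E \<inter> hist n h) * measure \<nu> (review_event n h q z)"
proof -
  have "E \<subseteq> space W" using E past_events sets.sets_into_space by blast
  then have "E \<inter> hist (Suc n) (h @ [z]) =
      E \<inter> hist n h \<inter> {w\<in>space W. (preference X (Suc n) w, noise X (Suc n) w) \<in> review_event n h q z}"
    using q hist_Suc[of _ n q h z] by (auto simp del: reviews.simps)
  then show ?thesis using prob_hist_pair[OF E review_event_sets[OF q(1)]] by (simp del: reviews.simps)
qed

text \<open>Likelihood of a history along a prescribed quality path. \<open>past 0\<close> consists
  of quality events only, so under \<open>E\<close> the pairs of all periods are still fresh and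
  each contributes its own factor.\<close>

lemma prob_trajectory_hist:
  assumes E: "E \<in> past 0" and y: "\<And>u. u \<in> {1..n} \<Longrightarrow> y u \<in> S"
    and Ey: "\<And>w u. w \<in> E \<Longrightarrow> u \<in> {1..n} \<Longrightarrow> quality X u w = y u" and h: "length h = n"
  shows "prob (E \<inter> hist n h) = prob E * (\<Prod>u<n. measure \<nu> (review_event u (take u h) (y (Suc u)) (h ! u)))"
  using y Ey h
proof (induction n arbitrary: h)
  case 0
  have "E \<subseteq> space W" using E past_events sets.sets_into_space by blast
  then have "E \<inter> hist 0 h = E" using 0 by auto
  then show ?case by simp
next
  case (Suc n)
  then obtain h' z where h: "h = h' @ [z]" "length h' = n" by (metis length_Suc_conv_rev)
  have "E \<in> past n" using E past_mono[of 0 n] by auto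
  then have "prob (E \<inter> hist (Suc n) h) = prob (E \<inter> hist n h') * measure \<nu> (review_event n h' (y (Suc n)) z)"
    unfolding h(1) using Suc by (intro prob_hist_Suc) auto
  also have "prob (E \<inter> hist n h') = prob E * (\<Prod>u<n. measure \<nu> (review_event u (take u h') (y (Suc u)) (h' ! u)))"
    using Suc h by (intro Suc.IH) auto
  also have "(\<Prod>u<n. measure \<nu> (review_event u (take u h') (y (Suc u)) (h' ! u)))
      = (\<Prod>u<n. measure \<nu> (review_event u (take u h) (y (Suc u)) (h ! u)))"
    using h by (intro prod.cong) (auto simp: nth_append)
  finally show ?case using h by (simp add: nth_append del: reviews.simps)
qed

lemma prob_hist_sum: "E \<in> events \<Longrightarrow> prob E = (\<Sum>h\<in>histories n. prob (E \<inter> hist n h))"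
  using sets.sets_into_space[of E W]
  by (intro measure_partition finite_histories hist_events reviews_in_histories) auto

definition trajectory :: "nat \<Rightarrow> (nat \<Rightarrow> vec) \<Rightarrow> 'w set" where
  "trajectory t y = {w\<in>space W. \<forall>s\<in>{1..t}. quality X s w = y s}"

lemma trajectory_in_past: "trajectory t y \<in> past n"
proof -
  interpret p: sigma_algebra "space W" "past n" by (rule sigma_algebra_past)
  have "{w\<in>space W. quality X s w \<in> {y s}} \<in> past n" if "s \<in> {1..t}" for s
    using that by (intro quality_in_past) auto
  then show ?thesis unfolding trajectory_def by (intro p.sets_Collect_finite_All) auto
qed

lemma trajectory_events [measurable]: "trajectory t y \<in> events"
  using trajectory_in_past past_events by blast

text \<open>Turns the conditional Markov property into a product formula that also covers
  trajectories of probability zero, on which \<open>markov_chain\<close> imposes nothing.\<close>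

lemma prob_trajectory_Suc:
  assumes t: "t \<ge> 1" and y: "\<And>s. s \<in> {1..Suc t} \<Longrightarrow> y s \<in> S"
  shows "prob (trajectory (Suc t) y) = prob (trajectory t y) * pmf (P (y t)) (y (Suc t))"
proof (cases "prob (trajectory t y) = 0")
  case True
  have "prob (trajectory (Suc t) y) \<le> prob (trajectory t y)"
    by (intro finite_measure_mono trajectory_events) (auto simp: trajectory_def)
  then show ?thesis using True by (simp add: measure_le_0_iff)
next
  case False
  \<comment> \<open>\<open>markov_chain\<close> quantifies over sequences with all values in
    \<open>S\<close>; outside the relevant periods \<open>y\<close> is replaced by a legal
    value.\<close>
  define x where "x s = (if s \<in> {1..Suc t} then y s else y 1)" for s
  have x: "\<forall>s. x s \<in> S" using y by (auto simp: x_def)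
  have trajectory_x: "trajectory t y = {w\<in>space W. \<forall>s\<in>{1..t}. quality X s w = x s}"
    unfolding trajectory_def x_def by auto
  have "\<P>(w in W. \<forall>s\<in>{1..t}. quality X s w = x s) > 0"
    using False unfolding trajectory_x[symmetric] by (simp add: zero_less_measure_iff)
  then have "\<P>(w in W. quality X (Suc t) w = y (Suc t) \<bar> \<forall>s\<in>{1..t}. quality X s w = x s) = pmf (P (x t)) (y (Suc t))"
    using dyn t x y[of "Suc t"] unfolding dynamics_def markov_chain_def by auto
  moreover have "{w\<in>space W. quality X (Suc t) w = y (Suc t) \<and> (\<forall>s\<in>{1..t}. quality X s w = x s)} = trajectory (Suc t) y"
    unfolding trajectory_def x_def by (auto simp: atLeastAtMostSuc_conv)
  ultimately have "prob (trajectory (Suc t) y) / prob (trajectory t y) = pmf (P (x t)) (y (Suc t))"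
    unfolding cond_prob_def trajectory_x by simp
  then show ?thesis using False t by (simp add: field_simps x_def)
qed

abbreviation paths :: "nat \<Rightarrow> (nat \<Rightarrow> vec) set" where
  "paths t \<equiv> {1..t} \<rightarrow>\<^sub>E S"

lemma finite_paths: "finite (paths t)"
  using finite_qualities by (intro finite_PiE) auto

lemma trajectory_eq_restrict: "w \<in> space W \<Longrightarrow> y \<in> paths t \<Longrightarrow> w \<in> trajectory t y \<longleftrightarrow> (\<lambda>s\<in>{1..t}. quality X s w) = y"
  unfolding trajectory_def by (auto simp: fun_eq_iff PiE_def extensional_def)

lemma prob_trajectory_sum:
  assumes E: "E \<in> events"
  shows "prob E = (\<Sum>y\<in>paths t. prob (E \<inter> trajectory t y))"
proof -
  have *: "trajectory t y = {w\<in>space W. (\<lambda>s\<in>{1..t}. quality X s w) = y}" if "y \<in> paths t" for y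
    using trajectory_eq_restrict[OF _ that] by (auto simp: trajectory_def)
  have "prob E = (\<Sum>y\<in>paths t. prob (E \<inter> {w\<in>space W. (\<lambda>s\<in>{1..t}. quality X s w) = y}))"
    using sets.sets_into_space[OF E] trajectory_events *[symmetric]
    by (intro measure_partition finite_paths E) (auto simp: quality_in)
  then show ?thesis by (simp add: * cong: sum.cong)
qed

end

section \<open>Upper bound\<close>

lemma Cauchy_Schwarz_sum_sqrt:
  fixes a b :: "'a \<Rightarrow> real"
  assumes "\<And>x. x \<in> A \<Longrightarrow> a x \<ge> 0" "\<And>x. x \<in> A \<Longrightarrow> b x \<ge> 0"
  shows "(\<Sum>x\<in>A. sqrt (a x * b x)) \<le> sqrt ((\<Sum>x\<in>A. a x) * (\<Sum>x\<in>A. b x))"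
proof (rule real_le_rsqrt)
  have "(\<Sum>x\<in>A. sqrt (a x * b x))\<^sup>2 = (\<Sum>x\<in>A. sqrt (a x) * sqrt (b x))\<^sup>2"
    by (simp add: real_sqrt_mult)
  also have "\<dots> \<le> (\<Sum>x\<in>A. (sqrt (a x))\<^sup>2) * (\<Sum>x\<in>A. (sqrt (b x))\<^sup>2)"
    by (rule Cauchy_Schwarz_ineq_sum)
  also have "\<dots> = (\<Sum>x\<in>A. a x) * (\<Sum>x\<in>A. b x)"
    using assms by simp
  finally show "(\<Sum>x\<in>A. sqrt (a x * b x))\<^sup>2 \<le> (\<Sum>x\<in>A. a x) * (\<Sum>x\<in>A. b x)" .
qed

text \<open>With \<open>s\<close> the affinity, Cauchy-Schwarz applied to
  \<open>a - b = (sqrt a - sqrt b) * (sqrt a + sqrt b)\<close> gives \<open>\<delta>\<^sup>2 \<le>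
  (2 * \<beta> - 2 * s) * (2 * \<beta> + 2 * s)\<close>, and the second factor is at most 4. The
  common mass \<beta> may be less than 1 because a consumer may not buy.\<close>

lemma affinity_le:
  fixes a b :: "'a \<Rightarrow> real"
  assumes nonneg: "\<And>x. x \<in> A \<Longrightarrow> a x \<ge> 0" "\<And>x. x \<in> A \<Longrightarrow> b x \<ge> 0"
    and sum: "(\<Sum>x\<in>A. a x) = \<beta>" "(\<Sum>x\<in>A. b x) = \<beta>" "\<beta> \<le> 1"
    and \<delta>: "0 \<le> \<delta>" "\<delta> \<le> (\<Sum>x\<in>A. \<bar>a x - b x\<bar>)"
  shows "(\<Sum>x\<in>A. sqrt (a x * b x)) \<le> \<beta> - \<delta>\<^sup>2 / 8"
proof -
  define s where "s = (\<Sum>x\<in>A. sqrt (a x * b x))"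
  have eq: "(\<Sum>x\<in>A. (sqrt (a x) - sqrt (b x))\<^sup>2) = 2 * \<beta> - 2 * s"
    "(\<Sum>x\<in>A. (sqrt (a x) + sqrt (b x))\<^sup>2) = 2 * \<beta> + 2 * s"
  proof -
    have "(\<Sum>x\<in>A. (sqrt (a x) - sqrt (b x))\<^sup>2) = (\<Sum>x\<in>A. a x + b x - 2 * sqrt (a x * b x))"
      "(\<Sum>x\<in>A. (sqrt (a x) + sqrt (b x))\<^sup>2) = (\<Sum>x\<in>A. a x + b x + 2 * sqrt (a x * b x))"
      by (intro sum.cong; simp add: power2_diff power2_sum nonneg real_sqrt_mult)+
    then show "(\<Sum>x\<in>A. (sqrt (a x) - sqrt (b x))\<^sup>2) = 2 * \<beta> - 2 * s"
      "(\<Sum>x\<in>A. (sqrt (a x) + sqrt (b x))\<^sup>2) = 2 * \<beta> + 2 * s"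
      using sum unfolding s_def sum_distrib_left by (simp_all add: sum.distrib sum_subtractf)
  qed
  have "\<delta> \<le> (\<Sum>x\<in>A. \<bar>sqrt (a x) - sqrt (b x)\<bar> * \<bar>sqrt (a x) + sqrt (b x)\<bar>)"
  proof -
    have "\<bar>sqrt (a x) - sqrt (b x)\<bar> * \<bar>sqrt (a x) + sqrt (b x)\<bar> = \<bar>a x - b x\<bar>" if "x \<in> A" for x
    proof -
      have "(sqrt (a x) - sqrt (b x)) * (sqrt (a x) + sqrt (b x)) = a x - b x"
        using nonneg[OF that] by (simp add: algebra_simps)
      then show ?thesis by (metis abs_mult)
    qed
    then show ?thesis using \<delta>(2) by simp
  qed
  then have "\<delta>\<^sup>2 \<le> (\<Sum>x\<in>A. \<bar>sqrt (a x) - sqrt (b x)\<bar> * \<bar>sqrt (a x) + sqrt (b x)\<bar>)\<^sup>2"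
    using \<delta>(1) by (intro power_mono)
  also have "\<dots> \<le> (\<Sum>x\<in>A. \<bar>sqrt (a x) - sqrt (b x)\<bar>\<^sup>2) * (\<Sum>x\<in>A. \<bar>sqrt (a x) + sqrt (b x)\<bar>\<^sup>2)"
    by (rule Cauchy_Schwarz_ineq_sum)
  also have "\<dots> = (2 * \<beta> - 2 * s) * (2 * \<beta> + 2 * s)" using eq by simp
  finally have 1: "\<delta>\<^sup>2 \<le> (2 * \<beta> - 2 * s) * (2 * \<beta> + 2 * s)" .
  have "0 \<le> (\<Sum>x\<in>A. (sqrt (a x) - sqrt (b x))\<^sup>2)" by (intro sum_nonneg) auto
  then have 2: "s \<le> \<beta>" using eq by simp
  have "(2 * \<beta> - 2 * s) * (2 * \<beta> + 2 * s) \<le> (2 * \<beta> - 2 * s) * 4"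
    using 2 sum(3) by (intro mult_left_mono) auto
  then show ?thesis using 1 unfolding s_def by simp
qed

context market_process
begin

lemma prob_hist_zero_Int: "prob (hist n h) = 0 \<Longrightarrow> prob (E \<inter> hist n h) = 0"
  using finite_measure_mono[of "E \<inter> hist n h" "hist n h"] hist_events by (simp add: measure_le_0_iff)

lemma bel_eq: "bel n h q = prob ({w\<in>space W. quality X (Suc n) w = q} \<inter> hist n h) / prob (hist n h)"
  unfolding bel_def cond_prob_def by (simp add: Int_def conj_ac cong: conj_cong)

lemma bel_nonneg: "bel n h q \<ge> 0"
  unfolding bel_eq by simp

lemma measure_quality_sum:
  "(\<Sum>q\<in>S. prob ({w\<in>space W. quality X (Suc n) w = q} \<inter> hist n h)) = prob (hist n h)"
proof -
  have "prob (hist n h) = (\<Sum>q\<in>S. prob (hist n h \<inter> {w\<in>space W. quality X (Suc n) w = q}))"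
    using quality_events[of "Suc n" "{q}" for q]
    by (intro measure_partition finite_qualities hist_events) (auto intro: quality_in)
  then show ?thesis by (simp add: Int_commute)
qed

lemma bel_sum: "prob (hist n h) > 0 \<Longrightarrow> (\<Sum>q\<in>S. bel n h q) = 1"
  unfolding bel_eq by (simp add: sum_divide_distrib[symmetric] measure_quality_sum)

lemma bel_outside: "q \<notin> S \<Longrightarrow> bel n h q = 0"
proof -
  assume "q \<notin> S"
  then have "{w\<in>space W. quality X (Suc n) w = q} = {}" using quality_in[of "Suc n"] by auto
  then show ?thesis unfolding bel_eq by (simp only: Int_empty_left) simp
qed

text \<open>\<open>delta\<close> ranges over beliefs of type \<open>vec pmf\<close>, whereas a
  posterior is a real function; on a history of probability zero it vanishes identically and is no
  belief.\<close>

lemma bel_pmf: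
  assumes "prob (hist n h) > 0"
  obtains \<pi> where "\<pi> \<in> beliefs (dim m)" "pmf \<pi> = bel n h"
proof -
  have "(\<integral>\<^sup>+q. ennreal (bel n h q) \<partial>count_space UNIV) = (\<Sum>q\<in>S. ennreal (bel n h q))"
    using bel_outside by (intro nn_integral_count_space' finite_qualities) auto
  also have "\<dots> = ennreal (\<Sum>q\<in>S. bel n h q)" by (intro sum_ennreal bel_nonneg)
  finally have 1: "(\<integral>\<^sup>+q. ennreal (bel n h q) \<partial>count_space UNIV) = 1" using bel_sum[OF assms] by simp
  show ?thesis
  proof (rule that)
    show "embed_pmf (bel n h) \<in> beliefs (dim m)"
      unfolding beliefs_def using set_embed_pmf[OF bel_nonneg 1] bel_outside by auto
    show "pmf (embed_pmf (bel n h)) = bel n h" using pmf_embed_pmf[OF bel_nonneg 1] by auto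
  qed
qed

definition buy_prob :: "(vec \<Rightarrow> real) \<Rightarrow> real" where
  "buy_prob b = measure \<nu> {x\<in>space \<nu>. buys m b (fst x)}"

sublocale pair: prob_space \<nu>
proof -
  interpret p: prob_space "pref_law m" using wf by (simp add: well_formed_def)
  interpret n: prob_space "noise_law m" using wf by (simp add: well_formed_def)
  interpret pair_prob_space "pref_law m" "noise_law m" ..
  show "prob_space \<nu>" by (rule prob_space_axioms)
qed

lemma qualities_with_component:
  assumes "i \<in> {1..d}" "x \<in> {0, 1}"
  obtains q where "q \<in> qualities d" "q i = x"
  using assms that[of "\<lambda>j\<in>{1..d}. x"] unfolding qualities_def by auto

lemma feedback_component:
  assumes i: "i \<in> {1..dim m}" and x: "x \<in> {0, 1}" and y: "y \<in> space \<nu>"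
  shows "feedback m i x (snd y) (fst y) \<in> component_outcomes m i"
proof -
  obtain q where q: "q \<in> S" "q i = x" using qualities_with_component[OF i x] by blast
  have "review_of m q (fst y) (snd y) \<in> outcomes m"
    using wf q y by (auto simp: well_formed_def space_pair_measure)
  moreover have "review_of m q (fst y) (snd y) i = feedback m i x (snd y) (fst y)"
    using i q by (simp add: review_of_def)
  ultimately show ?thesis unfolding component_outcomes_def by (metis imageI)
qed

lemma finite_component_outcomes: "finite (component_outcomes m i)"
  using wf by (simp add: component_outcomes_def well_formed_def)

lemma G_eq: "G m i z \<pi> x = measure \<nu> {y\<in>space \<nu>. buys m (pmf \<pi>) (fst y) \<and> feedback m i x (snd y) (fst y) = z}"
  unfolding G_def by (intro arg_cong[where f = "measure \<nu>"]) auto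

lemma G_sets:
  assumes "i \<in> {1..dim m}" "x \<in> {0, 1}"
  shows "{y\<in>space \<nu>. buys m b (fst y) \<and> feedback m i x (snd y) (fst y) = z} \<in> sets \<nu>"
  using buys_sets2[of b] feedback_sets[OF assms, of z] by (intro sets.sets_Collect_conj)

lemma G_sum:
  assumes i: "i \<in> {1..dim m}" and x: "x \<in> {0, 1}"
  shows "(\<Sum>z\<in>component_outcomes m i. G m i z \<pi> x) = buy_prob (pmf \<pi>)"
proof -
  have "buy_prob (pmf \<pi>) = (\<Sum>z\<in>component_outcomes m i. measure \<nu> ({y\<in>space \<nu>. buys m (pmf \<pi>) (fst y)}
      \<inter> {y\<in>space \<nu>. feedback m i x (snd y) (fst y) = z}))"
    unfolding buy_prob_def using feedback_component[OF i x] feedback_sets[OF i x]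
    by (intro pair.measure_partition finite_component_outcomes buys_sets2) auto
  also have "\<dots> = (\<Sum>z\<in>component_outcomes m i. G m i z \<pi> x)"
    unfolding G_eq by (intro sum.cong arg_cong[where f = "measure \<nu>"]) auto
  finally show ?thesis by simp
qed

lemma delta_le:
  assumes "i \<in> {1..dim m}" "\<pi> \<in> beliefs (dim m)"
  shows "delta m \<le> (\<Sum>z\<in>component_outcomes m i. \<bar>G m i z \<pi> 1 - G m i z \<pi> 0\<bar>)"
  unfolding delta_def
  by (rule cINF_lower2[of _ _ "(i, \<pi>)"]) (use assms in \<open>auto intro!: bdd_belowI[of _ 0] sum_nonneg\<close>)

text \<open>A non-purchase has the same probability under both values of the component and
  contributes it in full; only the reviews separate the two values.\<close>

lemma affinity_G:
  assumes i: "i \<in> {1..dim m}" and \<pi>: "\<pi> \<in> beliefs (dim m)" and \<delta>: "0 \<le> \<delta>" "\<delta> \<le> delta m"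
  shows "(1 - buy_prob (pmf \<pi>)) + (\<Sum>z\<in>component_outcomes m i. sqrt (G m i z \<pi> 0 * G m i z \<pi> 1)) \<le> 1 - \<delta>\<^sup>2 / 8"
proof -
  have "(\<Sum>z\<in>component_outcomes m i. sqrt (G m i z \<pi> 0 * G m i z \<pi> 1)) \<le> buy_prob (pmf \<pi>) - \<delta>\<^sup>2 / 8"
    using delta_le[OF i \<pi>] \<delta>
    by (intro affinity_le G_sum i) (auto simp: G_def buy_prob_def abs_minus_commute)
  then show ?thesis by simp
qed

lemma sum_histories_Suc:
  "(\<Sum>h\<in>histories (Suc n). f h) = (\<Sum>h\<in>histories n. f (h @ [None]) + (\<Sum>v\<in>outcomes m. f (h @ [Some v])))"
proof -
  have fin: "finite (outcomes m)" using wf by (simp add: well_formed_def)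
  have "histories (Suc n) = (\<lambda>(h, z). h @ [z]) ` (histories n \<times> insert None (Some ` outcomes m))"
  proof (intro equalityI subsetI)
    fix h assume h: "h \<in> histories (Suc n)"
    then obtain h' z where "h = h' @ [z]" "length h' = n"
      by (auto simp: histories_def length_Suc_conv_rev)
    then show "h \<in> (\<lambda>(h, z). h @ [z]) ` (histories n \<times> insert None (Some ` outcomes m))"
      using h by (force simp: histories_def)
  qed (auto simp: histories_def)
  then have "(\<Sum>h\<in>histories (Suc n). f h) = (\<Sum>(h, z)\<in>histories n \<times> insert None (Some ` outcomes m). f (h @ [z]))"
    by (simp add: sum.reindex inj_on_def case_prod_beta)
  also have "\<dots> = (\<Sum>h\<in>histories n. \<Sum>z\<in>insert None (Some ` outcomes m). f (h @ [z]))"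
    by (simp add: sum.cartesian_product)
  also have "\<dots> = (\<Sum>h\<in>histories n. f (h @ [None]) + (\<Sum>v\<in>outcomes m. f (h @ [Some v])))"
    using fin by (intro sum.cong refl) (subst sum.insert, auto simp: sum.reindex)
  finally show ?thesis .
qed

lemma prob_hist_None:
  assumes E: "E \<in> past n"
  shows "prob (E \<inter> hist (Suc n) (h @ [None])) \<le> prob (E \<inter> hist n h) * (1 - buy_prob (bel n h))"
proof -
  let ?B = "{x\<in>space \<nu>. \<not> buys m (bel n h) (fst x)}"
  have B: "?B \<in> sets \<nu>" using buys_sets2 by (intro sets.sets_Collect_neg)
  have eq: "measure \<nu> ?B = 1 - buy_prob (bel n h)"
    unfolding buy_prob_def by (rule pair.prob_neg) (rule buys_sets2)
  have E': "E \<in> events" using E past_events by blast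
  have "E \<inter> hist (Suc n) (h @ [None]) \<subseteq> E \<inter> hist n h \<inter> {w\<in>space W. (preference X (Suc n) w, noise X (Suc n) w) \<in> ?B}"
    using hist_Suc[OF _ refl, of _ n h None] pair_space[of "Suc n"]
    by (auto simp: review_event_def split: if_splits simp del: reviews.simps)
  moreover have "{w\<in>space W. (preference X (Suc n) w, noise X (Suc n) w) \<in> ?B} \<in> events"
    using pair_in_past[OF B, of "Suc n" "Suc n"] past_events by auto
  ultimately have "prob (E \<inter> hist (Suc n) (h @ [None])) \<le>
      prob (E \<inter> hist n h \<inter> {w\<in>space W. (preference X (Suc n) w, noise X (Suc n) w) \<in> ?B})"
    using E' by (intro finite_measure_mono) auto
  then show ?thesis unfolding prob_hist_pair[OF E B] eq .
qed

text \<open>After merging the reviews by their \<open>i\<close>-th entry, the law of that entry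
  depends on the quality through component \<open>i\<close> alone, so \<open>E\<close> has to fix
  this component only.\<close>

lemma prob_hist_component:
  assumes E: "E \<in> past n" and i: "i \<in> {1..dim m}" and x: "x \<in> {0, 1}"
    and Ex: "\<And>w. w \<in> E \<Longrightarrow> quality X (Suc n) w i = x" and \<pi>: "pmf \<pi> = bel n h"
  shows "(\<Sum>v\<in>{v\<in>outcomes m. v i = z}. prob (E \<inter> hist (Suc n) (h @ [Some v]))) \<le> prob (E \<inter> hist n h) * G m i z \<pi> x"
proof -
  let ?B = "{y\<in>space \<nu>. buys m (pmf \<pi>) (fst y) \<and> feedback m i x (snd y) (fst y) = z}"
  have B: "?B \<in> sets \<nu>" by (rule G_sets[OF i x])
  have E': "E \<in> events" using E past_events by blast
  have "(\<Sum>v\<in>{v\<in>outcomes m. v i = z}. prob (E \<inter> hist (Suc n) (h @ [Some v]))) =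
      prob (\<Union>v\<in>{v\<in>outcomes m. v i = z}. E \<inter> hist (Suc n) (h @ [Some v]))"
    using wf E' hist_events
    by (intro finite_measure_finite_Union[symmetric]) (auto simp: well_formed_def disjoint_family_on_def simp del: reviews.simps)
  also have "\<dots> \<le> prob (E \<inter> hist n h \<inter> {w\<in>space W. (preference X (Suc n) w, noise X (Suc n) w) \<in> ?B})"
  proof (rule finite_measure_mono)
    show "(\<Union>v\<in>{v\<in>outcomes m. v i = z}. E \<inter> hist (Suc n) (h @ [Some v])) \<subseteq>
       E \<inter> hist n h \<inter> {w\<in>space W. (preference X (Suc n) w, noise X (Suc n) w) \<in> ?B}"
    proof (intro subsetI)
      fix w assume "w \<in> (\<Union>v\<in>{v\<in>outcomes m. v i = z}. E \<inter> hist (Suc n) (h @ [Some v]))"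
      then obtain v where v: "v i = z" "w \<in> E" "w \<in> space W" "reviews m X (Suc n) w = h @ [Some v]"
        by (auto simp del: reviews.simps)
      then have r: "reviews m X n w = h"
        "(preference X (Suc n) w, noise X (Suc n) w) \<in> review_event n h (quality X (Suc n) w) (Some v)"
        using hist_Suc[OF _ refl, of w n h "Some v"] by auto
      then show "w \<in> E \<inter> hist n h \<inter> {w\<in>space W. (preference X (Suc n) w, noise X (Suc n) w) \<in> ?B}"
        using v Ex[of w] i by (auto simp: review_event_def \<pi> review_of_def split: if_splits)
    qed
    have "{w\<in>space W. (preference X (Suc n) w, noise X (Suc n) w) \<in> ?B} \<in> events"
      using pair_in_past[OF B, of "Suc n" "Suc n"] past_events by auto
    then show "E \<inter> hist n h \<inter> {w\<in>space W. (preference X (Suc n) w, noise X (Suc n) w) \<in> ?B} \<in> events"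
      using E' by auto
  qed
  finally show ?thesis unfolding prob_hist_pair[OF E B] G_eq .
qed

definition affinity :: "nat \<Rightarrow> 'w set \<Rightarrow> 'w set \<Rightarrow> real" where
  "affinity n E F = (\<Sum>h\<in>histories n. sqrt (prob (E \<inter> hist n h) * prob (F \<inter> hist n h)))"

text \<open>The affinity of the one-step extensions of a history is at most its own term times the
  affinity of a single review, and the latter is bounded whatever belief the history has
  produced.\<close>

lemma affinity_Suc:
  assumes E: "E \<in> past n" "F \<in> past n" and i: "i \<in> {1..dim m}"
    and Ex: "\<And>w. w \<in> E \<Longrightarrow> quality X (Suc n) w i = 0" "\<And>w. w \<in> F \<Longrightarrow> quality X (Suc n) w i = 1"
    and \<delta>: "0 \<le> \<delta>" "\<delta> \<le> delta m"
  shows "affinity (Suc n) E F \<le> (1 - \<delta>\<^sup>2 / 8) * affinity n E F"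
proof -
  let ?s = "\<lambda>h. sqrt (prob (E \<inter> hist n h) * prob (F \<inter> hist n h))"
  have "sqrt (prob (E \<inter> hist (Suc n) (h @ [None])) * prob (F \<inter> hist (Suc n) (h @ [None]))) +
      (\<Sum>v\<in>outcomes m. sqrt (prob (E \<inter> hist (Suc n) (h @ [Some v])) * prob (F \<inter> hist (Suc n) (h @ [Some v]))))
      \<le> (1 - \<delta>\<^sup>2 / 8) * ?s h" (is "?n + ?v \<le> _") for h
  proof (cases "prob (hist n h) = 0")
    case True
    have "prob (D \<inter> hist (Suc n) (h @ [z])) = 0" if "D \<in> events" for z D
    proof -
      have "prob (D \<inter> hist (Suc n) (h @ [z])) \<le> prob (hist n h)"
        using that by (intro finite_measure_mono) auto
      then show ?thesis using True by (simp add: measure_le_0_iff)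
    qed
    moreover have "E \<in> events" using E past_events by blast
    ultimately have "?n + ?v = 0" by (simp del: reviews.simps)
    then show ?thesis using True prob_hist_zero_Int[of n h] by simp
  next
    case False
    then have "prob (hist n h) > 0" by (simp add: zero_less_measure_iff)
    then obtain \<pi> where \<pi>: "\<pi> \<in> beliefs (dim m)" "pmf \<pi> = bel n h" by (rule bel_pmf)
    let ?b = "buy_prob (bel n h)"
    have b: "?b \<le> 1" unfolding buy_prob_def by (rule pair.prob_le_1)
    have "?n \<le> sqrt ((prob (E \<inter> hist n h) * (1 - ?b)) * (prob (F \<inter> hist n h) * (1 - ?b)))"
      using b by (intro real_sqrt_le_mono mult_mono prob_hist_None E) auto
    also have "\<dots> = sqrt (prob (E \<inter> hist n h) * prob (F \<inter> hist n h) * (1 - ?b)\<^sup>2)"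
      by (simp add: power2_eq_square mult_ac)
    also have "\<dots> = ?s h * (1 - ?b)" using b by (subst real_sqrt_mult) simp
    finally have n: "?n \<le> ?s h * (1 - ?b)" .
    have "?v = (\<Sum>z\<in>component_outcomes m i. \<Sum>v\<in>{v\<in>outcomes m. v i = z}.
        sqrt (prob (E \<inter> hist (Suc n) (h @ [Some v])) * prob (F \<inter> hist (Suc n) (h @ [Some v]))))"
      using wf unfolding component_outcomes_def
      by (intro sum.group[symmetric]) (auto simp: well_formed_def)
    \<comment> \<open>Cauchy-Schwarz within each group: merging outcomes can only raise the
      affinity.\<close>
    also have "\<dots> \<le> (\<Sum>z\<in>component_outcomes m i. ?s h * sqrt (G m i z \<pi> 0 * G m i z \<pi> 1))"
    proof (rule sum_mono)
      fix z
      have "(\<Sum>v\<in>{v\<in>outcomes m. v i = z}.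
          sqrt (prob (E \<inter> hist (Suc n) (h @ [Some v])) * prob (F \<inter> hist (Suc n) (h @ [Some v]))))
        \<le> sqrt ((\<Sum>v\<in>{v\<in>outcomes m. v i = z}. prob (E \<inter> hist (Suc n) (h @ [Some v]))) *
            (\<Sum>v\<in>{v\<in>outcomes m. v i = z}. prob (F \<inter> hist (Suc n) (h @ [Some v]))))"
        by (intro Cauchy_Schwarz_sum_sqrt) auto
      also have "\<dots> \<le> sqrt ((prob (E \<inter> hist n h) * G m i z \<pi> 0) * (prob (F \<inter> hist n h) * G m i z \<pi> 1))"
        using Ex \<pi> by (intro real_sqrt_le_mono mult_mono prob_hist_component E i) (auto intro!: sum_nonneg simp: G_def)
      also have "\<dots> = ?s h * sqrt (G m i z \<pi> 0 * G m i z \<pi> 1)"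
        by (simp add: real_sqrt_mult mult_ac)
      finally show "(\<Sum>v\<in>{v\<in>outcomes m. v i = z}.
          sqrt (prob (E \<inter> hist (Suc n) (h @ [Some v])) * prob (F \<inter> hist (Suc n) (h @ [Some v]))))
        \<le> ?s h * sqrt (G m i z \<pi> 0 * G m i z \<pi> 1)" .
    qed
    finally have v: "?v \<le> ?s h * (\<Sum>z\<in>component_outcomes m i. sqrt (G m i z \<pi> 0 * G m i z \<pi> 1))"
      by (simp add: sum_distrib_left)
    have "?n + ?v \<le> ?s h * ((1 - ?b) + (\<Sum>z\<in>component_outcomes m i. sqrt (G m i z \<pi> 0 * G m i z \<pi> 1)))"
      using n v by (simp add: algebra_simps)
    also have "\<dots> \<le> ?s h * (1 - \<delta>\<^sup>2 / 8)"
      using affinity_G[OF i \<pi>(1) \<delta>] \<pi>(2) by (intro mult_left_mono) auto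
    finally show ?thesis by (simp add: mult.commute)
  qed
  then have "affinity (Suc n) E F \<le> (\<Sum>h\<in>histories n. (1 - \<delta>\<^sup>2 / 8) * ?s h)"
    unfolding affinity_def sum_histories_Suc by (intro sum_mono)
  then show ?thesis by (simp add: affinity_def sum_distrib_left)
qed

text \<open>\<open>n\<close> counts the transitions of the window, which therefore has
  \<open>n + 1\<close> periods; \<open>n = 0\<close> fixes a single period.\<close>

definition hold :: "nat \<Rightarrow> nat \<Rightarrow> nat \<Rightarrow> real \<Rightarrow> 'w set" where
  "hold i s n x = {w\<in>space W. \<forall>u\<in>{s..s+n}. quality X u w i = x}"

lemma hold_in_past: "s \<ge> 1 \<Longrightarrow> hold i s n x \<in> past k"
proof -
  assume s: "s \<ge> 1"
  interpret p: sigma_algebra "space W" "past k" by (rule sigma_algebra_past)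
  have "{w\<in>space W. quality X u w \<in> {q. q i = x}} \<in> past k" if "u \<in> {s..s+n}" for u
    using that s by (intro quality_in_past) auto
  then show ?thesis unfolding hold_def by (intro p.sets_Collect_finite_All) auto
qed

text \<open>The first \<open>k\<close> reviews are bounded trivially by affinity 1; each of the
  \<open>n\<close> reviews of periods \<open>k + 1\<close> to \<open>k + n\<close> contracts once.
  The review of period \<open>k + n + 1\<close> is not yet part of the history.\<close>

lemma affinity_hold:
  assumes i: "i \<in> {1..dim m}" and \<delta>: "0 \<le> \<delta>" "\<delta> \<le> delta m" "\<delta> \<le> 1"
  shows "affinity (k + n) (hold i (Suc k) n 0) (hold i (Suc k) n 1) \<le> (1 - \<delta>\<^sup>2 / 8) ^ n"
proof (induction n)
  case 0
  have ev: "hold i (Suc k) n x \<in> events" for n x using hold_in_past[of "Suc k" i n x 0] past_events by auto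
  have "affinity k (hold i (Suc k) 0 0) (hold i (Suc k) 0 1) \<le> (\<Sum>h\<in>histories k. sqrt (prob (hist k h) * prob (hist k h)))"
    unfolding affinity_def using ev
    by (intro sum_mono real_sqrt_le_mono mult_mono finite_measure_mono) auto
  also have "\<dots> = (\<Sum>h\<in>histories k. prob (space W \<inter> hist k h))"
    by (intro sum.cong) (auto simp: Int_def)
  also have "\<dots> = 1" by (subst prob_hist_sum[symmetric]) (auto simp: prob_space)
  finally show ?case by simp
next
  case (Suc n)
  have ev: "hold i (Suc k) n x \<in> events" for n x using hold_in_past[of "Suc k" i n x 0] past_events by auto
  have "\<delta>\<^sup>2 \<le> 1" using \<delta> by (simp add: power_le_one)
  then have pos: "0 \<le> 1 - \<delta>\<^sup>2 / 8" by simp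
  have "affinity (Suc (k + n)) (hold i (Suc k) (Suc n) 0) (hold i (Suc k) (Suc n) 1)
    \<le> affinity (Suc (k + n)) (hold i (Suc k) n 0) (hold i (Suc k) n 1)"
    unfolding affinity_def using ev
    by (intro sum_mono real_sqrt_le_mono mult_mono finite_measure_mono)
      (auto simp: hold_def simp del: reviews.simps)
  also have "\<dots> \<le> (1 - \<delta>\<^sup>2 / 8) * affinity (k + n) (hold i (Suc k) n 0) (hold i (Suc k) n 1)"
    using i \<delta> by (intro affinity_Suc hold_in_past) (auto simp: hold_def)
  also have "\<dots> \<le> (1 - \<delta>\<^sup>2 / 8) * (1 - \<delta>\<^sup>2 / 8) ^ n" using Suc pos by (intro mult_left_mono)
  finally show ?case by simp
qed

text \<open>The bound on staying put holds conditionally on each path up to \<open>t\<close> and is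
  averaged over these paths.\<close>

lemma prob_change:
  assumes lazy: "lazy_transition (dim m) \<eta> P" and t: "t \<ge> 1"
  shows "prob {w\<in>space W. quality X (Suc t) w \<noteq> quality X t w} \<le> \<eta>"
proof -
  have stay: "(1 - \<eta>) * prob (trajectory t y) \<le> prob ({w\<in>space W. quality X (Suc t) w = quality X t w} \<inter> trajectory t y)"
    if y: "y \<in> paths t" for y
  proof -
    have yt: "y t \<in> S" using y t by auto
    have "(1 - \<eta>) * prob (trajectory t y) \<le> pmf (P (y t)) (y t) * prob (trajectory t y)"
      using lazy yt by (intro mult_right_mono) (auto simp: lazy_transition_def)
    also have "\<dots> = prob (trajectory t (y(Suc t := y t))) * pmf (P ((y(Suc t := y t)) t)) ((y(Suc t := y t)) (Suc t))"
      by (simp add: trajectory_def)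
    also have "\<dots> = prob (trajectory (Suc t) (y(Suc t := y t)))"
      using t y yt by (intro prob_trajectory_Suc[symmetric]) (auto simp: le_Suc_eq)
    also have "trajectory (Suc t) (y(Suc t := y t)) = {w\<in>space W. quality X (Suc t) w = quality X t w} \<inter> trajectory t y"
      using t unfolding trajectory_def by (auto simp: atLeastAtMostSuc_conv)
    finally show ?thesis .
  qed
  have ev: "{w\<in>space W. quality X (Suc t) w = quality X t w} \<in> events"
  proof -
    have "{w\<in>space W. quality X (Suc t) w = quality X t w} =
      (\<Union>q\<in>S. {w\<in>space W. quality X (Suc t) w \<in> {q}} \<inter> {w\<in>space W. quality X t w \<in> {q}})"
      using quality_in[OF t] by auto
    also have "\<dots> \<in> events"
      using t by (intro sets.finite_UN finite_qualities sets.Int quality_events) auto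
    finally show ?thesis .
  qed
  have "1 - \<eta> = (1 - \<eta>) * prob (space W)" by (simp add: prob_space)
  also have "\<dots> = (\<Sum>y\<in>paths t. (1 - \<eta>) * prob (space W \<inter> trajectory t y))"
    by (subst prob_trajectory_sum[of _ t]) (auto simp: sum_distrib_left)
  also have "\<dots> \<le> (\<Sum>y\<in>paths t. prob ({w\<in>space W. quality X (Suc t) w = quality X t w} \<inter> trajectory t y))"
    using stay sets.sets_into_space[OF trajectory_events] by (intro sum_mono) (simp add: Int_absorb1)
  also have "\<dots> = prob {w\<in>space W. quality X (Suc t) w = quality X t w}"
    by (rule prob_trajectory_sum[OF ev, symmetric])
  finally show ?thesis using prob_neg[OF ev] by simp
qed

text \<open>A change of any component within the window is charged \<eta> per transition. Without
  one, the present value of component \<open>i\<close> was held throughout the window, and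
  \<open>min a b \<le> sqrt (a * b)\<close> bounds the error of the optimal test by an
  affinity.\<close>

lemma min_affinity:
  assumes lazy: "lazy_transition (dim m) \<eta> P" and i: "i \<in> {1..dim m}"
    and \<delta>: "0 \<le> \<delta>" "\<delta> \<le> delta m" "\<delta> \<le> 1"
  shows "(\<Sum>h\<in>histories (k + n). min (prob (hold i (Suc (k + n)) 0 0 \<inter> hist (k + n) h))
      (prob (hold i (Suc (k + n)) 0 1 \<inter> hist (k + n) h))) \<le> real n * \<eta> + (1 - \<delta>\<^sup>2 / 8) ^ n"
proof -
  define C where "C = (\<Union>u\<in>{Suc k..<Suc k + n}. {w\<in>space W. quality X (Suc u) w \<noteq> quality X u w})"
  have ch: "{w\<in>space W. quality X (Suc u) w \<noteq> quality X u w} \<in> events" if "u \<ge> 1" for u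
  proof -
    have "{w\<in>space W. quality X (Suc u) w \<noteq> quality X u w} =
      (\<Union>q\<in>S. {w\<in>space W. quality X (Suc u) w \<in> {q}} \<inter> {w\<in>space W. quality X u w \<in> - {q}})"
      using quality_in[of "Suc u"] by auto
    also have "\<dots> \<in> events"
      using that by (intro sets.finite_UN finite_qualities sets.Int quality_events) auto
    finally show ?thesis .
  qed
  have C: "C \<in> events" unfolding C_def using ch by (intro sets.finite_UN) auto
  have "prob C \<le> (\<Sum>u\<in>{Suc k..<Suc k + n}. prob {w\<in>space W. quality X (Suc u) w \<noteq> quality X u w})"
    unfolding C_def using ch by (intro finite_measure_subadditive_finite) auto
  also have "\<dots> \<le> (\<Sum>u\<in>{Suc k..<Suc k + n}. \<eta>)"
    using lazy by (intro sum_mono prob_change) auto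
  finally have pC: "prob C \<le> real n * \<eta>" by simp
  have ev: "hold i s n x \<in> events" if "s \<ge> 1" for s n x using hold_in_past[OF that, of i n x 0] past_events by auto
  have sub: "hold i (Suc (k + n)) 0 x \<subseteq> hold i (Suc k) n x \<union> C" for x
  proof
    fix w assume w: "w \<in> hold i (Suc (k + n)) 0 x"
    show "w \<in> hold i (Suc k) n x \<union> C"
    proof (cases "w \<in> C")
      case False
      then have st: "quality X (Suc u) w = quality X u w" if "u \<in> {Suc k..<Suc k + n}" for u
        using that w unfolding C_def hold_def by auto
      have "j \<le> n \<longrightarrow> quality X (Suc k + j) w = quality X (Suc k) w" for j
        using st by (induction j) auto
      then have all: "j \<le> n \<Longrightarrow> quality X (Suc k + j) w = quality X (Suc k) w" for j by blast
      have "quality X u w i = x" if u: "u \<in> {Suc k..Suc k + n}" for u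
      proof -
        have "quality X u w = quality X (Suc k) w" using all[of "u - Suc k"] u by auto
        moreover have "quality X (Suc (k + n)) w = quality X (Suc k) w" using all[of n] by auto
        ultimately show ?thesis using w by (auto simp: hold_def)
      qed
      then show ?thesis using w by (auto simp: hold_def)
    qed simp
  qed
  have le: "prob (hold i (Suc (k + n)) 0 x \<inter> hist (k + n) h) \<le>
      prob (C \<inter> hist (k + n) h) + prob (hold i (Suc k) n x \<inter> hist (k + n) h)" for x h
  proof -
    have "prob (hold i (Suc (k + n)) 0 x \<inter> hist (k + n) h) \<le> prob ((C \<inter> hist (k + n) h) \<union> (hold i (Suc k) n x \<inter> hist (k + n) h))"
      using sub[of x] C ev by (intro finite_measure_mono) auto
    also have "\<dots> \<le> prob (C \<inter> hist (k + n) h) + prob (hold i (Suc k) n x \<inter> hist (k + n) h)"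
      using C ev by (intro measure_Un_le) auto
    finally show ?thesis .
  qed
  have min_sqrt: "min a b \<le> sqrt (a * b)" if "a \<ge> 0" "b \<ge> 0" for a b :: real
  proof (rule real_le_rsqrt)
    show "(min a b)\<^sup>2 \<le> a * b" unfolding power2_eq_square using that by (intro mult_mono) auto
  qed
  have "(\<Sum>h\<in>histories (k + n). min (prob (hold i (Suc (k + n)) 0 0 \<inter> hist (k + n) h))
      (prob (hold i (Suc (k + n)) 0 1 \<inter> hist (k + n) h)))
    \<le> (\<Sum>h\<in>histories (k + n). prob (C \<inter> hist (k + n) h) +
        sqrt (prob (hold i (Suc k) n 0 \<inter> hist (k + n) h) * prob (hold i (Suc k) n 1 \<inter> hist (k + n) h)))"
  proof (rule sum_mono)
    fix h
    show "min (prob (hold i (Suc (k + n)) 0 0 \<inter> hist (k + n) h)) (prob (hold i (Suc (k + n)) 0 1 \<inter> hist (k + n) h))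
      \<le> prob (C \<inter> hist (k + n) h) +
        sqrt (prob (hold i (Suc k) n 0 \<inter> hist (k + n) h) * prob (hold i (Suc k) n 1 \<inter> hist (k + n) h))"
      using le[of 0 h] le[of 1 h] min_sqrt[of "prob (hold i (Suc k) n 0 \<inter> hist (k + n) h)" "prob (hold i (Suc k) n 1 \<inter> hist (k + n) h)"]
      by (simp add: min_def split: if_splits)
  qed
  also have "\<dots> = prob C + affinity (k + n) (hold i (Suc k) n 0) (hold i (Suc k) n 1)"
    by (simp add: sum.distrib affinity_def prob_hist_sum[OF C, of "k + n"])
  also have "\<dots> \<le> real n * \<eta> + (1 - \<delta>\<^sup>2 / 8) ^ n"
    using pC affinity_hold[OF i \<delta>] by (intro add_mono)
  finally show ?thesis .
qed

end

section \<open>From the test error to the regret of one consumer\<close>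

text \<open>A consumer loses only if \<open>x\<close> and the mean reward lie on opposite sides of
  0, and then at most their distance.\<close>

lemma regret_le_deviation:
  fixes b r :: "'a \<Rightarrow> real"
  assumes b: "\<And>q. q \<in> A \<Longrightarrow> b q \<ge> 0" "(\<Sum>q\<in>A. b q) = 1"
  shows "max x 0 - (if (\<Sum>q\<in>A. b q * r q) > 0 then x else 0) \<le> (\<Sum>q\<in>A. b q * \<bar>x - r q\<bar>)"
proof -
  have "\<bar>x - (\<Sum>q\<in>A. b q * r q)\<bar> = \<bar>\<Sum>q\<in>A. b q * (x - r q)\<bar>"
    using b(2) by (simp add: right_diff_distrib sum_subtractf sum_distrib_right[symmetric])
  also have "\<dots> \<le> (\<Sum>q\<in>A. \<bar>b q * (x - r q)\<bar>)" by (rule sum_abs)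
  also have "\<dots> = (\<Sum>q\<in>A. b q * \<bar>x - r q\<bar>)" using b(1) by (intro sum.cong) (auto simp: abs_mult)
  finally show ?thesis by (auto simp: max_def)
qed

lemma sum_swap3: "(\<Sum>x\<in>A. \<Sum>y\<in>B. \<Sum>z\<in>C. f x y z) = (\<Sum>z\<in>C. \<Sum>x\<in>A. \<Sum>y\<in>B. f x y z)"
proof -
  have "(\<Sum>x\<in>A. \<Sum>y\<in>B. \<Sum>z\<in>C. f x y z) = (\<Sum>x\<in>A. \<Sum>z\<in>C. \<Sum>y\<in>B. f x y z)"
    by (intro sum.cong refl sum.swap)
  also have "\<dots> = (\<Sum>z\<in>C. \<Sum>x\<in>A. \<Sum>y\<in>B. f x y z)" by (rule sum.swap)
  finally show ?thesis .
qed

text \<open>With \<open>a\<close> and \<open>b\<close> the masses of the two values, the left-hand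
  side is \<open>2 * a * b / s\<close>, the unnormalised probability that two independent posterior
  draws disagree; since \<open>a + b = s\<close>, the quotient \<open>a * b / s\<close> is below
  both masses.\<close>

lemma bernoulli_deviation_le_min:
  fixes p :: "'a \<Rightarrow> real"
  assumes fin: "finite A" and p: "\<And>q. q \<in> A \<Longrightarrow> p q \<ge> 0" and f: "\<And>q. q \<in> A \<Longrightarrow> f q \<in> {0, 1 :: real}"
    and s: "(\<Sum>q\<in>A. p q) = s" "s > 0"
  shows "(\<Sum>q\<in>A. \<Sum>q'\<in>A. p q * (p q' / s) * \<bar>f q - f q'\<bar>) \<le>
    2 * min (\<Sum>q\<in>{q\<in>A. f q = 0}. p q) (\<Sum>q\<in>{q\<in>A. f q = 1}. p q)"
proof -
  define a b where "a = (\<Sum>q\<in>{q\<in>A. f q = 0}. p q)" and "b = (\<Sum>q\<in>{q\<in>A. f q = 1}. p q)"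
  have ab: "a = (\<Sum>q\<in>A. p q * (1 - f q))" "b = (\<Sum>q\<in>A. p q * f q)"
    unfolding a_def b_def using fin f by (auto simp: sum.inter_filter intro!: sum.cong dest!: f)
  have "(\<Sum>q\<in>A. \<Sum>q'\<in>A. p q * (p q' / s) * \<bar>f q - f q'\<bar>) =
      (\<Sum>q\<in>A. \<Sum>q'\<in>A. ((p q * (1 - f q)) * (p q' * f q') + (p q * f q) * (p q' * (1 - f q'))) / s)"
  proof (intro sum.cong refl)
    fix q q' assume "q \<in> A" "q' \<in> A"
    then show "p q * (p q' / s) * \<bar>f q - f q'\<bar> = ((p q * (1 - f q)) * (p q' * f q') + (p q * f q) * (p q' * (1 - f q'))) / s"
      using f[of q] f[of q'] by auto
  qed
  also have "\<dots> = (a * b + b * a) / s"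
    by (simp add: ab sum.distrib sum_divide_distrib[symmetric] sum_product)
  also have "\<dots> = 2 * (a * b / s)" by simp
  finally have eq: "(\<Sum>q\<in>A. \<Sum>q'\<in>A. p q * (p q' / s) * \<bar>f q - f q'\<bar>) = 2 * (a * b / s)" .
  have "a + b = s" unfolding ab s(1)[symmetric] by (simp add: sum.distrib[symmetric] algebra_simps)
  moreover have "a \<ge> 0" "b \<ge> 0" unfolding a_def b_def using p by (auto intro!: sum_nonneg)
  ultimately have "a * b \<le> a * s" "b * a \<le> b * s"
    by (intro mult_left_mono; simp)+
  then have "a * b / s \<le> a" "a * b / s \<le> b"
    using s(2) by (simp_all add: pos_divide_le_eq mult.commute)
  then show ?thesis unfolding eq a_def[symmetric] b_def[symmetric] by (simp add: min_def)
qed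

context market_process
begin

definition regret_at :: "nat \<Rightarrow> 'w \<Rightarrow> real" where
  "regret_at t w = max (reward m (quality X t w) (preference X t w)) 0 - utility m X t w"

lemma regret_eq: "regret m X T = (\<Sum>t=1..T. \<integral>w. regret_at t w \<partial>W)"
  by (simp add: regret_def regret_at_def)

text \<open>Posteriors are probability vectors only on histories of positive probability.\<close>

lemma AE_hist_pos: "AE w in W. prob (hist n (reviews m X n w)) > 0"
proof -
  have "AE w in W. reviews m X n w \<noteq> h" if "h \<in> {h\<in>histories n. prob (hist n h) = 0}" for h
    using that by (intro AE_I[of _ _ "hist n h"]) (auto simp: emeasure_eq_measure)
  then have "AE w in W. \<forall>h\<in>{h\<in>histories n. prob (hist n h) = 0}. reviews m X n w \<noteq> h"
    using finite_histories by (intro AE_ball_countable') (auto intro: countable_finite)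
  then show ?thesis
  proof (rule AE_mp, intro AE_I2 impI)
    fix w assume "w \<in> space W" "\<forall>h\<in>{h\<in>histories n. prob (hist n h) = 0}. reviews m X n w \<noteq> h"
    then have "prob (hist n (reviews m X n w)) \<noteq> 0" using reviews_in_histories[of w n] by auto
    then show "prob (hist n (reviews m X n w)) > 0" unfolding zero_less_measure_iff .
  qed
qed

lemma hold_0: "hold i t 0 x = {w\<in>space W. quality X t w i = x}"
  by (simp add: hold_def)

text \<open>Given the history, the true quality and a quality drawn from the posterior behave as two
  independent draws from the same law. The Lipschitz bound splits their distance by components, and
  each component yields a disagreement probability.\<close>

lemma expected_regret_at_le:
  assumes lip: "lipschitz_reward m M" and M: "M \<ge> 0"
  shows "(\<integral>w. regret_at (Suc n) w \<partial>W) \<le>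
    2 * M * (\<Sum>i=1..dim m. \<Sum>h\<in>histories n. min (prob (hold i (Suc n) 0 0 \<inter> hist n h)) (prob (hold i (Suc n) 0 1 \<inter> hist n h)))"
proof -
  let ?Q = "\<lambda>q. {w\<in>space W. quality X (Suc n) w = q}"
  define c where "c h q = (\<Sum>q'\<in>S. bel n h q' * (M * (\<Sum>i=1..dim m. \<bar>q i - q' i\<bar>)))" for h q
  define g where "g w = (\<Sum>h\<in>histories n. \<Sum>q\<in>S. c h q * indicator (?Q q \<inter> hist n h) w)" for w
  have Q: "?Q q \<in> events" for q using quality_events[of "Suc n" "{q}"] by simp
  have c0: "c h q \<ge> 0" for h q
    unfolding c_def using M bel_nonneg by (intro sum_nonneg mult_nonneg_nonneg) auto
  have g: "g w = c (reviews m X n w) (quality X (Suc n) w)" if w: "w \<in> space W" for w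
  proof -
    let ?h = "reviews m X n w" and ?q = "quality X (Suc n) w"
    have "g w = (\<Sum>h\<in>histories n. \<Sum>q\<in>S. if h = ?h then (if q = ?q then c h q else 0) else 0)"
      unfolding g_def using w by (intro sum.cong refl) (auto simp: indicator_def)
    also have "\<dots> = (\<Sum>h\<in>histories n. if h = ?h then c h ?q else 0)"
      using finite_qualities quality_in[of "Suc n" w] w by (intro sum.cong) (auto simp: sum.delta')
    also have "\<dots> = c ?h ?q"
      using finite_histories reviews_in_histories[OF w] by (simp add: sum.delta')
    finally show ?thesis .
  qed
  have "(\<integral>w. regret_at (Suc n) w \<partial>W) \<le> (\<integral>w. g w \<partial>W)"
  \<comment> \<open>This rule asks for integrability of the majorant \<open>g\<close>, a finite
    combination of indicators.\<close>
  proof (rule integral_mono_AE')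
    show "integrable W g" unfolding g_def
      using Q by (intro Bochner_Integration.integrable_sum integrable_mult_right integrable_real_indicator)
        (auto simp: emeasure_eq_measure)
    show "AE w in W. 0 \<le> g w" unfolding g_def using c0 by (intro AE_I2 sum_nonneg) auto
    show "AE w in W. regret_at (Suc n) w \<le> g w"
      using AE_hist_pos[of n]
    proof (rule AE_mp, intro AE_I2 impI)
      fix w assume w: "w \<in> space W" and pos: "prob (hist n (reviews m X n w)) > 0"
      let ?h = "reviews m X n w" and ?q = "quality X (Suc n) w" and ?th = "preference X (Suc n) w"
      have th: "?th \<in> space (pref_law m)" using measurable_space[OF measurable_preference, of "Suc n" w] w by simp
      have q: "?q \<in> S" using quality_in[of "Suc n"] w by simp
      have "regret_at (Suc n) w = max (reward m ?q ?th) 0 - (if (\<Sum>q\<in>S. bel n ?h q * reward m q ?th) > 0 then reward m ?q ?th else 0)"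
        unfolding regret_at_def utility_def belief_eq buys_def by simp
      also have "\<dots> \<le> (\<Sum>q'\<in>S. bel n ?h q' * \<bar>reward m ?q ?th - reward m q' ?th\<bar>)"
        using bel_sum[OF pos] by (intro regret_le_deviation bel_nonneg)
      also have "\<dots> \<le> c ?h ?q"
        unfolding c_def using lip th q by (intro sum_mono mult_left_mono bel_nonneg) (auto simp: lipschitz_reward_def)
      finally show "regret_at (Suc n) w \<le> g w" using g[OF w] by simp
    qed
  qed
  also have "(\<integral>w. g w \<partial>W) = (\<Sum>h\<in>histories n. \<Sum>q\<in>S. c h q * prob (?Q q \<inter> hist n h))"
  proof -
    have int: "integrable W (\<lambda>w. c h q * indicator (?Q q \<inter> hist n h) w)" for h q
      using Q by (intro integrable_mult_right integrable_real_indicator) (auto simp: emeasure_eq_measure)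
    have val: "(\<integral>w. c h q * indicator (?Q q \<inter> hist n h) w \<partial>W) = c h q * prob (?Q q \<inter> hist n h)" for h q
    proof -
      have "?Q q \<inter> hist n h \<inter> space W = ?Q q \<inter> hist n h" by auto
      then show ?thesis by simp
    qed
    have "(\<integral>w. g w \<partial>W) = (\<Sum>h\<in>histories n. \<Sum>q\<in>S. \<integral>w. c h q * indicator (?Q q \<inter> hist n h) w \<partial>W)"
      unfolding g_def using int by (simp only: Bochner_Integration.integral_sum Bochner_Integration.integrable_sum)
    then show ?thesis unfolding val .
  qed
  also have "\<dots> \<le> (\<Sum>h\<in>histories n. 2 * M * (\<Sum>i=1..dim m. min (prob (hold i (Suc n) 0 0 \<inter> hist n h)) (prob (hold i (Suc n) 0 1 \<inter> hist n h))))"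
  proof (rule sum_mono)
    fix h
    define p where "p q = prob (?Q q \<inter> hist n h)" for q
    show "(\<Sum>q\<in>S. c h q * prob (?Q q \<inter> hist n h)) \<le>
      2 * M * (\<Sum>i=1..dim m. min (prob (hold i (Suc n) 0 0 \<inter> hist n h)) (prob (hold i (Suc n) 0 1 \<inter> hist n h)))"
    proof (cases "prob (hist n h) = 0")
      case True
      then show ?thesis using prob_hist_zero_Int[OF True] by simp
    next
      case False
      then have pos: "prob (hist n h) > 0" by (simp add: zero_less_measure_iff)
      have hold: "prob (hold i (Suc n) 0 x \<inter> hist n h) = (\<Sum>q\<in>{q\<in>S. q i = x}. p q)" for i x
      proof -
        have "hold i (Suc n) 0 x \<in> events" using hold_in_past[of "Suc n" i 0 x 0] past_events by auto
        then have "prob (hold i (Suc n) 0 x \<inter> hist n h) =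
           (\<Sum>q\<in>{q\<in>S. q i = x}. prob (hold i (Suc n) 0 x \<inter> hist n h \<inter> ?Q q))"
          using Q finite_qualities quality_in[of "Suc n"] by (intro measure_partition) (auto simp: hold_0)
        also have "\<dots> = (\<Sum>q\<in>{q\<in>S. q i = x}. p q)"
          unfolding p_def hold_0 by (intro sum.cong arg_cong[where f = prob]) auto
        finally show ?thesis .
      qed
      have "(\<Sum>q\<in>S. c h q * prob (?Q q \<inter> hist n h)) =
          (\<Sum>q\<in>S. \<Sum>q'\<in>S. \<Sum>i=1..dim m. M * (p q * (p q' / prob (hist n h)) * \<bar>q i - q' i\<bar>))"
        unfolding c_def bel_eq p_def
        by (simp add: sum_distrib_left sum_distrib_right sum_divide_distrib mult_ac)
      also have "\<dots> = (\<Sum>i=1..dim m. M * (\<Sum>q\<in>S. \<Sum>q'\<in>S. p q * (p q' / prob (hist n h)) * \<bar>q i - q' i\<bar>))"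
        unfolding sum_distrib_left by (rule sum_swap3)
      also have "\<dots> \<le> (\<Sum>i=1..dim m. M * (2 * min (\<Sum>q\<in>{q\<in>S. q i = 0}. p q) (\<Sum>q\<in>{q\<in>S. q i = 1}. p q)))"
        using M pos finite_qualities measure_quality_sum qualities_component
        by (intro sum_mono mult_left_mono bernoulli_deviation_le_min) (auto simp: p_def)
      finally show ?thesis unfolding hold by (simp add: sum_distrib_left mult_ac)
    qed
  qed
  also have "\<dots> = 2 * M * (\<Sum>i=1..dim m. \<Sum>h\<in>histories n. min (prob (hold i (Suc n) 0 0 \<inter> hist n h)) (prob (hold i (Suc n) 0 1 \<inter> hist n h)))"
    by (subst sum.swap) (simp add: sum_distrib_left)
  finally show ?thesis .
qed

lemma expected_regret_at_le_window:
  assumes lip: "lipschitz_reward m M" and M: "M \<ge> 0" and lazy: "lazy_transition (dim m) \<eta> P"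
    and \<delta>: "0 \<le> \<delta>" "\<delta> \<le> delta m" "\<delta> \<le> 1"
  shows "(\<integral>w. regret_at (Suc (k + n)) w \<partial>W) \<le> 2 * M * real (dim m) * (real n * \<eta> + (1 - \<delta>\<^sup>2 / 8) ^ n)"
proof -
  have "(\<integral>w. regret_at (Suc (k + n)) w \<partial>W) \<le> 2 * M * (\<Sum>i=1..dim m. real n * \<eta> + (1 - \<delta>\<^sup>2 / 8) ^ n)"
    using M by (intro order_trans[OF expected_regret_at_le[OF lip M]] mult_left_mono sum_mono min_affinity lazy \<delta>) auto
  then show ?thesis by (simp add: algebra_simps)
qed

end

section \<open>Choice of the window length and summation over time\<close>

lemma lipschitz_nonneg:
  assumes "lipschitz_reward m M" "well_formed m"
  shows "M \<ge> 0"
proof -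
  have d: "1 \<in> {1..dim m}" and ps: "prob_space (pref_law m)" using assms(2) by (auto simp: well_formed_def)
  then obtain th where th: "th \<in> space (pref_law m)" using prob_space.not_empty by blast
  let ?q = "\<lambda>x. \<lambda>i\<in>{1..dim m}. x :: real"
  have q: "?q 0 \<in> qualities (dim m)" "?q 1 \<in> qualities (dim m)" by (auto simp: qualities_def)
  have "0 \<le> \<bar>reward m (?q 1) th - reward m (?q 0) th\<bar>" by simp
  also have "\<dots> \<le> M * (\<Sum>i=1..dim m. \<bar>?q 1 i - ?q 0 i\<bar>)"
    using assms(1) q th unfolding lipschitz_reward_def by blast
  also have "\<dots> = M * real (dim m)" by simp
  finally show ?thesis using d by (auto simp: zero_le_mult_iff)
qed

lemma ln_2_ge_half: "ln (2::real) \<ge> 1 / 2"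
  using ln_le_minus_one[of "1 / 2 :: real"] by (simp add: ln_div)

theorem regret_upper_bound:
  fixes \<delta> :: real
  assumes \<delta>: "0 < \<delta>"
  shows "\<exists>C>0. \<forall>(m :: ('th, 'e) market) (X :: ('w, 'th, 'e) process) \<pi>\<^sub>1 P M \<eta> T.
    well_formed m \<longrightarrow> delta m = \<delta> \<longrightarrow> lipschitz_reward m M \<longrightarrow> 0 < \<eta> \<longrightarrow> \<eta> < 1 \<longrightarrow>
    lazy_transition (dim m) \<eta> P \<longrightarrow> dynamics m \<pi>\<^sub>1 P X \<longrightarrow>
    regret m X T \<le> C * (M * real (dim m) * max 1 (ln (2 / \<eta>) * \<eta> * real T))"
proof -
  \<comment> \<open>The cap at 1 keeps the contraction factor \<rho> strictly between 0 and
    1.\<close>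
  define \<delta>' where "\<delta>' = min \<delta> 1"
  define \<rho> where "\<rho> = 1 - \<delta>'\<^sup>2 / 8"
  define l where "l = - ln \<rho>"
  \<comment> \<open>\<open>1 / l\<close> comes from the window length, 4 absorbs rounding by means
    of \<open>ln (2 / \<eta>) \<ge> 1 / 2\<close>, and \<open>1 / (1 - \<rho>)\<close> is the total
    error of the early consumers, the part that does not shrink with \<eta>.\<close>
  define C where "C = 1 / l + 4 + 1 / (1 - \<rho>)"
  have \<delta>': "0 < \<delta>'" "\<delta>' \<le> 1" "\<delta>' \<le> \<delta>" using \<delta> by (auto simp: \<delta>'_def)
  have "\<delta>'\<^sup>2 \<le> 1" using \<delta>' by (simp add: power_le_one)
  then have \<rho>: "0 < \<rho>" "\<rho> < 1" using \<delta>' by (auto simp: \<rho>_def)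
  then have l: "l > 0" by (simp add: l_def)
  have C: "C > 0" unfolding C_def using l \<rho> by (intro add_pos_pos) auto
  have "regret m X T \<le> 2 * C * (M * real (dim m) * max 1 (ln (2 / \<eta>) * \<eta> * real T))"
    if wf: "well_formed m" and dm: "delta m = \<delta>" and lip: "lipschitz_reward m M" and \<eta>: "0 < \<eta>" "\<eta> < 1"
      and lazy: "lazy_transition (dim m) \<eta> P" and dyn: "dynamics m \<pi>\<^sub>1 P X"
    for m :: "('th, 'e) market" and X :: "('w, 'th, 'e) process" and \<pi>\<^sub>1 P M \<eta> T
  proof -
    interpret prob_space "sample X" using dyn by (simp add: dynamics_def)
    interpret market_process X m \<pi>\<^sub>1 P by unfold_locales (fact dyn wf)+
    have M: "M \<ge> 0" by (rule lipschitz_nonneg[OF lip wf])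
    define L where "L = ln (2 / \<eta>)"
    have L: "L \<ge> 1 / 2"
    proof -
      have "ln 2 \<le> L" unfolding L_def using \<eta> by (subst ln_le_cancel_iff) (auto simp: field_simps)
      then show ?thesis using ln_2_ge_half by simp
    qed
    \<comment> \<open>The least length for which
      \<open>\<rho> ^ N \<le> exp (- L) = \<eta> / 2\<close>.\<close>
    define N where "N = nat \<lceil>L / l\<rceil>"
    have N: "real N \<ge> L / l" "real N \<le> L / l + 1"
      using L l by (auto simp: N_def intro: of_nat_ceiling)
    have "\<rho> ^ N = exp (real N * ln \<rho>)" using \<rho> by (simp add: exp_of_nat_mult)
    also have "\<dots> \<le> exp (- L)" using N(1) l by (simp add: l_def field_simps)
    also have "\<dots> = \<eta> / 2" unfolding L_def using \<eta> by (simp add: exp_minus)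
    finally have \<rho>N: "\<rho> ^ N \<le> \<eta>" using \<eta> by simp
    have step: "(\<integral>w. regret_at (Suc t) w \<partial>W) \<le> 2 * M * real (dim m) * (real N * \<eta> + \<eta> + \<rho> ^ t)" for t
    proof -
      \<comment> \<open>A consumer with fewer than \<open>N\<close> predecessors uses the whole
        history as window; the error \<open>\<rho> ^ t\<close> that remains is summable over
        \<open>t\<close>.\<close>
      define n where "n = min t N"
      have "\<rho> ^ n \<le> \<eta> + \<rho> ^ t" unfolding n_def min_def using \<rho>N \<rho> \<eta> by (auto intro: add_increasing add_increasing2)
      moreover have "real n * \<eta> \<le> real N * \<eta>" unfolding n_def using \<eta> by (intro mult_right_mono) auto
      ultimately have "2 * M * real (dim m) * (real n * \<eta> + \<rho> ^ n) \<le> 2 * M * real (dim m) * (real N * \<eta> + \<eta> + \<rho> ^ t)"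
        using M by (intro mult_left_mono) auto
      moreover have "(\<integral>w. regret_at (Suc ((t - n) + n)) w \<partial>W) \<le> 2 * M * real (dim m) * (real n * \<eta> + \<rho> ^ n)"
        unfolding \<rho>_def using \<delta>' dm by (intro expected_regret_at_le_window lip M lazy) auto
      ultimately show ?thesis by (simp add: n_def)
    qed
    have "regret m X T = (\<Sum>t<T. \<integral>w. regret_at (Suc t) w \<partial>W)"
      unfolding regret_eq by (rule sum.reindex_bij_witness[of _ Suc "\<lambda>t. t - 1"]) auto
    also have "\<dots> \<le> (\<Sum>t<T. 2 * M * real (dim m) * (real N * \<eta> + \<eta> + \<rho> ^ t))"
      by (intro sum_mono step)
    also have "\<dots> = 2 * M * real (dim m) * (real T * (real N * \<eta> + \<eta>) + (\<Sum>t<T. \<rho> ^ t))"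
      by (simp add: sum_distrib_left[symmetric] sum.distrib)
    also have "\<dots> \<le> 2 * M * real (dim m) * (C * max 1 (L * \<eta> * real T))"
    proof (rule mult_left_mono)
      have "(\<Sum>t<T. \<rho> ^ t) = (1 - \<rho> ^ T) / (1 - \<rho>)" using \<rho> by (simp add: sum_gp_strict)
      also have "\<dots> \<le> 1 / (1 - \<rho>)" using \<rho> by (intro divide_right_mono) auto
      also have "\<dots> \<le> 1 / (1 - \<rho>) * max 1 (L * \<eta> * real T)" using \<rho> mult_left_mono[of 1 "max 1 (L * \<eta> * real T)" "1 / (1 - \<rho>)"] by simp
      finally have 1: "(\<Sum>t<T. \<rho> ^ t) \<le> 1 / (1 - \<rho>) * max 1 (L * \<eta> * real T)" .
      have "real N * \<eta> + \<eta> \<le> (L / l + 2) * \<eta>"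
        using N(2) \<eta> mult_right_mono[of "real N" "L / l + 1" \<eta>] by (simp add: algebra_simps)
      also have "\<dots> \<le> ((1 / l + 4) * L) * \<eta>"
        using L \<eta> by (intro mult_right_mono) (auto simp: algebra_simps)
      finally have "real T * (real N * \<eta> + \<eta>) \<le> real T * (((1 / l + 4) * L) * \<eta>)"
        by (intro mult_left_mono) auto
      also have "\<dots> = (1 / l + 4) * (L * \<eta> * real T)" by simp
      also have "\<dots> \<le> (1 / l + 4) * max 1 (L * \<eta> * real T)" using l by (intro mult_left_mono) auto
      finally show "real T * (real N * \<eta> + \<eta>) + (\<Sum>t<T. \<rho> ^ t) \<le> C * max 1 (L * \<eta> * real T)"
        unfolding C_def using 1 by (simp add: algebra_simps)
    qed (use M in auto)
    finally show ?thesis unfolding L_def by (simp add: mult_ac)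
  qed
  then show ?thesis using C by (intro exI[of _ "2 * C"]) auto
qed

section \<open>A market with two types of consumers and common noise\<close>

definition bit_pmf :: "real \<Rightarrow> real pmf" where
  "bit_pmf p = map_pmf of_bool (bernoulli_pmf p)"

lemma measure_bit_pmf:
  assumes "0 \<le> p" "p \<le> 1"
  shows "measure (measure_pmf (bit_pmf p)) A = (if 1 \<in> A then p else 0) + (if 0 \<in> A then 1 - p else 0)"
proof -
  have "measure (measure_pmf (bit_pmf p)) A = measure (measure_pmf (bernoulli_pmf p)) (of_bool -` A)"
    by (simp add: bit_pmf_def)
  also have "\<dots> = (\<Sum>b\<in>{b\<in>UNIV. of_bool b \<in> A}. pmf (bernoulli_pmf p) b)"
    by (subst measure_measure_pmf_finite) (auto simp: vimage_def)
  also have "\<dots> = (\<Sum>b\<in>UNIV. if of_bool b \<in> A then pmf (bernoulli_pmf p) b else 0)"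
    by (subst sum.inter_filter) auto
  finally show ?thesis using assms by (simp add: UNIV_bool)
qed

text \<open>Preference 1 always buys, which secures the purchase guarantee; any other preference
  gains or loses \<open>M * d / 2\<close> at the two extreme qualities. Preferences and noises are
  coded as reals so that one product of real coordinates can carry the whole process.\<close>

definition coin_market :: "nat \<Rightarrow> real \<Rightarrow> real \<Rightarrow> real \<Rightarrow> (real, real) market" where
  "coin_market d \<alpha> p M =
    \<lparr>dim = d, pref_law = measure_pmf (bit_pmf \<alpha>), noise_law = measure_pmf (bit_pmf p),
     reward = (\<lambda>q th. if th = 1 then 1 else M * ((\<Sum>i=1..d. q i) - real d / 2)),
     feedback = (\<lambda>i x e th. if e = 1 then x else 1 - x), outcomes = qualities d\<rparr>"

lemma coin_market_simps [simp]:
  "dim (coin_market d \<alpha> p M) = d"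
  "pref_law (coin_market d \<alpha> p M) = measure_pmf (bit_pmf \<alpha>)"
  "noise_law (coin_market d \<alpha> p M) = measure_pmf (bit_pmf p)"
  "reward (coin_market d \<alpha> p M) q th = (if th = 1 then 1 else M * ((\<Sum>i=1..d. q i) - real d / 2))"
  "feedback (coin_market d \<alpha> p M) i x e th = (if e = 1 then x else 1 - x)"
  "outcomes (coin_market d \<alpha> p M) = qualities d"
  by (auto simp: coin_market_def)

definition zeros :: "nat \<Rightarrow> vec" where "zeros d = (\<lambda>i\<in>{1..d}. 0)"
definition ones :: "nat \<Rightarrow> vec" where "ones d = (\<lambda>i\<in>{1..d}. 1)"

lemma zeros_in [simp]: "zeros d \<in> qualities d" and ones_in [simp]: "ones d \<in> qualities d"
  by (auto simp: qualities_def zeros_def ones_def)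

lemma zeros_apply [simp]: "i \<in> {1..d} \<Longrightarrow> zeros d i = 0" and ones_apply [simp]: "i \<in> {1..d} \<Longrightarrow> ones d i = 1"
  by (auto simp: zeros_def ones_def)

lemma zeros_neq_ones: "1 \<le> d \<Longrightarrow> zeros d \<noteq> ones d"
  using zeros_apply[of 1 d] ones_apply[of 1 d] by (metis atLeastAtMost_iff order_refl zero_neq_one)

lemma component_outcomes_coin: "i \<in> {1..d} \<Longrightarrow> component_outcomes (coin_market d \<alpha> p M) i = {0, 1}"
proof (intro equalityI subsetI)
  fix x assume i: "i \<in> {1..d}" and "x \<in> {0, 1 :: real}"
  then have "x = zeros d i \<or> x = ones d i" by auto
  then show "x \<in> component_outcomes (coin_market d \<alpha> p M) i"
    unfolding component_outcomes_def coin_market_simps using zeros_in ones_in by blast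
next
  fix x assume "i \<in> {1..d}" "x \<in> component_outcomes (coin_market d \<alpha> p M) i"
  then obtain q where "q \<in> qualities d" "i \<in> {1..d}" "x = q i"
    unfolding component_outcomes_def coin_market_simps by blast
  then show "x \<in> {0, 1}" using qualities_component by metis
qed

lemma well_formed_coin: "1 \<le> d \<Longrightarrow> well_formed (coin_market d \<alpha> p M)"
  unfolding well_formed_def
proof (intro conjI ballI)
  fix i and x :: real
  have "(\<lambda>y. (\<lambda>e. if e = 1 then x else 1 - x) (snd y)) \<in> borel_measurable
      (measure_pmf (bit_pmf \<alpha>) \<Otimes>\<^sub>M measure_pmf (bit_pmf p))"
    by (rule measurable_compose[OF measurable_snd]) simp
  then show "(\<lambda>(th, e). feedback (coin_market d \<alpha> p M) i x e th) \<in>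
      borel_measurable (pref_law (coin_market d \<alpha> p M) \<Otimes>\<^sub>M noise_law (coin_market d \<alpha> p M))"
    by (simp add: case_prod_beta)
next
  fix q th e assume "q \<in> qualities (dim (coin_market d \<alpha> p M))"
  then show "review_of (coin_market d \<alpha> p M) q th e \<in> outcomes (coin_market d \<alpha> p M)"
    by (auto simp: review_of_def qualities_def PiE_iff)
next
  show "outcomes (coin_market d \<alpha> p M) \<subseteq> extensional {1..dim (coin_market d \<alpha> p M)}"
    unfolding coin_market_simps qualities_def PiE_def by (rule Int_lower2)
qed (auto simp: measure_pmf.prob_space_axioms finite_qualities)

section \<open>Values of \<open>delta\<close> and \<open>gamma\<close> for this market\<close>

definition sales :: "nat \<Rightarrow> real \<Rightarrow> real \<Rightarrow> real \<Rightarrow> (vec \<Rightarrow> real) \<Rightarrow> real" where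
  "sales d \<alpha> p M b = measure (measure_pmf (bit_pmf \<alpha>)) {th. buys (coin_market d \<alpha> p M) b th}"

lemma measure_coin_pair:
  "measure (measure_pmf (bit_pmf \<alpha>) \<Otimes>\<^sub>M measure_pmf (bit_pmf p)) {y. fst y \<in> A \<and> snd y \<in> B}
    = measure (measure_pmf (bit_pmf \<alpha>)) A * measure (measure_pmf (bit_pmf p)) B"
proof -
  have "{y. fst y \<in> A \<and> snd y \<in> B} = A \<times> B" by auto
  moreover have "emeasure (measure_pmf (bit_pmf \<alpha>) \<Otimes>\<^sub>M measure_pmf (bit_pmf p)) (A \<times> B)
    = emeasure (measure_pmf (bit_pmf \<alpha>)) A * emeasure (measure_pmf (bit_pmf p)) B"
    by (intro measure_pmf.emeasure_pair_measure_Times) auto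
  ultimately show ?thesis by (simp add: measure_def enn2real_mult)
qed

text \<open>The purchase depends on the preference and the review on the noise, so the probability
  factors. The factor \<open>sales\<close> cancels in the ratios that define \<open>gamma\<close>
  and carries all dependence of \<open>delta\<close> on the belief.\<close>

lemma G_coin:
  assumes p: "0 < p" "p < 1" and x: "x \<in> {0, 1}" and z: "z \<in> {0, 1}"
  shows "G (coin_market d \<alpha> p M) i z \<pi> x = sales d \<alpha> p M (pmf \<pi>) * (if z = x then p else 1 - p)"
proof -
  have "G (coin_market d \<alpha> p M) i z \<pi> x = measure (measure_pmf (bit_pmf \<alpha>) \<Otimes>\<^sub>M measure_pmf (bit_pmf p))
      {y. fst y \<in> {th. buys (coin_market d \<alpha> p M) (pmf \<pi>) th} \<and> snd y \<in> {e. (if e = 1 then x else 1 - x) = z}}"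
    unfolding G_def coin_market_simps
    by (intro arg_cong[where f = "measure _"]) (auto simp: space_pair_measure)
  also have "\<dots> = sales d \<alpha> p M (pmf \<pi>) * measure (measure_pmf (bit_pmf p)) {e. (if e = 1 then x else 1 - x) = z}"
    unfolding sales_def by (rule measure_coin_pair)
  also have "measure (measure_pmf (bit_pmf p)) {e. (if e = 1 then x else 1 - x) = z} = (if z = x then p else 1 - p)"
    using x z p by (subst measure_bit_pmf) auto
  finally show ?thesis .
qed

lemma sales_ge:
  assumes \<alpha>: "0 < \<alpha>" "\<alpha> < 1" and \<pi>: "\<pi> \<in> beliefs d"
  shows "\<alpha> \<le> sales d \<alpha> p M (pmf \<pi>)"
proof -
  have "(\<Sum>q\<in>qualities d. pmf \<pi> q) = 1"
    using \<pi> finite_qualities by (intro sum_pmf_eq_1) (auto simp: beliefs_def)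
  then have "buys (coin_market d \<alpha> p M) (pmf \<pi>) 1" by (simp add: buys_def)
  then show ?thesis unfolding sales_def using \<alpha> by (simp add: measure_bit_pmf)
qed

text \<open>Certainty of quality zero leaves preference 1 as the only buyer; this belief attains the
  infimum in \<open>delta\<close>.\<close>

lemma sales_zeros:
  assumes \<alpha>: "0 < \<alpha>" "\<alpha> < 1" and M: "0 \<le> M"
  shows "sales d \<alpha> p M (pmf (return_pmf (zeros d))) = \<alpha>"
proof -
  have *: "(\<Sum>q\<in>qualities d. pmf (return_pmf (zeros d)) q * f q) = f (zeros d)" for f :: "vec \<Rightarrow> real"
  proof -
    have "(\<Sum>q\<in>qualities d. pmf (return_pmf (zeros d)) q * f q) = (\<Sum>q\<in>qualities d. if q = zeros d then f q else 0)"
      by (intro sum.cong) (auto simp: pmf_return indicator_def)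
    also have "\<dots> = f (zeros d)" using finite_qualities[of d] by (subst sum.delta) auto
    finally show ?thesis .
  qed
  have "buys (coin_market d \<alpha> p M) (pmf (return_pmf (zeros d))) 1"
    "\<not> buys (coin_market d \<alpha> p M) (pmf (return_pmf (zeros d))) 0"
    unfolding buys_def coin_market_simps * using mult_nonneg_nonneg[OF M, of "real d"] by auto
  then show ?thesis unfolding sales_def using \<alpha> by (simp add: measure_bit_pmf)
qed

lemma delta_coin:
  assumes d: "1 \<le> d" and \<alpha>: "0 < \<alpha>" "\<alpha> < 1" and p: "1 / 2 < p" "p < 1" and M: "0 \<le> M"
  shows "delta (coin_market d \<alpha> p M) = \<alpha> * (2 * (2 * p - 1))"
proof -
  let ?m = "coin_market d \<alpha> p M"
  have eq: "(\<Sum>z\<in>component_outcomes ?m i. \<bar>G ?m i z \<pi> 1 - G ?m i z \<pi> 0\<bar>) = sales d \<alpha> p M (pmf \<pi>) * (2 * (2 * p - 1))"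
    if "i \<in> {1..d}" for i \<pi>
  proof -
    have "sales d \<alpha> p M (pmf \<pi>) \<ge> 0" by (simp add: sales_def)
    then have "\<bar>sales d \<alpha> p M (pmf \<pi>) * (1 - p) - sales d \<alpha> p M (pmf \<pi>) * p\<bar> = sales d \<alpha> p M (pmf \<pi>) * (2 * p - 1)"
      "\<bar>sales d \<alpha> p M (pmf \<pi>) * p - sales d \<alpha> p M (pmf \<pi>) * (1 - p)\<bar> = sales d \<alpha> p M (pmf \<pi>) * (2 * p - 1)"
      using p by (simp_all add: abs_mult flip: right_diff_distrib)
    then show ?thesis using p by (simp add: component_outcomes_coin[OF that] G_coin)
  qed
  have in_z: "(1, return_pmf (zeros d)) \<in> {1..dim ?m} \<times> beliefs (dim ?m)"
    using d by (auto simp: beliefs_def)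
  show ?thesis unfolding delta_def
  proof (rule cInf_eq_minimum)
    show "\<alpha> * (2 * (2 * p - 1)) \<in> (\<lambda>(i, \<pi>). \<Sum>z\<in>component_outcomes ?m i. \<bar>G ?m i z \<pi> 1 - G ?m i z \<pi> 0\<bar>)
        ` ({1..dim ?m} \<times> beliefs (dim ?m))"
      using d by (intro image_eqI[OF _ in_z]) (simp add: eq sales_zeros[OF \<alpha> M])
  next
    fix x assume "x \<in> (\<lambda>(i, \<pi>). \<Sum>z\<in>component_outcomes ?m i. \<bar>G ?m i z \<pi> 1 - G ?m i z \<pi> 0\<bar>)
        ` ({1..dim ?m} \<times> beliefs (dim ?m))"
    then obtain i \<pi> where "i \<in> {1..d}" "\<pi> \<in> beliefs d" "x = sales d \<alpha> p M (pmf \<pi>) * (2 * (2 * p - 1))"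
      using eq by auto
    then show "\<alpha> * (2 * (2 * p - 1)) \<le> x"
      using p sales_ge[OF \<alpha>] by (auto intro!: mult_right_mono)
  qed
qed

lemma gamma_coin:
  assumes d: "1 \<le> d" and \<alpha>: "0 < \<alpha>" "\<alpha> < 1" and p: "1 / 2 < p" "p < 1"
  shows "gamma (coin_market d \<alpha> p M) = 2 * ln (p / (1 - p))"
proof -
  let ?m = "coin_market d \<alpha> p M"
  have "p / (1 - p) > 1" using p by (simp add: field_simps)
  then have pos: "ln (p / (1 - p)) > 0" by simp
  have inv: "(1 - p) / p = inverse (p / (1 - p))" using p by simp
  have "\<bar>ln (G ?m i (z i) \<pi> 1 / G ?m i (z i) \<pi> 0)\<bar> = ln (p / (1 - p))"
    if "i \<in> {1..d}" "\<pi> \<in> beliefs d" "z \<in> qualities d" for i \<pi> z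
  proof -
    have s: "sales d \<alpha> p M (pmf \<pi>) > 0" using sales_ge[OF \<alpha> that(2), of p M] \<alpha> by simp
    have z: "z i \<in> {0, 1}" by (rule qualities_component[OF that(3,1)])
    then have "G ?m i (z i) \<pi> 1 / G ?m i (z i) \<pi> 0 = (if z i = 1 then p / (1 - p) else (1 - p) / p)"
      using p s by (auto simp: G_coin)
    moreover have "\<bar>ln ((1 - p) / p)\<bar> = ln (p / (1 - p))"
      unfolding inv using p pos by (subst ln_inverse) auto
    ultimately show ?thesis using pos by simp
  qed
  then have "(\<lambda>(i, \<pi>, z). \<bar>ln (G ?m i (z i) \<pi> 1 / G ?m i (z i) \<pi> 0)\<bar>)
      ` ({1..dim ?m} \<times> beliefs (dim ?m) \<times> outcomes ?m)
    = (\<lambda>_. ln (p / (1 - p))) ` ({1..dim ?m} \<times> beliefs (dim ?m) \<times> outcomes ?m)"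
    by (intro image_cong refl) auto
  moreover have "(1, return_pmf (zeros d), zeros d) \<in> {1..dim ?m} \<times> beliefs (dim ?m) \<times> outcomes ?m"
    using d by (auto simp: beliefs_def)
  then have "{1..dim ?m} \<times> beliefs (dim ?m) \<times> outcomes ?m \<noteq> {}" by blast
  ultimately have "(\<lambda>(i, \<pi>, z). \<bar>ln (G ?m i (z i) \<pi> 1 / G ?m i (z i) \<pi> 0)\<bar>)
      ` ({1..dim ?m} \<times> beliefs (dim ?m) \<times> outcomes ?m) = {ln (p / (1 - p))}"
    unfolding image_constant_conv by (simp only: if_False)
  then show ?thesis unfolding gamma_def by simp
qed

lemma admissible_coin:
  assumes d: "1 \<le> d" and \<alpha>: "0 < \<alpha>" "\<alpha> < 1" and p: "1 / 2 < p" "p < 1" and M: "0 \<le> M"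
  shows "admissible (coin_market d \<alpha> p M)"
  unfolding admissible_def
proof (intro conjI)
  let ?m = "coin_market d \<alpha> p M"
  show "well_formed ?m" by (rule well_formed_coin[OF d])
  show "purchase_guarantee ?m" unfolding purchase_guarantee_def
  proof (intro conjI ballI)
    fix q i th assume "q \<in> qualities (dim ?m)" "i \<in> {1..dim ?m}" "th \<in> space (pref_law ?m)"
    have "(\<Sum>j=1..d. (q(i := 0)) j) \<le> (\<Sum>j=1..d. (q(i := 1)) j)" by (intro sum_mono) auto
    then show "reward ?m (q(i := 0)) th \<le> reward ?m (q(i := 1)) th"
      using M by (auto intro!: mult_left_mono simp del: fun_upd_apply)
  next
    fix q
    have "\<alpha> \<le> measure (measure_pmf (bit_pmf \<alpha>)) {th. reward ?m q th > 0}"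
      using \<alpha> by (subst measure_bit_pmf) auto
    then show "\<P>(th in pref_law ?m. reward ?m q th > 0) > 0"
      using \<alpha> by (simp del: coin_market_simps(4))
  qed
  show "identifiable ?m" unfolding identifiable_def
  proof (intro ballI conjI impI)
    fix i \<pi> x z assume "i \<in> {1..dim ?m}" "\<pi> \<in> beliefs (dim ?m)" "x \<in> {0, 1 :: real}" "z \<in> component_outcomes ?m i"
    then show "G ?m i z \<pi> x > 0"
      using sales_ge[OF \<alpha>, of \<pi> d p M] \<alpha> p component_outcomes_coin[of i d \<alpha> p M]
      by (subst G_coin) (auto intro!: mult_pos_pos)
  next
    fix i \<pi> x x' assume i: "i \<in> {1..dim ?m}" and \<pi>: "\<pi> \<in> beliefs (dim ?m)" and x: "x \<in> {0, 1 :: real}" "x' \<in> {0, 1 :: real}" "x \<noteq> x'"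
    have s: "sales d \<alpha> p M (pmf \<pi>) > 0" using sales_ge[OF \<alpha>, of \<pi> d p M] \<pi> \<alpha> by simp
    have "G ?m i (ones d i) \<pi> x \<noteq> G ?m i (ones d i) \<pi> x'"
      using i x s p by (auto simp: G_coin)
    then show "\<exists>z\<in>outcomes ?m. G ?m i (z i) \<pi> x \<noteq> G ?m i (z i) \<pi> x'"
      by (intro bexI[of _ "ones d"]) auto
  qed
qed

lemma lipschitz_coin:
  assumes "0 \<le> M"
  shows "lipschitz_reward (coin_market d \<alpha> p M) M"
  unfolding lipschitz_reward_def
proof (intro ballI)
  fix q q' :: vec and th
  have "\<bar>M * ((\<Sum>i=1..d. q i) - real d / 2) - M * ((\<Sum>i=1..d. q' i) - real d / 2)\<bar> = M * \<bar>\<Sum>i=1..d. q i - q' i\<bar>"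
    using assms by (simp add: sum_subtractf abs_mult flip: right_diff_distrib)
  also have "\<dots> \<le> M * (\<Sum>i=1..d. \<bar>q i - q' i\<bar>)" using assms by (intro mult_left_mono sum_abs)
  finally have "\<bar>M * ((\<Sum>i=1..d. q i) - real d / 2) - M * ((\<Sum>i=1..d. q' i) - real d / 2)\<bar> \<le> M * (\<Sum>i=1..d. \<bar>q i - q' i\<bar>)" .
  moreover have "0 \<le> M * (\<Sum>i=1..d. \<bar>q i - q' i\<bar>)" using assms by (simp add: sum_nonneg)
  ultimately show "\<bar>reward (coin_market d \<alpha> p M) q th - reward (coin_market d \<alpha> p M) q' th\<bar>
      \<le> M * (\<Sum>i=1..dim (coin_market d \<alpha> p M). \<bar>q i - q' i\<bar>)" by simp
qed

section \<open>The transition matrix with rare resets\<close>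

text \<open>Codes for \<open>move\<close>: 0 keeps the quality, 1 resets it to ones and 2 to zeros.
  A single real draw per transition lets the chain be driven by independent real
  coordinates.\<close>

definition reset_pmf :: "real \<Rightarrow> real pmf" where
  "reset_pmf \<eta> = bind_pmf (bernoulli_pmf \<eta>) (\<lambda>b. if b then map_pmf (\<lambda>c. if c then 1 else 2) (bernoulli_pmf (1 / 2)) else return_pmf 0)"

definition move :: "nat \<Rightarrow> real \<Rightarrow> vec \<Rightarrow> vec" where
  "move d x q = (if x = 0 then q else if x = 1 then ones d else zeros d)"

definition reset_transition :: "nat \<Rightarrow> real \<Rightarrow> vec \<Rightarrow> vec pmf" where
  "reset_transition d \<eta> q = map_pmf (\<lambda>x. move d x q) (reset_pmf \<eta>)"

lemma pmf_reset_transition: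
  assumes "0 < \<eta>" "\<eta> < 1"
  shows "pmf (reset_transition d \<eta> q) q' =
    (1 - \<eta>) * of_bool (q' = q) + \<eta> / 2 * of_bool (q' = ones d) + \<eta> / 2 * of_bool (q' = zeros d)"
proof -
  have "reset_transition d \<eta> q = bind_pmf (bernoulli_pmf \<eta>) (\<lambda>b. if b then
      bind_pmf (bernoulli_pmf (1 / 2)) (\<lambda>c. return_pmf (if c then ones d else zeros d)) else return_pmf q)"
    unfolding reset_transition_def reset_pmf_def map_bind_pmf
    by (intro bind_pmf_cong refl) (auto simp: pmf.map_comp o_def move_def map_pmf_def bind_assoc_pmf bind_return_pmf intro!: bind_pmf_cong)
  then show ?thesis using assms
    by (simp add: pmf_bind pmf_return indicator_def)
qed

lemma lazy_reset:
  assumes "0 < \<eta>" "\<eta> < 1"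
  shows "lazy_transition d \<eta> (reset_transition d \<eta>)"
  unfolding lazy_transition_def
proof (intro ballI conjI)
  fix q assume q: "q \<in> qualities d"
  show "set_pmf (reset_transition d \<eta> q) \<subseteq> qualities d"
    using q by (auto simp: reset_transition_def move_def)
  show "1 - \<eta> \<le> pmf (reset_transition d \<eta> q) q"
    using assms by (simp add: pmf_reset_transition)
qed

section \<open>Lower bound\<close>

locale reset_market = market_process X "coin_market d \<alpha> p M" \<pi>\<^sub>1 "reset_transition d \<eta>"
  for X :: "('w, real, real) process" and d \<alpha> p M \<pi>\<^sub>1 \<eta> +
  assumes d: "1 \<le> d" and \<alpha>: "0 < \<alpha>" "\<alpha> < 1" and p: "1 / 2 < p" "p < 1" and M: "0 \<le> M" and \<eta>: "0 < \<eta>" "\<eta> < 1"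
begin

abbreviation ratio :: real where "ratio \<equiv> p / (1 - p)"

lemma ratio_ge_1: "ratio \<ge> 1"
  using p by (simp add: field_simps)

text \<open>In this market the review does not depend on the preference, so 0 stands for any
  preference.\<close>

lemma review_event_eq: "review_event n h q z = (case z of None \<Rightarrow> {y. fst y \<in> {th. \<not> buys (coin_market d \<alpha> p M) (bel n h) th} \<and> snd y \<in> UNIV}
   | Some v \<Rightarrow> {y. fst y \<in> {th. buys (coin_market d \<alpha> p M) (bel n h) th} \<and> snd y \<in> {e. review_of (coin_market d \<alpha> p M) q 0 e = v}})"
proof -
  have "review_of (coin_market d \<alpha> p M) q th e = review_of (coin_market d \<alpha> p M) q 0 e" for th e
    by (simp add: review_of_def)
  then show ?thesis
    by (auto simp: review_event_def space_pair_measure split: option.split if_splits) metis+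
qed

text \<open>A non-purchase is equally likely under both qualities. Because the noise is common, a
  purchase reveals \<open>zeros d\<close> or \<open>ones d\<close> only, with probabilities
  \<open>p\<close> and \<open>1 - p\<close> in one order or the other; hence one factor
  \<open>ratio\<close>, whatever \<open>d\<close>.\<close>

lemma likelihood_ratio:
  "measure \<nu> (review_event n h (zeros d) z) \<le> ratio * measure \<nu> (review_event n h (ones d) z)"
proof (cases z)
  case None
  have "1 * measure \<nu> (review_event n h (ones d) z) \<le> ratio * measure \<nu> (review_event n h (ones d) z)"
    using ratio_ge_1 by (intro mult_right_mono) auto
  then show ?thesis by (simp add: None review_event_eq)
next
  case (Some v)
  let ?s = "measure (measure_pmf (bit_pmf \<alpha>)) {th. buys (coin_market d \<alpha> p M) (bel n h) th}"
  let ?r = "\<lambda>q. measure (measure_pmf (bit_pmf p)) {e. review_of (coin_market d \<alpha> p M) q 0 e = v}"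
  have eq: "measure \<nu> (review_event n h q z) = ?s * ?r q" for q
    unfolding review_event_eq Some option.case coin_market_simps by (rule measure_coin_pair)
  have rev: "review_of (coin_market d \<alpha> p M) (zeros d) 0 e = (if e = 1 then zeros d else ones d)"
    "review_of (coin_market d \<alpha> p M) (ones d) 0 e = (if e = 1 then ones d else zeros d)" for e
    by (auto simp: review_of_def zeros_def ones_def)
  have "?r (zeros d) \<le> ratio * ?r (ones d)"
    using p zeros_neq_ones[OF d] unfolding rev by (subst (1 2) measure_bit_pmf) (auto simp: field_simps)
  then have "?s * ?r (zeros d) \<le> ?s * (ratio * ?r (ones d))" by (intro mult_left_mono) auto
  then show ?thesis unfolding eq by (simp add: mult_ac)
qed

section \<open>Law of the reset chain and of its switches\<close>

lemma prob_trajectory_upd: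
  assumes t: "t \<ge> 1" and y: "y \<in> paths t" and q: "q \<in> S"
  shows "prob (trajectory t y \<inter> {w\<in>space W. quality X (Suc t) w = q}) = prob (trajectory t y) * pmf (reset_transition d \<eta> (y t)) q"
proof -
  define y' where "y' = y(Suc t := q)"
  have y': "y' s = y s" if "s \<le> t" for s using that by (simp add: y'_def)
  have q': "y' (Suc t) = q" by (simp add: y'_def)
  have 1: "trajectory t y \<inter> {w\<in>space W. quality X (Suc t) w = q} = trajectory (Suc t) y'"
    unfolding trajectory_def using y' q' by (auto simp: atLeastAtMostSuc_conv)
  have 2: "trajectory t y' = trajectory t y"
    unfolding trajectory_def using y' by auto
  have "prob (trajectory (Suc t) y') = prob (trajectory t y') * pmf (reset_transition d \<eta> (y' t)) (y' (Suc t))"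
    using t y q y' q' by (intro prob_trajectory_Suc) (auto simp: le_Suc_eq)
  then show ?thesis unfolding 1 2 y'[OF order_refl] q' .
qed

lemma prob_ones_Suc:
  "prob {w\<in>space W. quality X (Suc (Suc n)) w = ones d} = (1 - \<eta>) * prob {w\<in>space W. quality X (Suc n) w = ones d} + \<eta> / 2"
proof -
  let ?E = "{w\<in>space W. quality X (Suc (Suc n)) w = ones d}" and ?F = "{w\<in>space W. quality X (Suc n) w = ones d}"
  have E: "?E \<in> events" "?F \<in> events" using quality_events[of "Suc (Suc n)" "{ones d}"] quality_events[of "Suc n" "{ones d}"] by auto
  have "prob ?E = (\<Sum>y\<in>paths (Suc n). prob (?E \<inter> trajectory (Suc n) y))"
    by (rule prob_trajectory_sum[OF E(1)])
  also have "\<dots> = (\<Sum>y\<in>paths (Suc n). (1 - \<eta>) * prob (?F \<inter> trajectory (Suc n) y) + \<eta> / 2 * prob (space W \<inter> trajectory (Suc n) y))"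
  proof (rule sum.cong[OF refl])
    fix y assume y: "y \<in> paths (Suc n)"
    have "?F \<inter> trajectory (Suc n) y = (if y (Suc n) = ones d then trajectory (Suc n) y else {})"
      by (auto simp: trajectory_def)
    moreover have "space W \<inter> trajectory (Suc n) y = trajectory (Suc n) y" by (auto simp: trajectory_def)
    moreover have "prob (?E \<inter> trajectory (Suc n) y) = prob (trajectory (Suc n) y) * pmf (reset_transition d \<eta> (y (Suc n))) (ones d)"
      using y by (subst Int_commute) (intro prob_trajectory_upd, auto)
    ultimately show "prob (?E \<inter> trajectory (Suc n) y) = (1 - \<eta>) * prob (?F \<inter> trajectory (Suc n) y) + \<eta> / 2 * prob (space W \<inter> trajectory (Suc n) y)"
      using zeros_neq_ones[OF d] by (auto simp: pmf_reset_transition[OF \<eta>] algebra_simps)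
  qed
  also have "\<dots> = (1 - \<eta>) * prob ?F + \<eta> / 2 * prob (space W)"
    by (simp only: sum.distrib sum_distrib_left[symmetric] prob_trajectory_sum[OF E(2), symmetric] prob_trajectory_sum[OF sets.top, symmetric])
  finally show ?thesis by (simp add: prob_space)
qed

text \<open>Within \<open>k\<close> transitions a reset occurs with probability
  \<open>1 - (1 - \<eta>) ^ k\<close>, and the last one leads to ones with probability 1/2, whatever
  the initial law.\<close>

lemma prob_ones_ge: "prob {w\<in>space W. quality X (Suc k) w = ones d} \<ge> (1 - (1 - \<eta>) ^ k) / 2"
proof (induction k)
  case (Suc k)
  have "(1 - \<eta>) * ((1 - (1 - \<eta>) ^ k) / 2) \<le> (1 - \<eta>) * prob {w\<in>space W. quality X (Suc k) w = ones d}"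
    using Suc \<eta> by (intro mult_left_mono) auto
  moreover have "(1 - (1 - \<eta>) ^ Suc k) / 2 = (1 - \<eta>) * ((1 - (1 - \<eta>) ^ k) / 2) + \<eta> / 2"
    by (simp add: field_simps)
  ultimately show ?case unfolding prob_ones_Suc by linarith
qed simp

text \<open>For \<open>j < n\<close> zeros begin in period \<open>k + 2 + j\<close>, so the window
  ends at zeros; \<open>j = n\<close> is the comparison event without a switch, which ends at
  ones.\<close>

definition switch :: "nat \<Rightarrow> nat \<Rightarrow> nat \<Rightarrow> 'w set" where
  "switch k n j = {w\<in>space W. \<forall>s\<in>{Suc k..Suc k + n}. quality X s w = (if s \<le> Suc k + j then ones d else zeros d)}"

lemma switch_in_past: "switch k n j \<in> past 0"
proof -
  interpret p: sigma_algebra "space W" "past 0" by (rule sigma_algebra_past)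
  have "{w\<in>space W. quality X s w \<in> {if s \<le> Suc k + j then ones d else zeros d}} \<in> past 0" if "s \<in> {Suc k..Suc k + n}" for s
    using that by (intro quality_in_past) auto
  then show ?thesis unfolding switch_def by (intro p.sets_Collect_finite_All) auto
qed

lemma switch_events [measurable]: "switch k n j \<in> events"
  using switch_in_past past_events by blast

lemma switch_disjoint: "i < j \<Longrightarrow> j \<le> n \<Longrightarrow> switch k n i \<inter> switch k n j = {}"
proof -
  assume ij: "i < j" "j \<le> n"
  have False if "w \<in> switch k n i" "w \<in> switch k n j" for w
  proof -
    have "Suc k + j \<in> {Suc k..Suc k + n}" using ij by auto
    then have "quality X (Suc k + j) w = (if Suc k + j \<le> Suc k + i then ones d else zeros d)"
      "quality X (Suc k + j) w = (if Suc k + j \<le> Suc k + j then ones d else zeros d)"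
      using that unfolding switch_def by blast+
    then show False using zeros_neq_ones[OF d] ij by simp
  qed
  then show ?thesis by blast
qed

definition switched :: "nat \<Rightarrow> nat \<Rightarrow> (nat \<Rightarrow> vec) \<Rightarrow> nat \<Rightarrow> vec" where
  "switched k j y s = (if s \<le> Suc k then y s else if s \<le> Suc k + j then ones d else zeros d)"

lemma switchD: "w \<in> switch k n j \<Longrightarrow> s \<in> {Suc k..Suc k + n} \<Longrightarrow> quality X s w = (if s \<le> Suc k + j then ones d else zeros d)"
  unfolding switch_def by blast

lemma switchI: "w \<in> space W \<Longrightarrow> (\<And>s. s \<in> {Suc k..Suc k + n} \<Longrightarrow> quality X s w = (if s \<le> Suc k + j then ones d else zeros d)) \<Longrightarrow> w \<in> switch k n j"
  unfolding switch_def by blast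

lemma trajectoryD: "w \<in> trajectory t y \<Longrightarrow> s \<in> {1..t} \<Longrightarrow> quality X s w = y s"
  unfolding trajectory_def by blast

lemma trajectoryI: "w \<in> space W \<Longrightarrow> (\<And>s. s \<in> {1..t} \<Longrightarrow> quality X s w = y s) \<Longrightarrow> w \<in> trajectory t y"
  unfolding trajectory_def by blast

lemma trajectory_space: "w \<in> trajectory t y \<Longrightarrow> w \<in> space W"
  unfolding trajectory_def by blast

lemma switch_trajectory:
  assumes "y (Suc k) = ones d"
  shows "switch k n j \<inter> trajectory (Suc k) y = trajectory (Suc k + n) (switched k j y)"
proof (intro equalityI subsetI)
  fix w assume "w \<in> switch k n j \<inter> trajectory (Suc k) y"
  then have w: "w \<in> switch k n j" "w \<in> trajectory (Suc k) y" by simp_all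
  note sw = switchD[OF w(1)] and tr = trajectoryD[OF w(2)] and sp = trajectory_space[OF w(2)]
  have "quality X s w = switched k j y s" if "s \<in> {1..Suc k + n}" for s
    using that sw[of s] tr[of s] by (cases "s \<le> Suc k") (simp_all add: switched_def)
  then show "w \<in> trajectory (Suc k + n) (switched k j y)"
    using sp by (intro trajectoryI)
next
  fix w assume w: "w \<in> trajectory (Suc k + n) (switched k j y)"
  note tr = trajectoryD[OF w] and sp = trajectory_space[OF w]
  have "quality X s w = (if s \<le> Suc k + j then ones d else zeros d)" if "s \<in> {Suc k..Suc k + n}" for s
  proof (cases "s = Suc k")
    case True
    then show ?thesis using tr[of "Suc k"] assms by (simp add: switched_def)
  next
    case False
    then show ?thesis using tr[of s] that by (simp add: switched_def)
  qed
  then have "w \<in> switch k n j" using sp by (intro switchI)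
  moreover have "quality X s w = y s" if "s \<in> {1..Suc k}" for s
    using tr[of s] that by (simp add: switched_def)
  then have "w \<in> trajectory (Suc k) y" using sp by (intro trajectoryI)
  ultimately show "w \<in> switch k n j \<inter> trajectory (Suc k) y" by blast
qed

lemma switch_trajectory_empty: "y (Suc k) \<noteq> ones d \<Longrightarrow> switch k n j \<inter> trajectory (Suc k) y = {}"
proof -
  assume y: "y (Suc k) \<noteq> ones d"
  have "quality X (Suc k) w = ones d" "quality X (Suc k) w = y (Suc k)"
    if "w \<in> switch k n j \<inter> trajectory (Suc k) y" for w
    using switchD[of w k n j "Suc k"] trajectoryD[of w "Suc k" y "Suc k"] that by simp_all
  then show ?thesis using y by (metis all_not_in_conv)
qed

lemma switched_in: "y \<in> paths (Suc k) \<Longrightarrow> s \<in> {1..Suc k + n} \<Longrightarrow> switched k j y s \<in> S"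
  by (auto simp: switched_def)

lemma prob_switched_Suc:
  assumes "y \<in> paths (Suc k)"
  shows "prob (trajectory (Suc k + Suc n) (switched k j y)) = prob (trajectory (Suc k + n) (switched k j y)) *
    pmf (reset_transition d \<eta> (switched k j y (Suc k + n))) (switched k j y (Suc k + Suc n))"
  using prob_trajectory_Suc[of "Suc k + n" "switched k j y"] switched_in[OF assms, of _ "Suc n" j] by simp

text \<open>A transition keeps an extreme quality with probability \<open>1 - \<eta> / 2\<close>,
  since a reset may return to the same quality; the single switching transition has probability
  \<open>\<eta> / 2\<close>.\<close>

lemma prob_switched:
  assumes y: "y \<in> paths (Suc k)" "y (Suc k) = ones d"
  shows "prob (trajectory (Suc k + n) (switched k j y)) =
    prob (trajectory (Suc k) y) * (if j < n then \<eta> / 2 * (1 - \<eta> / 2) ^ (n - 1) else (1 - \<eta> / 2) ^ n)"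
proof (induction n)
  case 0
  have "trajectory (Suc k) (switched k j y) = trajectory (Suc k) y" unfolding trajectory_def switched_def by auto
  then show ?case by simp
next
  case (Suc n)
  note z = zeros_neq_ones[OF d] zeros_neq_ones[OF d, symmetric]
  consider "Suc n \<le> j" | "n = j" | "j < n" by linarith
  then show ?case
  proof cases
    case 1
    then have "switched k j y (Suc k + n) = ones d" "switched k j y (Suc k + Suc n) = ones d"
      using y(2) by (auto simp: switched_def)
    then show ?thesis unfolding prob_switched_Suc[OF y(1)] Suc using 1 z by (simp add: pmf_reset_transition[OF \<eta>] field_simps)
  next
    case 2
    then have "switched k j y (Suc k + n) = ones d" "switched k j y (Suc k + Suc n) = zeros d"
      using y(2) by (auto simp: switched_def)
    then show ?thesis unfolding prob_switched_Suc[OF y(1)] Suc using 2 z by (simp add: pmf_reset_transition[OF \<eta>])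
  next
    case 3
    then have "switched k j y (Suc k + n) = zeros d" "switched k j y (Suc k + Suc n) = zeros d"
      using y(2) by (auto simp: switched_def)
    moreover have "(1 - \<eta> / 2) ^ n = (1 - \<eta> / 2) ^ (n - 1) * (1 - \<eta> / 2)" using 3 by (cases n) auto
    ultimately show ?thesis unfolding prob_switched_Suc[OF y(1)] Suc using 3 z by (simp add: pmf_reset_transition[OF \<eta>])
  qed
qed

lemma prob_switch:
  assumes "j < n"
  shows "prob (switch k n j) = prob {w\<in>space W. quality X (Suc k) w = ones d} * (\<eta> / 2 * (1 - \<eta> / 2) ^ (n - 1))"
proof -
  let ?F = "{w\<in>space W. quality X (Suc k) w = ones d}"
  have F: "?F \<in> events" using quality_events[of "Suc k" "{ones d}"] by auto
  have "prob (switch k n j) = (\<Sum>y\<in>paths (Suc k). prob (switch k n j \<inter> trajectory (Suc k) y))"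
    by (rule prob_trajectory_sum[OF switch_events])
  also have "\<dots> = (\<Sum>y\<in>paths (Suc k). prob (?F \<inter> trajectory (Suc k) y) * (\<eta> / 2 * (1 - \<eta> / 2) ^ (n - 1)))"
  proof (rule sum.cong[OF refl])
    fix y assume y: "y \<in> paths (Suc k)"
    show "prob (switch k n j \<inter> trajectory (Suc k) y) = prob (?F \<inter> trajectory (Suc k) y) * (\<eta> / 2 * (1 - \<eta> / 2) ^ (n - 1))"
    proof (cases "y (Suc k) = ones d")
      case True
      then have "?F \<inter> trajectory (Suc k) y = trajectory (Suc k) y" by (auto simp: trajectory_def)
      then show ?thesis using True assms by (simp add: switch_trajectory prob_switched[OF y] del: add_Suc)
    next
      case False
      then have "?F \<inter> trajectory (Suc k) y = {}" by (auto simp: trajectory_def)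
      then show ?thesis using switch_trajectory_empty[of y k, OF False] by simp
    qed
  qed
  also have "\<dots> = prob ?F * (\<eta> / 2 * (1 - \<eta> / 2) ^ (n - 1))"
    by (simp only: sum_distrib_right[symmetric] prob_trajectory_sum[OF F, symmetric])
  finally show ?thesis .
qed

text \<open>Compares a switch after \<open>j\<close> steps with no switch, separately for each path
  up to period \<open>k + 1\<close>. The prior odds are
  \<open>(\<eta> / 2) / (1 - \<eta> / 2) \<le> \<eta>\<close>, and at most \<open>n\<close> reviews
  see different qualities, each worth a factor \<open>ratio\<close>.\<close>

lemma switch_hist_le:
  assumes j: "j < n" and h: "length h = k + n"
  shows "prob (switch k n j \<inter> hist (k + n) h) \<le> \<eta> * ratio ^ n * prob (switch k n n \<inter> hist (k + n) h)"
proof -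
  have "prob (switch k n j \<inter> hist (k + n) h \<inter> trajectory (Suc k) y) \<le>
      \<eta> * ratio ^ n * prob (switch k n n \<inter> hist (k + n) h \<inter> trajectory (Suc k) y)"
    if y: "y \<in> paths (Suc k)" for y
  proof (cases "y (Suc k) = ones d")
    case True
    let ?L = "\<lambda>i u. measure \<nu> (review_event u (take u h) (switched k i y (Suc u)) (h ! u))"
    have eq: "prob (switch k n i \<inter> hist (k + n) h \<inter> trajectory (Suc k) y) =
        prob (trajectory (Suc k + n) (switched k i y)) * (\<Prod>u<k + n. ?L i u)" for i
    proof -
      have sw: "switch k n i \<inter> hist (k + n) h \<inter> trajectory (Suc k) y = trajectory (Suc k + n) (switched k i y) \<inter> hist (k + n) h"
        using switch_trajectory[of y k n i, OF True] by blast
      show ?thesis unfolding sw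
      proof (rule prob_trajectory_hist[OF trajectory_in_past _ _ h])
        show "switched k i y u \<in> S" if "u \<in> {1..k + n}" for u
          using that by (intro switched_in[OF y, of _ n]) auto
        show "quality X u w = switched k i y u" if "w \<in> trajectory (Suc k + n) (switched k i y)" "u \<in> {1..k + n}" for u w
          using that by (auto simp: trajectory_def)
      qed
    qed
    \<comment> \<open>Factor \<open>u\<close> belongs to the review of period \<open>u + 1\<close>.
      For \<open>u < k\<close> the two paths agree; the other \<open>n\<close> factors get the crude
      bound \<open>ratio\<close>, even where the paths still agree.\<close>
    have "(\<Prod>u<k + n. ?L j u) \<le> (\<Prod>u<k + n. (if u < k then 1 else ratio) * ?L n u)"
    proof (intro prod_mono conjI)
      fix u assume u: "u \<in> {..<k + n}"
      have cases: "switched k j y (Suc u) = switched k n y (Suc u) \<or>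
          (u \<ge> k \<and> switched k j y (Suc u) = zeros d \<and> switched k n y (Suc u) = ones d)"
        using u by (auto simp: switched_def)
      have "1 * ?L n u \<le> ratio * ?L n u" using ratio_ge_1 by (intro mult_right_mono) auto
      then show "?L j u \<le> (if u < k then 1 else ratio) * ?L n u"
        using cases likelihood_ratio[of u "take u h" "h ! u"] by (elim disjE conjE) (auto simp del: times_divide_eq_left)
    qed simp
    also have "\<dots> = ratio ^ n * (\<Prod>u<k + n. ?L n u)"
    proof -
      have "(\<Prod>u<k + n. (if u < k then 1 else ratio)) = (\<Prod>u\<in>{k..<k+n}. ratio)"
        by (rule prod.mono_neutral_cong_right) auto
      then show ?thesis by (simp add: prod.distrib)
    qed
    finally have L: "(\<Prod>u<k + n. ?L j u) \<le> ratio ^ n * (\<Prod>u<k + n. ?L n u)" .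
    have "prob (trajectory (Suc k + n) (switched k j y)) \<le> \<eta> * prob (trajectory (Suc k + n) (switched k n y))"
    proof -
      have n: "(1 - \<eta> / 2) ^ n = (1 - \<eta> / 2) ^ (n - 1) * (1 - \<eta> / 2)" using j by (cases n) auto
      have "\<eta> / 2 \<le> \<eta> * (1 - \<eta> / 2)" using \<eta> by (simp add: field_simps)
      then have "\<eta> / 2 * (1 - \<eta> / 2) ^ (n - 1) \<le> \<eta> * (1 - \<eta> / 2) * (1 - \<eta> / 2) ^ (n - 1)"
        using \<eta> by (intro mult_right_mono) auto
      then have "prob (trajectory (Suc k) y) * (\<eta> / 2 * (1 - \<eta> / 2) ^ (n - 1)) \<le> prob (trajectory (Suc k) y) * (\<eta> * (1 - \<eta> / 2) ^ n)"
        unfolding n by (intro mult_left_mono) (auto simp: mult_ac)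
      then show ?thesis using prob_switched[OF y True, of n j] prob_switched[OF y True, of n n] j by (simp add: mult_ac)
    qed
    then have "prob (trajectory (Suc k + n) (switched k j y)) * (\<Prod>u<k + n. ?L j u) \<le>
      (\<eta> * prob (trajectory (Suc k + n) (switched k n y))) * (ratio ^ n * (\<Prod>u<k + n. ?L n u))"
      using L \<eta> by (intro mult_mono) (auto intro: prod_nonneg)
    then show ?thesis unfolding eq by (simp add: mult_ac)
  next
    case False
    have "switch k n i \<inter> hist (k + n) h \<inter> trajectory (Suc k) y = {}" for i
      using switch_trajectory_empty[of y k n i, OF False] by blast
    then show ?thesis by simp
  qed
  then have "(\<Sum>y\<in>paths (Suc k). prob (switch k n j \<inter> hist (k + n) h \<inter> trajectory (Suc k) y)) \<le>
    (\<Sum>y\<in>paths (Suc k). \<eta> * ratio ^ n * prob (switch k n n \<inter> hist (k + n) h \<inter> trajectory (Suc k) y))"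
    by (intro sum_mono)
  then show ?thesis
    using prob_trajectory_sum[of "switch k n i \<inter> hist (k + n) h" "Suc k" for i] by (simp add: sum_distrib_left[symmetric])
qed

section \<open>Ambiguity between the extreme qualities and its cost\<close>

text \<open>The unnormalised error of the optimal test between the two extreme qualities; joint
  probabilities avoid dividing by the probability of the history.\<close>

definition ambiguity :: "nat \<Rightarrow> real" where
  "ambiguity n = (\<Sum>h\<in>histories n. min (prob ({w\<in>space W. quality X (Suc n) w = zeros d} \<inter> hist n h))
    (prob ({w\<in>space W. quality X (Suc n) w = ones d} \<inter> hist n h)))"

text \<open>The switches with \<open>j < n\<close> are disjoint and end at zeros, so their joint
  mass \<open>B\<close> with a history is at most that of zeros; by \<open>switch_hist_le\<close> it
  is also at most \<open>K\<close> times that of ones. Hence \<open>B / K\<close> is below the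
  minimum, and summing over histories leaves the unconditional probability of a switch.\<close>

lemma ambiguity_ge_window:
  assumes K: "K \<ge> 1" "real n * \<eta> * ratio ^ n \<le> K"
  shows "ambiguity (k + n) \<ge> real n * (\<eta> / 2 * (1 - \<eta> / 2) ^ (n - 1)) * ((1 - (1 - \<eta>) ^ k) / 2) / K"
proof -
  let ?Z = "\<lambda>h. prob ({w\<in>space W. quality X (Suc (k + n)) w = zeros d} \<inter> hist (k + n) h)"
  let ?O = "\<lambda>h. prob ({w\<in>space W. quality X (Suc (k + n)) w = ones d} \<inter> hist (k + n) h)"
  define B where "B h = (\<Sum>j<n. prob (switch k n j \<inter> hist (k + n) h))" for h
  have ev: "{w\<in>space W. quality X (Suc (k + n)) w = q} \<in> events" for q
    using quality_events[of "Suc (k + n)" "{q}"] by simp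
  have BZ: "B h \<le> ?Z h" for h
  proof -
    have "B h = prob (\<Union>j\<in>{..<n}. switch k n j \<inter> hist (k + n) h)"
      unfolding B_def
    proof (rule finite_measure_finite_Union[symmetric])
      show "disjoint_family_on (\<lambda>j. switch k n j \<inter> hist (k + n) h) {..<n}"
        unfolding disjoint_family_on_def
      proof (intro ballI impI)
        fix i j assume "i \<in> {..<n}" "j \<in> {..<n}" "i \<noteq> j"
        then have "switch k n i \<inter> switch k n j = {}"
          using switch_disjoint[of i j n k] switch_disjoint[of j i n k] by (cases "i < j") auto
        then show "switch k n i \<inter> hist (k + n) h \<inter> (switch k n j \<inter> hist (k + n) h) = {}" by blast
      qed
    qed auto
    also have "\<dots> \<le> ?Z h"
      using ev by (intro finite_measure_mono) (auto simp: switch_def)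
    finally show ?thesis .
  qed
  have BO: "B h \<le> K * ?O h" if h: "h \<in> histories (k + n)" for h
  proof -
    have "length h = k + n" using h by (simp add: histories_def)
    then have "B h \<le> (\<Sum>j<n. \<eta> * ratio ^ n * prob (switch k n n \<inter> hist (k + n) h))"
      unfolding B_def by (intro sum_mono switch_hist_le) auto
    also have "\<dots> = (real n * \<eta> * ratio ^ n) * prob (switch k n n \<inter> hist (k + n) h)" by simp
    also have "\<dots> \<le> K * ?O h"
    proof (intro mult_mono K(2))
      show "prob (switch k n n \<inter> hist (k + n) h) \<le> ?O h"
        using ev by (intro finite_measure_mono) (auto simp: switch_def)
    qed (use K in auto)
    finally show ?thesis .
  qed
  have "B h / K \<le> min (?Z h) (?O h)" if h: "h \<in> histories (k + n)" for h
  proof -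
    have "B h \<ge> 0" by (auto simp: B_def intro!: sum_nonneg)
    then have "B h / K \<le> B h" using K(1) by (simp add: divide_le_eq mult_left_mono[of 1 K "B h", simplified])
    moreover have "B h / K \<le> ?O h" using BO[OF h] K(1) by (simp add: divide_le_eq mult.commute)
    ultimately show ?thesis using BZ[of h] by simp
  qed
  then have "(\<Sum>h\<in>histories (k + n). B h) / K \<le> ambiguity (k + n)"
    unfolding ambiguity_def sum_divide_distrib by (intro sum_mono)
  moreover have "(\<Sum>h\<in>histories (k + n). B h) = (\<Sum>j<n. prob (switch k n j))"
    unfolding B_def by (subst sum.swap) (simp add: prob_hist_sum[OF switch_events, of _ _ _ "k + n", symmetric])
  moreover have "(\<Sum>j<n. prob (switch k n j)) = real n * (prob {w\<in>space W. quality X (Suc k) w = ones d} * (\<eta> / 2 * (1 - \<eta> / 2) ^ (n - 1)))"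
    by (simp add: prob_switch)
  moreover have "real n * (\<eta> / 2 * (1 - \<eta> / 2) ^ (n - 1)) * ((1 - (1 - \<eta>) ^ k) / 2) \<le>
     real n * (\<eta> / 2 * (1 - \<eta> / 2) ^ (n - 1)) * prob {w\<in>space W. quality X (Suc k) w = ones d}"
    using \<eta> by (intro mult_left_mono prob_ones_ge) auto
  ultimately have "real n * (\<eta> / 2 * (1 - \<eta> / 2) ^ (n - 1)) * ((1 - (1 - \<eta>) ^ k) / 2) \<le> (\<Sum>h\<in>histories (k + n). B h)"
    by (simp add: mult_ac)
  then have "real n * (\<eta> / 2 * (1 - \<eta> / 2) ^ (n - 1)) * ((1 - (1 - \<eta>) ^ k) / 2) / K \<le> (\<Sum>h\<in>histories (k + n). B h) / K"
    using K(1) by (intro divide_right_mono) auto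
  then show ?thesis using \<open>(\<Sum>h\<in>histories (k + n). B h) / K \<le> ambiguity (k + n)\<close> by linarith
qed

text \<open>Given the qualities so far, the transition after period \<open>n\<close> is independent
  of the first \<open>n\<close> reviews, and it leads to either extreme with probability at least
  \<open>\<eta> / 2\<close>.\<close>

lemma prob_quality_hist_ge:
  assumes n: "n \<ge> 1" and h: "length h = n" and q: "q = zeros d \<or> q = ones d"
  shows "\<eta> / 2 * prob (hist n h) \<le> prob ({w\<in>space W. quality X (Suc n) w = q} \<inter> hist n h)"
proof -
  let ?E = "{w\<in>space W. quality X (Suc n) w = q}"
  have E: "?E \<in> events" and Ep: "?E \<in> past 0"
    using quality_events[of "Suc n" "{q}"] quality_in_past[of "Suc n" "{q}" 0] by auto
  interpret p: sigma_algebra "space W" "past 0" by (rule sigma_algebra_past)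
  have qS: "q \<in> S" using q by auto
  have "\<eta> / 2 * prob (hist n h \<inter> trajectory n y) \<le> prob (?E \<inter> hist n h \<inter> trajectory n y)" if y: "y \<in> paths n" for y
  proof -
    let ?L = "\<Prod>u<n. measure \<nu> (review_event u (take u h) (y (Suc u)) (h ! u))"
    have "prob (?E \<inter> hist n h \<inter> trajectory n y) = prob ((trajectory n y \<inter> ?E) \<inter> hist n h)"
      by (rule arg_cong[where f = prob]) blast
    also have "\<dots> = prob (trajectory n y \<inter> ?E) * ?L"
      using y trajectory_in_past Ep by (intro prob_trajectory_hist h p.Int) (auto simp: trajectory_def)
    also have "prob (trajectory n y \<inter> ?E) = prob (trajectory n y) * pmf (reset_transition d \<eta> (y n)) q"
      by (rule prob_trajectory_upd[OF n y qS])
    finally have 1: "prob (?E \<inter> hist n h \<inter> trajectory n y) = pmf (reset_transition d \<eta> (y n)) q * (prob (trajectory n y) * ?L)"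
      by simp
    have "prob (hist n h \<inter> trajectory n y) = prob (trajectory n y \<inter> hist n h)" by (simp add: Int_commute)
    also have "\<dots> = prob (trajectory n y) * ?L"
      using y by (intro prob_trajectory_hist h trajectory_in_past) (auto simp: trajectory_def)
    finally have 2: "prob (hist n h \<inter> trajectory n y) = prob (trajectory n y) * ?L" .
    have "\<eta> / 2 \<le> pmf (reset_transition d \<eta> (y n)) q"
      using q \<eta> by (auto simp: pmf_reset_transition[OF \<eta>])
    then show ?thesis unfolding 1 2 by (intro mult_right_mono mult_nonneg_nonneg prod_nonneg) auto
  qed
  then have "(\<Sum>y\<in>paths n. \<eta> / 2 * prob (hist n h \<inter> trajectory n y)) \<le> (\<Sum>y\<in>paths n. prob (?E \<inter> hist n h \<inter> trajectory n y))"
    by (intro sum_mono)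
  then show ?thesis
    using prob_trajectory_sum[of "hist n h" n] prob_trajectory_sum[of "?E \<inter> hist n h" n] E
    by (simp add: sum_distrib_left[symmetric] del: times_divide_eq_left)
qed

text \<open>The bound for \<eta> bounded away from 0, where \<open>ln (2 / \<eta>)\<close> is
  bounded and the last transition alone suffices.\<close>

lemma ambiguity_ge_reset:
  assumes "n \<ge> 1"
  shows "ambiguity n \<ge> \<eta> / 2"
proof -
  have "\<eta> / 2 = (\<Sum>h\<in>histories n. \<eta> / 2 * prob (space W \<inter> hist n h))"
    unfolding sum_distrib_left[symmetric] using prob_hist_sum[of "space W" n] by (simp add: prob_space)
  also have "\<dots> \<le> ambiguity n"
    unfolding ambiguity_def
  proof (rule sum_mono)
    fix h assume "h \<in> histories n"
    then have h: "length h = n" by (simp add: histories_def)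
    have "space W \<inter> hist n h = hist n h" by auto
    then show "\<eta> / 2 * prob (space W \<inter> hist n h) \<le> min (prob ({w\<in>space W. quality X (Suc n) w = zeros d} \<inter> hist n h))
        (prob ({w\<in>space W. quality X (Suc n) w = ones d} \<inter> hist n h))"
      using prob_quality_hist_ge[OF assms h] by (simp del: times_divide_eq_left)
  qed
  finally show ?thesis .
qed

text \<open>For a consumer whose preference is not 1, which has probability
  \<open>1 - \<alpha>\<close>, the history fixes the decision. If she buys, zeros cost
  \<open>M * d / 2\<close>; if she does not, ones cost the same. Either way the costly quality has
  at least the smaller of the two masses.\<close>

lemma expected_regret_ge:
  "(\<integral>w. regret_at (Suc n) w \<partial>W) \<ge> M * real d / 2 * (1 - \<alpha>) * ambiguity n"
proof -
  let ?m = "coin_market d \<alpha> p M"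
  let ?Q = "\<lambda>q. {w\<in>space W. quality X (Suc n) w = q}"
  define T where "T b = {w\<in>space W. (preference X (Suc n) w, noise X (Suc n) w) \<in> {y. fst y \<in> {th. (th = 1) = b} \<and> snd y \<in> UNIV}}" for b
  \<comment> \<open>The reward sees a preference only through whether it equals 1, so
    \<open>of_bool b\<close> can represent it.\<close>
  define c where "c h q b = max (reward ?m q (of_bool b)) 0 -
      (if buys ?m (bel n h) (of_bool b) then reward ?m q (of_bool b) else 0)" for h q b
  have c0: "c h q b \<ge> 0" for h q b unfolding c_def by auto
  have Q: "?Q q \<in> past n" for q using quality_in_past[of "Suc n" "{q}" n] by simp
  have Bs: "{y. fst y \<in> A \<and> snd y \<in> UNIV} \<in> sets \<nu>" for A :: "real set"
  proof -
    have "{y. fst y \<in> A \<and> snd y \<in> UNIV} = A \<times> (UNIV :: real set)" by auto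
    then show ?thesis by simp
  qed
  have T: "T b \<in> events" for b
    unfolding T_def by (rule subsetD[OF past_events pair_in_past[OF Bs, where n = "Suc n"]]) simp
  have pT: "prob (?Q q \<inter> hist n h \<inter> T b) = prob (?Q q \<inter> hist n h) * (if b then \<alpha> else 1 - \<alpha>)" for q h b
  proof -
    have "prob (?Q q \<inter> hist n h \<inter> T b) = prob (?Q q \<inter> hist n h) * measure \<nu> {y. fst y \<in> {th. (th = 1) = b} \<and> snd y \<in> UNIV}"
      unfolding T_def by (rule prob_hist_pair[OF Q Bs])
    also have "measure \<nu> {y. fst y \<in> {th. (th = 1) = b} \<and> snd y \<in> UNIV} = (if b then \<alpha> else 1 - \<alpha>)"
      unfolding coin_market_simps measure_coin_pair using \<alpha> by (subst measure_bit_pmf) auto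
    finally show ?thesis .
  qed
  define f where "f = (\<lambda>w. \<Sum>h\<in>histories n. \<Sum>q\<in>S. \<Sum>b\<in>UNIV. c h q b * indicator (?Q q \<inter> hist n h \<inter> T b) w)"
  have f: "regret_at (Suc n) w = f w" if w: "w \<in> space W" for w
  proof -
    let ?h = "reviews ?m X n w" and ?q = "quality X (Suc n) w" and ?b = "preference X (Suc n) w = 1"
    have "f w = (\<Sum>h\<in>histories n. \<Sum>q\<in>S. \<Sum>b\<in>UNIV. if h = ?h then (if q = ?q then (if b = ?b then c h q b else 0) else 0) else 0)"
      unfolding f_def using w by (intro sum.cong refl) (auto simp: indicator_def T_def)
    also have "\<dots> = (\<Sum>h\<in>histories n. \<Sum>q\<in>S. if h = ?h then (if q = ?q then c h q ?b else 0) else 0)"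
      by (intro sum.cong refl) (auto simp: sum.delta)
    also have "\<dots> = (\<Sum>h\<in>histories n. if h = ?h then c h ?q ?b else 0)"
      using finite_qualities quality_in[of "Suc n" w] w by (intro sum.cong refl) (auto simp: sum.delta)
    also have "\<dots> = c ?h ?q ?b"
      using finite_histories reviews_in_histories[OF w] by (simp add: sum.delta)
    also have "\<dots> = regret_at (Suc n) w"
      unfolding c_def regret_at_def utility_def belief_eq buys_def by simp
    finally show ?thesis by simp
  qed
  have int: "integrable W (\<lambda>w. c h q b * indicator (?Q q \<inter> hist n h \<inter> T b) w)" for h q b
    using Q T past_events by (intro integrable_mult_right integrable_real_indicator) (auto simp: emeasure_eq_measure)
  have val: "(\<integral>w. c h q b * indicator (?Q q \<inter> hist n h \<inter> T b) w \<partial>W) = c h q b * prob (?Q q \<inter> hist n h \<inter> T b)" for h q b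
  proof -
    have "?Q q \<inter> hist n h \<inter> T b \<inter> space W = ?Q q \<inter> hist n h \<inter> T b" by auto
    then show ?thesis by simp
  qed
  have "(\<integral>w. regret_at (Suc n) w \<partial>W) = (\<integral>w. f w \<partial>W)"
    using f by (intro Bochner_Integration.integral_cong refl)
  also have "\<dots> = (\<Sum>h\<in>histories n. \<Sum>q\<in>S. \<Sum>b\<in>UNIV. c h q b * prob (?Q q \<inter> hist n h \<inter> T b))"
    unfolding f_def using int by (simp only: Bochner_Integration.integral_sum Bochner_Integration.integrable_sum val)
  also have "\<dots> \<ge> (\<Sum>h\<in>histories n. M * real d / 2 * (1 - \<alpha>) * min (prob (?Q (zeros d) \<inter> hist n h)) (prob (?Q (ones d) \<inter> hist n h)))"
  proof (rule sum_mono)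
    fix h
    let ?min = "min (prob (?Q (zeros d) \<inter> hist n h)) (prob (?Q (ones d) \<inter> hist n h))"
    obtain q where q: "q \<in> S" "c h q False = M * real d / 2" "?min \<le> prob (?Q q \<inter> hist n h)"
    proof (cases "buys ?m (bel n h) 0")
      case True
      have "(\<Sum>i=1..d. zeros d i) = 0" by (intro sum.neutral) auto
      then have "c h (zeros d) False = M * real d / 2"
        using True M by (simp add: c_def)
      then show ?thesis by (intro that[of "zeros d"]) auto
    next
      case False
      have "(\<Sum>i=1..d. ones d i) = real d" by simp
      then have "c h (ones d) False = M * real d / 2"
        using False M by (simp add: c_def)
      then show ?thesis by (intro that[of "ones d"]) auto
    qed
    have "M * real d / 2 * (1 - \<alpha>) * ?min \<le> M * real d / 2 * (1 - \<alpha>) * prob (?Q q \<inter> hist n h)"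
      using q(3) M \<alpha> by (intro mult_left_mono) auto
    also have "\<dots> = c h q False * prob (?Q q \<inter> hist n h \<inter> T False)"
      unfolding pT q(2) by simp
    also have "\<dots> \<le> (\<Sum>b\<in>UNIV. c h q b * prob (?Q q \<inter> hist n h \<inter> T b))"
      using c0 by (intro member_le_sum) auto
    also have "\<dots> \<le> (\<Sum>q\<in>S. \<Sum>b\<in>UNIV. c h q b * prob (?Q q \<inter> hist n h \<inter> T b))"
      using c0 finite_qualities q(1) by (intro member_le_sum) (auto intro!: sum_nonneg)
    finally show "M * real d / 2 * (1 - \<alpha>) * ?min \<le> (\<Sum>q\<in>S. \<Sum>b\<in>UNIV. c h q b * prob (?Q q \<inter> hist n h \<inter> T b))" .
  qed
  finally show ?thesis unfolding ambiguity_def sum_distrib_left .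
qed

end

section \<open>Construction of the process\<close>

lemma path_events_subset:
  assumes X: "\<And>t. t \<ge> 1 \<Longrightarrow> X t \<in> measurable N' N" and space: "space N' = space W"
  shows "path_events W N X \<subseteq> sets N'"
proof -
  let ?f = "\<lambda>w. \<lambda>t\<in>{1..}. X t w"
  have f: "?f \<in> measurable N' (Pi\<^sub>M {1..} (\<lambda>_. N))"
    using X by (intro measurable_restrict) auto
  have "?f \<in> space W \<rightarrow> space (Pi\<^sub>M {1..} (\<lambda>_. N))"
    using measurable_space[OF f] space by auto
  from sets_vimage_algebra2[OF this] show ?thesis
    unfolding path_events_def using measurable_sets[OF f] space by auto
qed

section \<open>Independent real coordinates\<close>

locale coordinate_process =
  fixes \<kappa> :: "nat \<Rightarrow> real pmf"
begin

definition \<Omega> :: "(nat \<Rightarrow> real) measure" where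
  "\<Omega> = Pi\<^sub>M UNIV (\<lambda>i. measure_pmf (\<kappa> i))"

sublocale prob_space \<Omega>
  unfolding \<Omega>_def by (rule prob_space_PiM) (rule measure_pmf.prob_space_axioms)

definition coordinate_events :: "nat \<Rightarrow> (nat \<Rightarrow> real) set set" where
  "coordinate_events i = {{w. w i \<in> A} | A. True}"

definition generated :: "nat set \<Rightarrow> (nat \<Rightarrow> real) measure" where
  "generated I = sigma UNIV (\<Union>i\<in>I. coordinate_events i)"

lemma space_\<Omega> [simp]: "space \<Omega> = UNIV"
  by (simp add: \<Omega>_def space_PiM)

lemma space_generated [simp]: "space (generated I) = UNIV"
  by (simp add: generated_def)

lemma sets_generated: "sets (generated I) = sigma_sets UNIV (\<Union>i\<in>I. coordinate_events i)"
  by (simp add: generated_def)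

lemma measurable_coordinate: "(\<lambda>w. w i) \<in> measurable \<Omega> (measure_pmf (\<kappa> i))"
  unfolding \<Omega>_def by (rule measurable_component_singleton) simp

lemma distr_coordinate: "distr \<Omega> (measure_pmf (\<kappa> i)) (\<lambda>w. w i) = measure_pmf (\<kappa> i)"
  unfolding \<Omega>_def by (rule distr_PiM_component) (auto simp: measure_pmf.prob_space_axioms)

lemma prob_coordinate: "prob {w. w i \<in> A} = measure (measure_pmf (\<kappa> i)) A"
proof -
  have "measure (measure_pmf (\<kappa> i)) A = measure (distr \<Omega> (measure_pmf (\<kappa> i)) (\<lambda>w. w i)) A"
    by (simp add: distr_coordinate)
  also have "\<dots> = prob ((\<lambda>w. w i) -` A \<inter> space \<Omega>)"
    by (rule measure_distr[OF measurable_coordinate]) simp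
  finally show ?thesis by (simp add: vimage_def)
qed

lemma coordinate_events_eq:
  "coordinate_events i = {(\<lambda>w. w i) -` A \<inter> space \<Omega> | A. A \<in> sets (measure_pmf (\<kappa> i))}"
  by (simp add: coordinate_events_def vimage_def)

lemma indep_coordinate_events: "indep_sets coordinate_events UNIV"
proof -
  have "indep_vars (\<lambda>i. measure_pmf (\<kappa> i)) (\<lambda>i w. w i) UNIV"
  proof (subst indep_vars_iff_distr_eq_PiM)
    have "distr \<Omega> (Pi\<^sub>M UNIV (\<lambda>i. measure_pmf (\<kappa> i))) (\<lambda>x. \<lambda>i\<in>UNIV. x i) = distr \<Omega> \<Omega> (\<lambda>x. x)"
      by (simp add: \<Omega>_def restrict_UNIV)
    also have "\<dots> = Pi\<^sub>M UNIV (\<lambda>i. distr \<Omega> (measure_pmf (\<kappa> i)) (\<lambda>w. w i))"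
      by (simp add: distr_id2 distr_coordinate \<Omega>_def[symmetric])
    finally show "distr \<Omega> (Pi\<^sub>M UNIV (\<lambda>i. measure_pmf (\<kappa> i))) (\<lambda>x. \<lambda>i\<in>UNIV. x i) =
        Pi\<^sub>M UNIV (\<lambda>i. distr \<Omega> (measure_pmf (\<kappa> i)) (\<lambda>w. w i))" .
  qed (simp, rule measurable_coordinate)
  then show ?thesis unfolding indep_vars_def2 coordinate_events_eq[symmetric] by blast
qed

lemma indep_generated:
  assumes "disjoint_family_on I J"
  shows "indep_sets (\<lambda>j. sets (generated (I j))) J"
proof -
  have "indep_sets (\<lambda>j. sigma_sets (space \<Omega>) (\<Union>i\<in>I j. coordinate_events i)) J"
  proof (rule indep_sets_collect_sigma[OF _ _ assms])
    show "indep_sets coordinate_events (\<Union>j\<in>J. I j)"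
      by (rule indep_sets_mono_index[OF _ indep_coordinate_events]) simp
    show "Int_stable (coordinate_events i)" for i
      unfolding coordinate_events_eq by (rule Int_stable_vimages)
  qed
  then show ?thesis by (simp add: sets_generated)
qed

text \<open>All measures \<open>measure_pmf q\<close> on the reals share the sigma-algebra of all
  sets, so any \<open>q\<close> can serve as target.\<close>

lemma measurable_generated: "i \<in> I \<Longrightarrow> (\<lambda>w. w i) \<in> measurable (generated I) (measure_pmf q)"
proof (rule measurableI)
  fix A assume "i \<in> I"
  then have "{w. w i \<in> A} \<in> (\<Union>i\<in>I. coordinate_events i)" by (auto simp: coordinate_events_def)
  then show "(\<lambda>w. w i) -` A \<inter> space (generated I) \<in> sets (generated I)"
    by (simp add: sets_generated vimage_def)
qed simp

lemma iid_coordinates: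
  assumes f: "inj f" and q: "\<And>t. t \<ge> 1 \<Longrightarrow> \<kappa> (f t) = q"
  shows "iid \<Omega> (measure_pmf q) (\<lambda>t w. w (f t))"
  unfolding iid_def
proof (intro conjI allI impI)
  show "distr \<Omega> (measure_pmf q) (\<lambda>w. w (f t)) = measure_pmf q" if "1 \<le> t" for t
    using distr_coordinate[of "f t"] q[OF that] by simp
  show "indep_vars (\<lambda>_. measure_pmf q) (\<lambda>t w. w (f t)) {1..}"
    unfolding indep_vars_def2
  proof (intro conjI ballI)
    show "random_variable (measure_pmf q) (\<lambda>w. w (f t))" if "t \<in> {1..}" for t
      using measurable_coordinate[of "f t"] q[of t] that by simp
    have "indep_sets (\<lambda>t. sets (generated {f t})) {1..}"
      using f by (intro indep_generated) (auto simp: disjoint_family_on_def inj_def)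
    then show "indep_sets (\<lambda>t. {(\<lambda>w. w (f t)) -` A \<inter> space \<Omega> |A. A \<in> sets (measure_pmf q)}) {1..}"
    proof (rule indep_sets_mono_sets)
      fix t
      show "{(\<lambda>w. w (f t)) -` A \<inter> space \<Omega> |A. A \<in> sets (measure_pmf q)} \<subseteq> sets (generated {f t})"
        using measurable_sets[OF measurable_generated[of "f t" "{f t}" q]] by auto
    qed
  qed
qed

end

text \<open>
  Coordinate \<open>3 t\<close> drives the quality at time \<open>t\<close>, coordinates \<open>3 t + 1\<close> and \<open>3 t + 2\<close> are the preference
  and the noise of consumer \<open>t\<close>; \<open>dec\<close> decodes a real number into the initial quality.
\<close>

primrec chain :: "nat \<Rightarrow> (real \<Rightarrow> vec) \<Rightarrow> nat \<Rightarrow> (nat \<Rightarrow> real) \<Rightarrow> vec" where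
  "chain d dec 0 w = zeros d"
| "chain d dec (Suc t) w = (if t = 0 then dec (w 3) else move d (w (3 * Suc t)) (chain d dec t w))"

text \<open>The chain is an iteration of random maps \<open>move d x\<close> driven by coordinates
  of its own, which gives the Markov property and the independence from preferences and noises at
  once.\<close>

lemma exists_reset_process:
  fixes d :: nat and \<alpha> p M \<eta> :: real
  shows "\<exists>X :: (nat \<Rightarrow> real, real, real) process.
    dynamics (coin_market d \<alpha> p M) (uniform_prior d) (reset_transition d \<eta>) X"
proof -
  let ?S = "qualities d"
  \<comment> \<open>Coordinates are real, so the initial quality is passed through a number:
    \<open>init\<close> encodes the uniform prior by \<open>to_nat_on\<close>, and
    \<open>dec\<close> inverts the encoding.\<close>
  define dec :: "real \<Rightarrow> vec" where "dec x = from_nat_into ?S (nat \<lfloor>x\<rfloor>)" for x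
  define init where "init = map_pmf (\<lambda>q. real (to_nat_on ?S q)) (uniform_prior d)"
  define \<kappa> where "\<kappa> i = (if i mod 3 = 1 then bit_pmf \<alpha> else if i mod 3 = 2 then bit_pmf p
      else if i = 3 then init else reset_pmf \<eta>)" for i :: nat
  have cS: "countable ?S" by (rule countable_finite[OF finite_qualities])
  have dec_in: "dec x \<in> ?S" for x unfolding dec_def by (rule from_nat_into[OF qualities_nonempty])
  have dec: "map_pmf dec init = uniform_prior d"
  proof -
    have "map_pmf dec init = map_pmf (\<lambda>q. q) (uniform_prior d)"
      unfolding init_def pmf.map_comp
      by (rule map_pmf_cong[OF refl])
        (use cS finite_qualities qualities_nonempty in \<open>auto simp: dec_def uniform_prior_def set_pmf_of_set\<close>)
    then show ?thesis by (simp add: map_pmf_ident)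
  qed
  interpret coordinate_process \<kappa> .
  let ?Q = "chain d dec"
  define X :: "(nat \<Rightarrow> real, real, real) process" where
    "X = \<lparr>sample = \<Omega>, quality = ?Q, preference = (\<lambda>t w. w (3 * t + 1)), noise = (\<lambda>t w. w (3 * t + 2))\<rparr>"
  have chain_in: "?Q t w \<in> ?S" for t w
    by (induction t) (auto simp: dec_in move_def)
  \<comment> \<open>\<open>I\<close> only has to contain the coordinates that drive the chain up to
    \<open>t\<close>. This serves the Markov property, with \<open>{..<3 * Suc t}\<close>, and the
    independence of the three sequences, with the multiples of 3.\<close>
  have chain_meas: "?Q t \<in> measurable (generated I) (count_space ?S)" if "\<And>s. s \<in> {1..t} \<Longrightarrow> 3 * s \<in> I" for t I
    using that
  proof (induction t)
    case 0
    have "?Q 0 = (\<lambda>_. zeros d)" by auto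
    then show ?case by simp
  next
    case (Suc t)
    show ?case
    proof (cases "t = 0")
      case True
      have "dec \<in> measurable (measure_pmf init) (count_space ?S)" using dec_in by auto
      from measurable_compose[OF measurable_generated[of 3 I] this] show ?thesis
        using True Suc(2)[of 1] by simp
    next
      case False
      have "(\<lambda>w. move d (w (3 * Suc t)) q) \<in> measurable (generated I) (count_space ?S)" if "q \<in> ?S" for q
      proof -
        have "(\<lambda>x. move d x q) \<in> measurable (measure_pmf init) (count_space ?S)"
          using that by (auto simp: move_def)
        from measurable_compose[OF measurable_generated[of "3 * Suc t" I] this] show ?thesis
          using Suc(2)[of "Suc t"] by simp
      qed
      moreover have "?Q t \<in> measurable (generated I) (count_space ?S)" using Suc by simp
      ultimately have "(\<lambda>w. move d (w (3 * Suc t)) (?Q t w)) \<in> measurable (generated I) (count_space ?S)"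
        using cS by (rule measurable_compose_countable'[where f = "\<lambda>q w. move d (w (3 * Suc t)) q" and g = "?Q t"])
      then show ?thesis using False by simp
    qed
  qed
  \<comment> \<open>\<open>indep_sets\<close> includes that its members are families of events, so a
    one-element family yields the inclusion.\<close>
  have generated_sub: "sets (generated I) \<subseteq> events" for I
    using indep_generated[of "\<lambda>_. I" "{()}"] by (auto simp: indep_sets_def disjoint_family_on_def)
  have chain_event: "{w. \<forall>s\<in>{1..t}. ?Q s w = x s} \<in> sets (generated {..<3 * Suc t})" for t x
  proof -
    have "{w\<in>space (generated {..<3 * Suc t}). ?Q s w \<in> {x s}} \<in> sets (generated {..<3 * Suc t})" if "s \<in> {1..t}" for s
    proof -
      have "?Q s \<in> measurable (generated {..<3 * Suc t}) (count_space ?S)" using that by (intro chain_meas) auto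
      from measurable_sets[OF this, of "{x s} \<inter> ?S"] show ?thesis using chain_in
        by (auto simp: vimage_def Int_def conj_commute)
    qed
    then have "{w\<in>space (generated {..<3 * Suc t}). \<forall>s\<in>{1..t}. ?Q s w \<in> {x s}} \<in> sets (generated {..<3 * Suc t})"
      by (intro sets.sets_Collect_finite_All) auto
    then show ?thesis by simp
  qed
  have first: "prob {w. ?Q 1 w = q} = pmf (uniform_prior d) q" for q
  proof -
    have "prob {w. ?Q 1 w = q} = measure (measure_pmf init) {x. dec x = q}"
      using prob_coordinate[of 3 "{x. dec x = q}"] by (simp add: \<kappa>_def)
    also have "\<dots> = measure (measure_pmf (map_pmf dec init)) {q}" by (simp add: vimage_def)
    finally show ?thesis unfolding dec by (simp add: measure_pmf_single)
  qed
  \<comment> \<open>On \<open>?A\<close> the state at \<open>t\<close> is \<open>x t\<close>, so the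
    next state is a function of coordinate \<open>3 * Suc t\<close>, which lies outside the block
    that generates \<open>?A\<close>.\<close>
  have markov: "prob {w. ?Q (Suc t) w = q \<and> (\<forall>s\<in>{1..t}. ?Q s w = x s)} =
      prob {w. \<forall>s\<in>{1..t}. ?Q s w = x s} * pmf (reset_transition d \<eta> (x t)) q" if t: "t \<ge> 1" for t q x
  proof -
    let ?A = "{w. \<forall>s\<in>{1..t}. ?Q s w = x s}" and ?B = "{w. w (3 * Suc t) \<in> {y. move d y (x t) = q}}"
    have "indep_sets (\<lambda>b. sets (generated (if b then {..<3 * Suc t} else {3 * Suc t}))) UNIV"
      by (intro indep_generated) (auto simp: disjoint_family_on_def)
    then have "indep_set (sets (generated {..<3 * Suc t})) (sets (generated {3 * Suc t}))"
      unfolding indep_set_def by (rule indep_sets_cong[THEN iffD1, rotated -1]) (auto split: bool.split)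
    moreover have "?B \<in> sets (generated {3 * Suc t})"
      using measurable_sets[OF measurable_generated[of "3 * Suc t" "{3 * Suc t}" init], of "{y. move d y (x t) = q}"]
      by (simp add: vimage_def)
    ultimately have "prob (?A \<inter> ?B) = prob ?A * prob ?B" by (rule indep_setD[OF _ chain_event])
    moreover have "{w. ?Q (Suc t) w = q \<and> (\<forall>s\<in>{1..t}. ?Q s w = x s)} = ?A \<inter> ?B"
      using t by auto
    moreover have "prob ?B = pmf (reset_transition d \<eta> (x t)) q"
    proof -
      have "prob ?B = measure (measure_pmf (reset_pmf \<eta>)) {y. move d y (x t) = q}"
        using prob_coordinate[of "3 * Suc t" "{y. move d y (x t) = q}"] t by (simp add: \<kappa>_def)
      also have "\<dots> = measure (measure_pmf (reset_transition d \<eta> (x t))) {q}"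
        by (simp add: reset_transition_def vimage_def)
      finally show ?thesis by (simp add: measure_pmf_single)
    qed
    ultimately show ?thesis by simp
  qed
  have "markov_chain \<Omega> ?S (uniform_prior d) (reset_transition d \<eta>) ?Q"
    unfolding markov_chain_def
  proof (intro conjI allI impI ballI)
    fix t :: nat assume "1 \<le> t"
    have "?Q t \<in> measurable (generated UNIV) (count_space ?S)" by (rule chain_meas) simp
    then show "?Q t \<in> measurable \<Omega> (count_space ?S)"
      using generated_sub[of UNIV] by (auto simp: measurable_def)
  next
    fix q show "\<P>(w in \<Omega>. ?Q 1 w = q) = pmf (uniform_prior d) q" using first by simp
  next
    fix t x q assume t: "1 \<le> t" and pos: "\<P>(w in \<Omega>. \<forall>s\<in>{1..t}. ?Q s w = x s) > 0"
    show "\<P>(w in \<Omega>. ?Q (Suc t) w = q \<bar> \<forall>s\<in>{1..t}. ?Q s w = x s) = pmf (reset_transition d \<eta> (x t)) q"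
      using pos markov[OF t, of q x] unfolding cond_prob_def by (simp del: chain.simps)
  qed
  moreover have "iid \<Omega> (measure_pmf (bit_pmf \<alpha>)) (\<lambda>t w. w (3 * t + 1))"
    by (rule iid_coordinates) (auto simp: inj_def \<kappa>_def)
  moreover have "iid \<Omega> (measure_pmf (bit_pmf p)) (\<lambda>t w. w (3 * t + 2))"
  proof (rule iid_coordinates)
    fix t :: nat
    have "(3 * t + 2) mod 3 = 2" by presburger
    then show "\<kappa> (3 * t + 2) = bit_pmf p" unfolding \<kappa>_def by simp
  qed (simp add: inj_def)
  moreover have "indep_sets (\<lambda>k. if k = 0 then path_events \<Omega> (count_space ?S) ?Q
            else if k = 1 then path_events \<Omega> (measure_pmf (bit_pmf \<alpha>)) (\<lambda>t w. w (3 * t + 1))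
            else path_events \<Omega> (measure_pmf (bit_pmf p)) (\<lambda>t w. w (3 * t + 2))) {0, 1, 2 :: nat}"
  proof (rule indep_sets_mono_sets)
    show "indep_sets (\<lambda>k. sets (generated {i. i mod 3 = k})) {0, 1, 2 :: nat}"
      by (intro indep_generated) (auto simp: disjoint_family_on_def)
    fix k assume "k \<in> {0, 1, 2 :: nat}"
    then consider "k = 0" | "k = 1" | "k = 2" by auto
    then show "(if k = 0 then path_events \<Omega> (count_space ?S) ?Q
            else if k = 1 then path_events \<Omega> (measure_pmf (bit_pmf \<alpha>)) (\<lambda>t w. w (3 * t + 1))
            else path_events \<Omega> (measure_pmf (bit_pmf p)) (\<lambda>t w. w (3 * t + 2))) \<subseteq> sets (generated {i. i mod 3 = k})"
    proof cases
      case 1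
      have "path_events \<Omega> (count_space ?S) ?Q \<subseteq> sets (generated {i. i mod 3 = 0})"
        by (intro path_events_subset chain_meas) auto
      then show ?thesis using 1 by simp
    next
      case 2
      have "path_events \<Omega> (measure_pmf (bit_pmf \<alpha>)) (\<lambda>t w. w (3 * t + 1)) \<subseteq> sets (generated {i. i mod 3 = 1})"
        by (intro path_events_subset measurable_generated) auto
      then show ?thesis using 2 by simp
    next
      case 3
      have "3 * t + 2 \<in> {i. i mod 3 = 2}" for t :: nat
        unfolding mem_Collect_eq by presburger
      then have "path_events \<Omega> (measure_pmf (bit_pmf p)) (\<lambda>t w. w (3 * t + 2)) \<subseteq> sets (generated {i. i mod 3 = 2})"
        by (intro path_events_subset measurable_generated) simp_all
      then show ?thesis using 3 by simp
    qed
  qed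
  ultimately have "dynamics (coin_market d \<alpha> p M) (uniform_prior d) (reset_transition d \<eta>) X"
    unfolding dynamics_def X_def coin_market_simps process.select_convs
    using prob_space_axioms by blast
  then show ?thesis by blast
qed

text \<open>
  The window length \<open>n\<close> is chosen as large as possible, about \<open>ln (1 / \<eta>) / \<gamma>\<close>, such that the
  likelihood ratio \<open>exp (\<gamma> n / 2) \<le> 1 / sqrt \<eta>\<close> cannot make up for the prior odds \<open>\<eta>\<close> of a switch.
\<close>

lemma ambiguity_sum_lower_bound:
  fixes \<kappa> \<gamma> :: real
  assumes \<kappa>: "0 < \<kappa>" and \<gamma>: "0 < \<gamma>"
  shows "\<exists>c>0. \<forall>\<eta> T (a :: nat \<Rightarrow> real). 0 < \<eta> \<longrightarrow> \<eta> < 1 \<longrightarrow> 2 \<le> T \<longrightarrow> \<kappa> \<le> \<eta> * real T \<longrightarrow>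
    (\<forall>n. 0 \<le> a n) \<longrightarrow> (\<forall>n\<ge>1. \<eta> / 2 \<le> a n) \<longrightarrow>
    (\<forall>K k n. 1 \<le> K \<longrightarrow> real n * \<eta> * exp (\<gamma> / 2) ^ n \<le> K \<longrightarrow>
      real n * (\<eta> / 2 * (1 - \<eta> / 2) ^ (n - 1)) * ((1 - (1 - \<eta>) ^ k) / 2) / K \<le> a (k + n)) \<longrightarrow>
    c * (ln (2 / \<eta>) * \<eta> * real T) \<le> (\<Sum>n<T. a n)"
proof -
  \<comment> \<open>Below \<open>\<eta>\<^sub>0\<close> the four terms give, in this order:
    \<open>ln (2 / \<eta>) \<le> 2 * ln (1 / \<eta>)\<close>; a window of length at least 1;
    \<open>n * \<eta> \<le> 1\<close>, so that
    \<open>(1 - \<eta> / 2) ^ (n - 1) \<ge> 1 / 2\<close>; and a window of at most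
    \<open>T / 4\<close> periods.\<close>
  define \<eta>\<^sub>0 where "\<eta>\<^sub>0 = Min {1 / 2, exp (- \<gamma>), (\<gamma> / 2)\<^sup>2, (\<kappa> * \<gamma> / 8)\<^sup>2}"
  define K where "K = max 1 (2 / \<gamma>)"
  define D where "D = 1 - exp (- (\<kappa> / 4))"
  \<comment> \<open>The first entry is for \<open>\<eta> \<ge> \<eta>\<^sub>0\<close>. In the
    second, 96 is the product of 2 from \<open>ln (2 / \<eta>) \<le> 2 * l\<close>, 2 from rounding
    \<open>l / \<gamma>\<close> down, 8 from the window bound and 3 from
    \<open>T div 2 \<ge> T / 3\<close>.\<close>
  define c where "c = min (1 / (4 * ln (2 / \<eta>\<^sub>0))) (D / (96 * \<gamma> * K))"
  have \<eta>0: "0 < \<eta>\<^sub>0" "\<eta>\<^sub>0 \<le> 1 / 2" "\<eta>\<^sub>0 \<le> exp (- \<gamma>)" "\<eta>\<^sub>0 \<le> (\<gamma> / 2)\<^sup>2" "\<eta>\<^sub>0 \<le> (\<kappa> * \<gamma> / 8)\<^sup>2"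
    using \<kappa> \<gamma> unfolding \<eta>\<^sub>0_def by simp_all
  have K: "1 \<le> K" "2 / \<gamma> \<le> K" by (auto simp: K_def)
  have D: "0 < D" using \<kappa> by (simp add: D_def)
  have ln0: "0 < ln (2 / \<eta>\<^sub>0)" using \<eta>0 by (simp add: field_simps)
  have c: "0 < c" unfolding c_def using ln0 D \<gamma> K by simp
  have "c * (ln (2 / \<eta>) * \<eta> * real T) \<le> (\<Sum>n<T. a n)"
    if \<eta>: "0 < \<eta>" "\<eta> < 1" and T: "2 \<le> T" "\<kappa> \<le> \<eta> * real T" and a0: "\<And>n. 0 \<le> a n" and a1: "\<And>n. n \<ge> 1 \<Longrightarrow> \<eta> / 2 \<le> a n"
      and aw: "\<And>K k n. 1 \<le> K \<Longrightarrow> real n * \<eta> * exp (\<gamma> / 2) ^ n \<le> K \<Longrightarrow>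
      real n * (\<eta> / 2 * (1 - \<eta> / 2) ^ (n - 1)) * ((1 - (1 - \<eta>) ^ k) / 2) / K \<le> a (k + n)"
    for \<eta> and T and a :: "nat \<Rightarrow> real"
  proof (cases "\<eta>\<^sub>0 \<le> \<eta>")
    case True
    have ln: "0 \<le> ln (2 / \<eta>)" "ln (2 / \<eta>) \<le> ln (2 / \<eta>\<^sub>0)"
      using True \<eta> \<eta>0 by (simp_all add: frac_le)
    have "c * ln (2 / \<eta>) \<le> 1 / (4 * ln (2 / \<eta>\<^sub>0)) * ln (2 / \<eta>\<^sub>0)"
      using ln ln0 unfolding c_def by (intro mult_mono) auto
    then have cl: "c * ln (2 / \<eta>) \<le> 1 / 4" using ln0 by simp
    have "c * (ln (2 / \<eta>) * \<eta> * real T) = (c * ln (2 / \<eta>)) * (\<eta> * real T)" by simp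
    also have "\<dots> \<le> 1 / 4 * (\<eta> * real T)" using cl \<eta> by (intro mult_right_mono) auto
    \<comment> \<open>The first consumer, index 0, is left out; \<open>T \<ge> 2\<close> makes
      \<open>T - 1\<close> at least \<open>T / 2\<close>.\<close>
    also have "\<dots> \<le> real (T - 1) * (\<eta> / 2)"
    proof -
      have "real T \<le> 2 * real (T - 1)" using T(1) by (simp add: of_nat_diff)
      then have "\<eta> * real T \<le> \<eta> * (2 * real (T - 1))" using \<eta> by (intro mult_left_mono) auto
      then show ?thesis by (simp add: mult_ac)
    qed
    also have "\<dots> = (\<Sum>n\<in>{1..<T}. \<eta> / 2)" by simp
    also have "\<dots> \<le> (\<Sum>n\<in>{1..<T}. a n)" using a1 by (intro sum_mono) auto
    also have "\<dots> \<le> (\<Sum>n<T. a n)" using a0 by (intro sum_mono2) auto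
    finally show ?thesis .
  next
    case False
    define s where "s = sqrt \<eta>"
    have s: "0 < s" "s * s = \<eta>" using \<eta> by (auto simp: s_def)
    have s\<gamma>: "s \<le> \<gamma> / 2"
      unfolding s_def using False \<eta>0(4) \<gamma> by (intro real_le_lsqrt) auto
    have s\<kappa>: "s \<le> \<kappa> * \<gamma> / 8"
      unfolding s_def using False \<eta>0(5) \<gamma> \<kappa> by (intro real_le_lsqrt) auto
    define l where "l = ln (1 / \<eta>)"
    define n where "n = nat \<lfloor>l / \<gamma>\<rfloor>"
    have "\<eta> \<le> exp (- \<gamma>)" using False \<eta>0(3) by simp
    then have "ln \<eta> \<le> - \<gamma>" using \<eta> by (metis ln_exp ln_le_cancel_iff exp_gt_zero)
    then have l\<gamma>: "\<gamma> \<le> l" unfolding l_def using \<eta> by (simp add: ln_div)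
    then have l0: "0 \<le> l" using \<gamma> by simp
    have "1 \<le> l / \<gamma>" using l\<gamma> \<gamma> by simp
    then have n: "1 \<le> n" "real n \<le> l / \<gamma>" "l / \<gamma> / 2 \<le> real n"
    proof -
      have "1 \<le> \<lfloor>l / \<gamma>\<rfloor>" using \<open>1 \<le> l / \<gamma>\<close> by simp
      then have rn: "real n = of_int \<lfloor>l / \<gamma>\<rfloor>" "1 \<le> real_of_int \<lfloor>l / \<gamma>\<rfloor>" by (simp_all add: n_def)
      have "x / 2 \<le> real_of_int \<lfloor>x\<rfloor>" if "1 \<le> real_of_int \<lfloor>x\<rfloor>" for x :: real
        using that by linarith
      from this[OF rn(2)] show "l / \<gamma> / 2 \<le> real n" unfolding rn(1) .
      show "1 \<le> n" "real n \<le> l / \<gamma>" using rn by linarith+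
    qed
    have ln2: "ln (2 / \<eta>) \<le> 2 * l"
    proof -
      have "2 / \<eta> \<le> (1 / \<eta>)\<^sup>2" using False \<eta>0(2) \<eta> by (simp add: power2_eq_square field_simps)
      then have "ln (2 / \<eta>) \<le> ln ((1 / \<eta>)\<^sup>2)" using \<eta> by simp
      also have "\<dots> = 2 * l" using \<eta> by (simp add: l_def ln_realpow)
      finally show ?thesis .
    qed
    \<comment> \<open>A crude bound of the logarithm by \<open>2 / sqrt \<eta>\<close>. It leaves a
      factor \<open>s\<close> in \<open>n * \<eta>\<close>, which cancels the likelihood ratio
      \<open>1 / s\<close> below and makes \<open>K\<close> independent of \<eta>.\<close>
    have ls: "l \<le> 2 / s"
    proof -
      have "1 / \<eta> = (1 / s)\<^sup>2" using s by (simp add: power2_eq_square)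
      then have "l = 2 * ln (1 / s)" using s(1) unfolding l_def by (simp add: ln_realpow)
      also have "ln (1 / s) \<le> 1 / s - 1" using s(1) by (intro ln_le_minus_one) auto
      finally show ?thesis by simp
    qed
    have ns: "real n \<le> 2 / (\<gamma> * s)"
    proof -
      have "l / \<gamma> \<le> 2 / s / \<gamma>" using ls \<gamma> by (intro divide_right_mono) auto
      then show ?thesis using n(2) by (simp add: mult.commute)
    qed
    have e: "exp (\<gamma> / 2) ^ n \<le> 1 / s"
    proof -
      have "exp (\<gamma> / 2) ^ n = exp (real n * (\<gamma> / 2))" by (rule exp_of_nat_mult[symmetric])
      also have "\<dots> \<le> exp (l / 2)" using n(2) \<gamma> by (simp add: field_simps)
      also have "\<dots> = 1 / s"
      proof -
        have "l / 2 = ln (1 / s)" unfolding l_def using s \<eta> by (simp add: s_def ln_div ln_sqrt)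
        then show ?thesis using s(1) by simp
      qed
      finally show ?thesis .
    qed
    have n\<eta>: "real n * \<eta> \<le> 2 * s / \<gamma>"
    proof -
      have "real n * \<eta> \<le> 2 / (\<gamma> * s) * \<eta>" using ns \<eta> by (intro mult_right_mono) auto
      also have "\<dots> = 2 * s / \<gamma>" using s \<gamma> by (simp add: s(2)[symmetric])
      finally show ?thesis .
    qed
    have K': "real n * \<eta> * exp (\<gamma> / 2) ^ n \<le> K"
    proof -
      have "real n * \<eta> * exp (\<gamma> / 2) ^ n \<le> 2 * s / \<gamma> * (1 / s)"
        using n\<eta> e s \<gamma> by (intro mult_mono) auto
      also have "\<dots> = 2 / \<gamma>" using s by simp
      finally show ?thesis using K by simp
    qed
    have half: "1 / 2 \<le> (1 - \<eta> / 2) ^ (n - 1)"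
    proof -
      have "2 * s / \<gamma> \<le> 1" using s\<gamma> \<gamma> by (simp add: field_simps)
      then have "real n * \<eta> \<le> 1" using n\<eta> by simp
      moreover have "real (n - 1) * \<eta> \<le> real n * \<eta>" using \<eta> by (intro mult_right_mono) auto
      ultimately have "real (n - 1) * \<eta> \<le> 1" by (rule order_trans[rotated])
      then have "1 / 2 \<le> 1 + real (n - 1) * (- \<eta> / 2)" by simp
      also have "\<dots> \<le> (1 + - \<eta> / 2) ^ (n - 1)" using \<eta> by (intro Bernoulli_inequality) auto
      finally show ?thesis by simp
    qed
    have nT: "real n \<le> real T / 4"
    proof -
      have "8 * s \<le> \<kappa> * \<gamma>" using s\<kappa> by simp
      then have "2 / (\<gamma> * s) \<le> \<kappa> / (4 * \<eta>)"
        using s(1) \<gamma> \<eta> unfolding s(2)[symmetric] by (simp add: field_simps)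
      also have "\<dots> \<le> real T / 4" using T(2) \<eta> by (simp add: field_simps)
      finally show ?thesis using ns by simp
    qed
    \<comment> \<open>A consumer in the second half has at least \<open>T / 4\<close> periods before
      her window, enough for a reset to occur with probability at least \<open>D\<close>.\<close>
    have big: "real n * \<eta> / 8 * D / K \<le> a N" if N: "real T / 2 \<le> real N" for N
    proof -
      define k where "k = N - n"
      have k: "k + n = N" "real T / 4 \<le> real k" using N nT by (auto simp: k_def of_nat_diff)
      have "(1 - \<eta>) ^ k \<le> exp (- \<eta>) ^ k" using \<eta> exp_ge_add_one_self[of "- \<eta>"] by (intro power_mono) auto
      also have "\<dots> = exp (- (\<eta> * real k))" by (simp add: exp_of_nat_mult[symmetric] mult.commute)
      also have "\<dots> \<le> exp (- (\<kappa> / 4))"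
      proof -
        have "\<eta> * (real T / 4) \<le> \<eta> * real k" using k \<eta> by (intro mult_left_mono) auto
        then show ?thesis using T(2) by simp
      qed
      finally have A: "D / 2 \<le> (1 - (1 - \<eta>) ^ k) / 2" by (simp add: D_def)
      have "\<eta> / 2 * (1 / 2) \<le> \<eta> / 2 * (1 - \<eta> / 2) ^ (n - 1)" using half \<eta> by (intro mult_left_mono) auto
      then have B: "real n * (\<eta> / 2 * (1 / 2)) \<le> real n * (\<eta> / 2 * (1 - \<eta> / 2) ^ (n - 1))" by (rule mult_left_mono) simp
      have "real n * (\<eta> / 2 * (1 / 2)) * (D / 2) \<le> real n * (\<eta> / 2 * (1 - \<eta> / 2) ^ (n - 1)) * ((1 - (1 - \<eta>) ^ k) / 2)"
        by (rule mult_mono[OF B A]) (use \<eta> D in auto)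
      then have "real n * (\<eta> / 2 * (1 / 2)) * (D / 2) / K \<le> real n * (\<eta> / 2 * (1 - \<eta> / 2) ^ (n - 1)) * ((1 - (1 - \<eta>) ^ k) / 2) / K"
        using K by (intro divide_right_mono) auto
      also have "\<dots> \<le> a (k + n)" by (rule aw[OF K(1) K'])
      finally show ?thesis using k by simp
    qed
    have "c * (ln (2 / \<eta>) * \<eta> * real T) \<le> D / (96 * \<gamma> * K) * (2 * l * \<eta> * real T)"
    proof (intro mult_mono)
      show "c \<le> D / (96 * \<gamma> * K)" by (simp add: c_def)
    qed (use ln2 l0 \<eta> D \<gamma> K in \<open>auto intro!: mult_nonneg_nonneg\<close>)
    also have "\<dots> = real T / 3 * ((l / \<gamma> / 2) * \<eta> / 8 * D / K)" by (simp add: mult_ac)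
    also have "\<dots> \<le> real T / 3 * (real n * \<eta> / 8 * D / K)"
      using n(3) \<eta> D K by (intro mult_left_mono divide_right_mono mult_right_mono) auto
    also have "\<dots> \<le> real (T div 2) * (real n * \<eta> / 8 * D / K)"
    proof (rule mult_right_mono)
      have "T \<le> 3 * (T div 2)" using T(1) by presburger
      then have "real T \<le> real (3 * (T div 2))" by (simp only: of_nat_le_iff)
      then show "real T / 3 \<le> real (T div 2)" by simp
    qed (use \<eta> D K in auto)
    also have "\<dots> = (\<Sum>N\<in>{T - T div 2..<T}. real n * \<eta> / 8 * D / K)" by simp
    also have "\<dots> \<le> (\<Sum>N\<in>{T - T div 2..<T}. a N)"
    proof (intro sum_mono big)
      fix N assume "N \<in> {T - T div 2..<T}"
      then have "T \<le> 2 * N" by auto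
      then have "real T \<le> real (2 * N)" by (simp only: of_nat_le_iff)
      then show "real T / 2 \<le> real N" by simp
    qed
    also have "\<dots> \<le> (\<Sum>n<T. a n)" using a0 by (intro sum_mono2) auto
    finally show ?thesis .
  qed
  then show ?thesis using c by blast
qed

section \<open>Parameters of the market and the final bounds\<close>

text \<open>The equation \<open>p / (1 - p) = exp (\<gamma> / 2)\<close> makes
  \<open>2 * p - 1\<close> equal to \<open>tanh (\<gamma> / 4)\<close>. Then
  \<open>\<alpha> = \<delta> / (2 * tanh (\<gamma> / 4))\<close>, and the upper bound on \<delta>
  says exactly that \<alpha> is below 1.\<close>

lemma coin_parameters:
  fixes \<delta> \<gamma> :: real
  assumes \<delta>: "0 < \<delta>" "\<delta> < 2 * tanh (\<gamma> / 4)"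
  obtains \<alpha> p where "0 < \<gamma>" "0 < \<alpha>" "\<alpha> < 1" "1 / 2 < p" "p < 1" "p / (1 - p) = exp (\<gamma> / 2)"
    "\<alpha> * (2 * (2 * p - 1)) = \<delta>"
proof -
  define u where "u = exp (\<gamma> / 2)"
  have t: "tanh (\<gamma> / 4) > 0" using \<delta> by linarith
  then have \<gamma>: "0 < \<gamma>" by simp
  then have u: "u > 1" by (simp add: u_def)
  define p where "p = u / (1 + u)"
  have p: "1 / 2 < p" "p < 1" using u by (simp_all add: p_def field_simps)
  have "1 - p = 1 / (1 + u)" using u by (simp add: p_def field_simps)
  then have ratio: "p / (1 - p) = exp (\<gamma> / 2)" using u by (simp add: p_def u_def[symmetric])
  have "exp (- 2 * (\<gamma> / 4)) = 1 / u" by (simp add: u_def exp_minus field_simps)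
  then have "tanh (\<gamma> / 4) = (1 - 1 / u) / (1 + 1 / u)" by (simp only: tanh_real_altdef)
  also have "\<dots> = ((u - 1) / u) / ((u + 1) / u)"
    using u by (simp add: diff_divide_distrib add_divide_distrib)
  also have "\<dots> = (u - 1) / (u + 1)" using u by simp
  also have "\<dots> = 2 * p - 1" using u by (simp add: p_def divide_simps)
  finally have tp: "tanh (\<gamma> / 4) = 2 * p - 1" .
  show ?thesis
  proof (rule that[OF \<gamma> _ _ p ratio])
    show "0 < \<delta> / (2 * tanh (\<gamma> / 4))" "\<delta> / (2 * tanh (\<gamma> / 4)) < 1" using \<delta> t by simp_all
    show "\<delta> / (2 * tanh (\<gamma> / 4)) * (2 * (2 * p - 1)) = \<delta>" using t unfolding tp by simp
  qed
qed

text \<open>\<alpha>, \<open>p\<close> and \<open>c\<close> come from \<kappa>, \<delta> and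
  \<gamma> alone, so the constant \<open>(1 - \<alpha>) / 2 * c\<close> is uniform in
  \<open>d\<close>, \<open>M\<close>, \<eta> and \<open>T\<close>. The market can be fixed before
  \<eta> because only the transition matrix and the process depend on \<eta>.\<close>

theorem regret_lower_bound:
  fixes \<kappa> \<delta> \<gamma> :: real
  assumes \<kappa>: "0 < \<kappa>" and \<delta>: "0 < \<delta>" "\<delta> < 2 * tanh (\<gamma> / 4)"
  shows "\<exists>c > 0. \<forall>d \<ge> 1. \<forall>M \<ge> 0. \<exists>m :: (real, real) market.
          admissible m \<and> dim m = d \<and> delta m = \<delta> \<and> gamma m = \<gamma> \<and> lipschitz_reward m M \<and>
          (\<forall>\<eta>. 0 < \<eta> \<longrightarrow> \<eta> < 1 \<longrightarrow>
             (\<exists>P. lazy_transition d \<eta> P \<and>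
                (\<exists>X :: (nat \<Rightarrow> real, real, real) process.
                   dynamics m (uniform_prior d) P X \<and>
                   (\<forall>T \<ge> 2. \<kappa> \<le> \<eta> * real T \<longrightarrow>
                      c * (M * real d * ln (2 / \<eta>) * \<eta> * real T) \<le> regret m X T))))"
proof -
  obtain \<alpha> p where \<gamma>: "0 < \<gamma>" and \<alpha>: "0 < \<alpha>" "\<alpha> < 1" and p: "1 / 2 < p" "p < 1"
    and ratio: "p / (1 - p) = exp (\<gamma> / 2)" and \<delta>p: "\<alpha> * (2 * (2 * p - 1)) = \<delta>"
    using coin_parameters[OF \<delta>] by metis
  obtain c where c: "c > 0" and bound: "\<And>\<eta> T (a :: nat \<Rightarrow> real). 0 < \<eta> \<Longrightarrow> \<eta> < 1 \<Longrightarrow> 2 \<le> T \<Longrightarrow> \<kappa> \<le> \<eta> * real T \<Longrightarrow>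
    (\<forall>n. 0 \<le> a n) \<Longrightarrow> (\<forall>n\<ge>1. \<eta> / 2 \<le> a n) \<Longrightarrow>
    (\<forall>K k n. 1 \<le> K \<longrightarrow> real n * \<eta> * exp (\<gamma> / 2) ^ n \<le> K \<longrightarrow>
      real n * (\<eta> / 2 * (1 - \<eta> / 2) ^ (n - 1)) * ((1 - (1 - \<eta>) ^ k) / 2) / K \<le> a (k + n)) \<Longrightarrow>
    c * (ln (2 / \<eta>) * \<eta> * real T) \<le> (\<Sum>n<T. a n)"
    using ambiguity_sum_lower_bound[OF \<kappa> \<gamma>] by metis
  have main: "(1 - \<alpha>) / 2 * c * (M * real d * ln (2 / \<eta>) * \<eta> * real T) \<le> regret (coin_market d \<alpha> p M) X T"
    if d: "1 \<le> d" and M: "0 \<le> M" and \<eta>: "0 < \<eta>" "\<eta> < 1" and T: "2 \<le> T" "\<kappa> \<le> \<eta> * real T"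
      and dyn: "dynamics (coin_market d \<alpha> p M) (uniform_prior d) (reset_transition d \<eta>) X"
    for d M \<eta> T and X :: "(nat \<Rightarrow> real, real, real) process"
  proof -
    interpret prob_space "sample X" using dyn by (simp add: dynamics_def)
    interpret reset_market X d \<alpha> p M "uniform_prior d" \<eta>
      by unfold_locales (fact dyn well_formed_coin[OF d] d \<alpha> p M \<eta>)+
    have "c * (ln (2 / \<eta>) * \<eta> * real T) \<le> (\<Sum>n<T. ambiguity n)"
    proof (rule bound[OF \<eta> T], safe)
      show "0 \<le> ambiguity n" for n unfolding ambiguity_def by (intro sum_nonneg) auto
      show "\<eta> / 2 \<le> ambiguity n" if "1 \<le> n" for n using that by (rule ambiguity_ge_reset)
      show "real n * (\<eta> / 2 * (1 - \<eta> / 2) ^ (n - 1)) * ((1 - (1 - \<eta>) ^ k) / 2) / K \<le> ambiguity (k + n)"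
        if "1 \<le> K" "real n * \<eta> * exp (\<gamma> / 2) ^ n \<le> K" for K k n
        using that unfolding ratio[symmetric] by (rule ambiguity_ge_window)
    qed
    then have "M * real d / 2 * (1 - \<alpha>) * (c * (ln (2 / \<eta>) * \<eta> * real T)) \<le> M * real d / 2 * (1 - \<alpha>) * (\<Sum>n<T. ambiguity n)"
      using M \<alpha> by (intro mult_left_mono) auto
    also have "\<dots> = (\<Sum>n<T. M * real d / 2 * (1 - \<alpha>) * ambiguity n)" by (rule sum_distrib_left)
    also have "\<dots> \<le> (\<Sum>n<T. \<integral>w. regret_at (Suc n) w \<partial>W)" by (intro sum_mono expected_regret_ge)
    also have "\<dots> = regret (coin_market d \<alpha> p M) X T"
      unfolding regret_eq by (rule sum.reindex_bij_witness[of _ "\<lambda>t. t - 1" Suc]) auto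
    finally show ?thesis by (simp add: mult_ac)
  qed
  show ?thesis
  proof (intro exI[of _ "(1 - \<alpha>) / 2 * c"] conjI allI impI)
    show "0 < (1 - \<alpha>) / 2 * c" using c \<alpha> by simp
    fix d :: nat and M :: real assume d: "1 \<le> d" and M: "0 \<le> M"
    let ?m = "coin_market d \<alpha> p M"
    have "\<exists>P. lazy_transition d \<eta> P \<and> (\<exists>X :: (nat \<Rightarrow> real, real, real) process.
       dynamics ?m (uniform_prior d) P X \<and> (\<forall>T \<ge> 2. \<kappa> \<le> \<eta> * real T \<longrightarrow>
         (1 - \<alpha>) / 2 * c * (M * real d * ln (2 / \<eta>) * \<eta> * real T) \<le> regret ?m X T))"
      if \<eta>: "0 < \<eta>" "\<eta> < 1" for \<eta>
    proof -
      obtain X :: "(nat \<Rightarrow> real, real, real) process" where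
        X: "dynamics ?m (uniform_prior d) (reset_transition d \<eta>) X"
        using exists_reset_process by blast
      show ?thesis
        using lazy_reset[OF \<eta>] X main[OF d M \<eta> _ _ X] by blast
    qed
    moreover have "gamma ?m = \<gamma>" using gamma_coin[OF d \<alpha> p] by (simp add: ratio)
    moreover have "delta ?m = \<delta>" using delta_coin[OF d \<alpha> p M] \<delta>p by simp
    ultimately show "\<exists>m :: (real, real) market.
          admissible m \<and> dim m = d \<and> delta m = \<delta> \<and> gamma m = \<gamma> \<and> lipschitz_reward m M \<and>
          (\<forall>\<eta>. 0 < \<eta> \<longrightarrow> \<eta> < 1 \<longrightarrow>
             (\<exists>P. lazy_transition d \<eta> P \<and>
                (\<exists>X :: (nat \<Rightarrow> real, real, real) process.
                   dynamics m (uniform_prior d) P X \<and>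
                   (\<forall>T \<ge> 2. \<kappa> \<le> \<eta> * real T \<longrightarrow>
                      (1 - \<alpha>) / 2 * c * (M * real d * ln (2 / \<eta>) * \<eta> * real T) \<le> regret m X T))))"
      using admissible_coin[OF d \<alpha> p M] lipschitz_coin[OF M]
      by (intro exI[of _ ?m]) auto
  qed
qed

theorem theorem4p1:
  shows
    "(\<forall>\<delta> > 0. \<forall>\<gamma>. \<exists>C > 0.
        \<forall>(m :: ('th, 'e) market) (X :: ('w, 'th, 'e) process) P M \<eta> T.
          admissible m \<longrightarrow> delta m = \<delta> \<longrightarrow> gamma m = \<gamma> \<longrightarrow> lipschitz_reward m M \<longrightarrow>
          0 < \<eta> \<longrightarrow> \<eta> < 1 \<longrightarrow> lazy_transition (dim m) \<eta> P \<longrightarrow>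
          dynamics m (uniform_prior (dim m)) P X \<longrightarrow> 1 \<le> T \<longrightarrow>
          regret m X T \<le> C * (M * real (dim m) * max 1 (ln (2 / \<eta>) * \<eta> * real T)))
     \<and>
     (\<forall>\<kappa> > 0. \<forall>\<delta> > 0. \<forall>\<gamma>. \<delta> < 2 * tanh (\<gamma> / 4) \<longrightarrow>
        (\<exists>c > 0. \<forall>d \<ge> 1. \<forall>M \<ge> 0. \<exists>m :: (real, real) market.
          admissible m \<and> dim m = d \<and> delta m = \<delta> \<and> gamma m = \<gamma> \<and> lipschitz_reward m M \<and>
          (\<forall>\<eta>. 0 < \<eta> \<longrightarrow> \<eta> < 1 \<longrightarrow>
             (\<exists>P. lazy_transition d \<eta> P \<and>
                (\<exists>X :: (nat \<Rightarrow> real, real, real) process.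
                   dynamics m (uniform_prior d) P X \<and>
                   (\<forall>T \<ge> 2. \<kappa> \<le> \<eta> * real T \<longrightarrow>
                      c * (M * real d * ln (2 / \<eta>) * \<eta> * real T) \<le> regret m X T))))))"
proof (intro conjI allI impI)
  fix \<delta> \<gamma> :: real assume \<delta>: "0 < \<delta>"
  obtain C where "C > 0" and C: "\<And>(m :: ('th, 'e) market) (X :: ('w, 'th, 'e) process) \<pi>\<^sub>1 P M \<eta> T.
      well_formed m \<Longrightarrow> delta m = \<delta> \<Longrightarrow> lipschitz_reward m M \<Longrightarrow> 0 < \<eta> \<Longrightarrow> \<eta> < 1 \<Longrightarrow>
      lazy_transition (dim m) \<eta> P \<Longrightarrow> dynamics m \<pi>\<^sub>1 P X \<Longrightarrow>
      regret m X T \<le> C * (M * real (dim m) * max 1 (ln (2 / \<eta>) * \<eta> * real T))"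
    using regret_upper_bound[OF \<delta>, where 'th = 'th and 'e = 'e and 'w = 'w] by blast
  show "\<exists>C > 0. \<forall>(m :: ('th, 'e) market) (X :: ('w, 'th, 'e) process) P M \<eta> T.
      admissible m \<longrightarrow> delta m = \<delta> \<longrightarrow> gamma m = \<gamma> \<longrightarrow> lipschitz_reward m M \<longrightarrow>
      0 < \<eta> \<longrightarrow> \<eta> < 1 \<longrightarrow> lazy_transition (dim m) \<eta> P \<longrightarrow>
      dynamics m (uniform_prior (dim m)) P X \<longrightarrow> 1 \<le> T \<longrightarrow>
      regret m X T \<le> C * (M * real (dim m) * max 1 (ln (2 / \<eta>) * \<eta> * real T))"
    using \<open>C > 0\<close> C unfolding admissible_def by blast
qed (rule regret_lower_bound)

end
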